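(* Let $\ell\ge0$, $n=[\ell/2]$, let $({\bf s},\ell)=(s_0,\dots,s_\ell)$ be a normalized sequence of real numbers such that $\det S_n\neq0$, let $\kappa\ge 0$ be an integer and let $\nu_-=\nu_-(S_n)$. Then the moment problem $MP_\kappa({\bf s},\ell)$ is solvable if and only if $\kappa\ge\nu_-$. Moreover the sets $\mathcal M_\kappa({\bf s},\ell)$ and $\mathcal I_\kappa({\bf s},\ell)$ are parametrized by the formula $$\varphi(\lambda)=\frac{w^{(N)}_{11}(\lambda)\tau(\lambda)+w^{(N)}_{12}(\lambda)}{w^{(N)}_{21}(\lambda)\tau(\lambda)+w^{(N)}_{22}(\lambda)},$$ where $W_{[1,N]}(\lambda)=(w^{(N)}_{ik}(\lambda))_{i,k=1}^2$, in the following way. If $\ell$ is even: $\varphi\in\mathcal M_\kappa({\bf s},\ell)$ if and only if $\tau\in\mathbf N_{\kappa-\nu_-}$ and $\tau$ satisfies (E) $\tau(\lambda)=o(\lambda)$ as $\lambda\hat\to\infty$. If $\ell$ is odd: $\varphi\in\mathcal I_\kappa({\bf s},\ell)$ if and only if $\tau\in\mathbf N_{\kappa-\nu_-}$ and $\tau$ satisfies (O) $\tau(\lambda)=o(1)$ as $\lambda\hat\to\infty$; and $\varphi\in\mathcal M_\kappa({\bf s},\ell)$ if and only if $\tau\in\mathbf N_{\kappa-\nu_-,1}$ and $\tau$ satisfies (O).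
   Context: General notation. $S_k=(s_{i+j})_{i,j=0}^k$; $\nu_-(A)$ is the number of negative eigenvalues (with multiplicities) of a Hermitian matrix $A$. A sequence is normalized if its first nonzero element has modulus $1$. $T(c_0,\dots,c_k)$ is the upper triangular Toeplitz matrix of order $k+1$ with entries $c_{j-i}$ for $i\le j$ and $0$ for $i>j$. $\lambda\hat\to\infty$ means that $\lambda\to\infty$ nontangentially ($\delta<\arg\lambda<\pi-\delta$, $\delta>0$). Function classes. $\mathbf N_\kappa$ ($\kappa\ge0$ integer; $\mathbf N_\kappa=\emptyset$ for $\kappa<0$) is the class of functions $\varphi$ meromorphic on $\mathbb C_+$ (extended to $\mathbb C_-$ by $\varphi(\bar\lambda)=\overline{\varphi(\lambda)}$) whose kernel $\frac{\varphi(\lambda)-\overline{\varphi(\omega)}}{\lambda-\bar\omega}$ has $\kappa$ negative squares on $\mathbb C_+$: for all points $\lambda_1,\dots,\lambda_m\in\mathbb C_+$ of holomorphy the matrix $\left(\frac{\varphi(\lambda_i)-\overline{\varphi(\lambda_k)}}{\lambda_i-\bar\lambda_k}\right)_{i,k=1}^m$ has at most $\kappa$, and for some choice exactly $\kappa$, negative eigenvalues. Subclasses: $\mathbf N_{\kappa,1}$ consists of $\varphi\in\mathbf N_\kappa$ with $\lim_{z\hat\to\infty}\varphi(z)/z=0$ and $\int_\eta^\infty\frac{|\mathrm{Im}\,\varphi(iy)|}{y}dy<\infty$ for $\eta>0$ large enough; $\mathbf N_{\kappa,0}$ consists of $\varphi\in\mathbf N_\kappa$ with $\lim_{z\hat\to\infty}\varphi(z)/z=0$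 and $\limsup_{z\hat\to\infty}|z\,\mathrm{Im}\,\varphi(z)|<\infty$. For $k\ge1$, $\varphi\in\mathbf N_\kappa$ belongs to $\mathbf N_{\kappa,-2k}$ if there are real $\gamma,c_0,\dots,c_{2k-1}$ such that $\varphi^{[2k]}(z):=z^{2k}\left(\varphi(z)-\gamma+\sum_{j=1}^{2k}c_{j-1}z^{-j}\right)$ is $O(1/z)$ as $z\hat\to\infty$, and to $\mathbf N_{\kappa,-2k+1}$ if for some such real numbers $\varphi^{[2k]}\in\mathbf N_{\kappa',1}$ for some $\kappa'\le\kappa$. Problems. $\mathcal I_\kappa({\bf s},\ell)$ is the set of $\varphi\in\mathbf N_\kappa$ with $\varphi(\lambda)=-\frac{s_0}{\lambda}-\dots-\frac{s_\ell}{\lambda^{\ell+1}}+o\left(\frac1{\lambda^{\ell+1}}\right)$ as $\lambda\hat\to\infty$ (solutions of the interpolation problem $IP_\kappa({\bf s},\ell)$). $\mathcal M_\kappa({\bf s},\ell)$ is the set of $\varphi\in\mathbf N_{\kappa,-\ell}$ with the same expansion (solutions of the moment problem $MP_\kappa({\bf s},\ell)$). For even $\ell$ the two sets coincide. A problem is solvable if its solution set is nonempty. The matrix $W_{[1,N]}$. Let $0<n_1<\dots<n_N=n+1$ be all normal indices of $S_n$, i.e. all $j\in\{1,\dots,n+1\}$ with $\det S_{j-1}\ne0$; put $n_0=0$, ${\bf s}^{(0)}={\bf s}$. For $j=1,\dots,N-1$ let $d_j=n_j-n_{j-1}$, which is the smallest $d$ with $s^{(j-1)}_{d-1}\ne0$,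 put $\varepsilon_j=s^{(j-1)}_{d_j-1}\in\{\pm1\}$, and, with $r=\ell-2n_{j-1}$, determine the monic polynomial $p_j(\lambda)=\sum_{i=0}^{d_j}p_i^{(j)}\lambda^i$ and real numbers $u_0,\dots,u_{r-2d_j}$ uniquely by $$T(s^{(j-1)}_{d_j-1},\dots,s^{(j-1)}_r)\,T(p^{(j)}_{d_j},\dots,p^{(j)}_0,-\varepsilon_ju_0,\dots,-\varepsilon_ju_{r-2d_j})=\varepsilon_jI_{r-d_j+2};$$ then choose $a_j>0$ so that ${\bf s}^{(j)}=(u_i/a_j^2)_{i=0}^{\ell-2n_j}$ is normalized. At the last step, with $m=n-n_{N-1}$, one has $s^{(N-1)}_i=0$ for $i<m$ and $\varepsilon_N:=s^{(N-1)}_m=\pm1$; put $a_N=1$ and $$p_N(\lambda)=\frac1{\det (s^{(N-1)}_{i+k})_{i,k=0}^m}\det\begin{pmatrix}s^{(N-1)}_0&\dots&s^{(N-1)}_{m+1}\\ \vdots&&\vdots\\ s^{(N-1)}_m&\dots&s^{(N-1)}_{2m+1}\\1&\dots&\lambda^{m+1}\end{pmatrix},$$ where $s^{(N-1)}_{2m+1}$ is an arbitrary fixed real number if $\ell$ is even. Finally $$W_j(\lambda)=\begin{pmatrix}0&-\varepsilon_j/a_j\\ \varepsilon_ja_j&p_j(\lambda)/a_j\end{pmatrix},\qquad W_{[1,N]}(\lambda)=W_1(\lambda)\cdots W_N(\lambda).$$ *)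

theory Defs
  imports
    "Jordan_Normal_Form.Char_Poly"
    "HOL-Complex_Analysis.Complex_Analysis"
    "HOL-Library.Landau_Symbols"
begin

unbundle no fps_syntax

section \<open>Hankel and Toeplitz matrices, negative eigenvalues\<close>

text \<open>A finite sequence \<open>(s, l) = (s_0, \<dots>, s_l)\<close> is the list of its \<open>l + 1\<close> entries.\<close>

definition hankel :: "real list \<Rightarrow> nat \<Rightarrow> real Matrix.mat" where
  "hankel s k = Matrix.mat (k + 1) (k + 1) (\<lambda>(i, j). s ! (i + j))"

definition toeplitz :: "real list \<Rightarrow> real Matrix.mat" where
  "toeplitz c = Matrix.mat (length c) (length c) (\<lambda>(i, j). if i \<le> j then c ! (j - i) else 0)"

text \<open>Meant for Hermitian matrices, whose algebraic and geometric multiplicities agree.\<close>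

definition neg_eigs :: "complex Matrix.mat \<Rightarrow> nat" where
  "neg_eigs A = (\<Sum>x | x < 0 \<and> poly (char_poly A) (complex_of_real x) = 0.
                   Polynomial.order (complex_of_real x) (char_poly A))"

definition normalized :: "real list \<Rightarrow> bool" where
  "normalized s \<longleftrightarrow> (\<exists>k<length s. \<bar>s ! k\<bar> = 1 \<and> (\<forall>i<k. s ! i = 0))"


section \<open>Meromorphic functions on the upper half-plane\<close>

abbreviation upper_half :: "complex set" (\<open>\<complex>\<^sub>+\<close>) where
  "\<complex>\<^sub>+ \<equiv> {z. Im z > 0}"

text \<open>
  Meromorphic functions on \<open>\<complex>\<^sub>+\<close>, extended by symmetry to the lower half-plane. Each is
  represented by exactly one HOL function: removable singularities are removed, and the value
  is 0 at poles and on the real line, where the function is undefined.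
\<close>

definition mero_sym :: "(complex \<Rightarrow> complex) set" where
  "mero_sym = {\<phi>. \<phi> nicely_meromorphic_on \<complex>\<^sub>+ \<and>
                   (\<forall>z\<in>\<complex>\<^sub>+. \<phi> (cnj z) = cnj (\<phi> z)) \<and> (\<forall>z. Im z = 0 \<longrightarrow> \<phi> z = 0)}"

text \<open>The representative of the meromorphic function that \<open>f\<close> defines on \<open>\<complex>\<^sub>+\<close>.\<close>

definition sym_ext :: "(complex \<Rightarrow> complex) \<Rightarrow> complex \<Rightarrow> complex" where
  "sym_ext f z = (if Im z > 0 then remove_sings f z
                  else if Im z < 0 then cnj (remove_sings f (cnj z)) else 0)"

text \<open>
  The nontangential limit at \<open>\<infinity>\<close> is the limit along \<open>nontang \<delta>\<close> for every \<open>\<delta> > 0\<close>.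
\<close>

definition nontang :: "real \<Rightarrow> complex filter" where
  "nontang \<delta> = inf at_infinity (principal {z. \<delta> < Arg z \<and> Arg z < pi - \<delta>})"

definition nt_smallo :: "(complex \<Rightarrow> complex) \<Rightarrow> (complex \<Rightarrow> complex) \<Rightarrow> bool" where
  "nt_smallo f g \<longleftrightarrow> (\<forall>\<delta>>0. f \<in> o[nontang \<delta>](g))"

definition nt_bigo :: "(complex \<Rightarrow> complex) \<Rightarrow> (complex \<Rightarrow> complex) \<Rightarrow> bool" where
  "nt_bigo f g \<longleftrightarrow> (\<forall>\<delta>>0. f \<in> O[nontang \<delta>](g))"

definition nt_lim :: "(complex \<Rightarrow> complex) \<Rightarrow> complex \<Rightarrow> bool" where
  "nt_lim f L \<longleftrightarrow> (\<forall>\<delta>>0. (f \<longlongrightarrow> L) (nontang \<delta>))"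


section \<open>Generalized Nevanlinna classes\<close>

definition pick_matrix :: "(complex \<Rightarrow> complex) \<Rightarrow> complex list \<Rightarrow> complex Matrix.mat" where
  "pick_matrix \<phi> zs = Matrix.mat (length zs) (length zs)
     (\<lambda>(i, k). (\<phi> (zs ! i) - cnj (\<phi> (zs ! k))) / (zs ! i - cnj (zs ! k)))"

definition holo_points :: "(complex \<Rightarrow> complex) \<Rightarrow> complex set" where
  "holo_points \<phi> = {z\<in>\<complex>\<^sub>+. \<phi> analytic_on {z}}"

text \<open>The class is empty for negative \<open>\<kappa>\<close>, since \<open>neg_eigs\<close> is a natural number.\<close>

definition nev :: "int \<Rightarrow> (complex \<Rightarrow> complex) set" where
  "nev \<kappa> = {\<phi>\<in>mero_sym.
      (\<forall>zs. set zs \<subseteq> holo_points \<phi> \<longrightarrow> int (neg_eigs (pick_matrix \<phi> zs)) \<le> \<kappa>) \<and>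
      (\<exists>zs. set zs \<subseteq> holo_points \<phi> \<and> int (neg_eigs (pick_matrix \<phi> zs)) = \<kappa>)}"

definition nev_1 :: "int \<Rightarrow> (complex \<Rightarrow> complex) set" where
  "nev_1 \<kappa> = {\<phi>\<in>nev \<kappa>. nt_lim (\<lambda>z. \<phi> z / z) 0 \<and>
      (\<forall>\<^sub>F \<eta> in at_top. set_integrable lborel {\<eta>..}
          (\<lambda>y::real. \<bar>Im (\<phi> (\<i> * complex_of_real y))\<bar> / y))}"

definition nev_0 :: "int \<Rightarrow> (complex \<Rightarrow> complex) set" where
  "nev_0 \<kappa> = {\<phi>\<in>nev \<kappa>. nt_lim (\<lambda>z. \<phi> z / z) 0 \<and>
      (\<forall>\<delta>>0. Limsup (nontang \<delta>) (\<lambda>z. ereal (cmod (z * complex_of_real (Im (\<phi> z))))) < \<infinity>)}"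

text \<open>The function \<open>\<phi>^{[2k]}\<close>.\<close>

definition shifted ::
    "(complex \<Rightarrow> complex) \<Rightarrow> nat \<Rightarrow> real \<Rightarrow> (nat \<Rightarrow> real) \<Rightarrow> complex \<Rightarrow> complex" where
  "shifted \<phi> k \<gamma> c = sym_ext (\<lambda>z. z ^ (2 * k) *
      (\<phi> z - complex_of_real \<gamma> + (\<Sum>j=1..2*k. complex_of_real (c (j - 1)) / z ^ j)))"

definition nev_neg_even :: "int \<Rightarrow> nat \<Rightarrow> (complex \<Rightarrow> complex) set" where
  "nev_neg_even \<kappa> k = {\<phi>\<in>nev \<kappa>. \<exists>\<gamma> c. nt_bigo (shifted \<phi> k \<gamma> c) (\<lambda>z. 1 / z)}"

definition nev_neg_odd :: "int \<Rightarrow> nat \<Rightarrow> (complex \<Rightarrow> complex) set" where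
  "nev_neg_odd \<kappa> k = {\<phi>\<in>nev \<kappa>. \<exists>\<gamma> c. \<exists>\<kappa>'\<le>\<kappa>. shifted \<phi> k \<gamma> c \<in> nev_1 \<kappa>'}"

text \<open>\<open>nev_neg \<kappa> l\<close> is the class with indices \<open>\<kappa>\<close> and \<open>- l\<close>, for \<open>l \<ge> 0\<close>.\<close>

definition nev_neg :: "int \<Rightarrow> nat \<Rightarrow> (complex \<Rightarrow> complex) set" where
  "nev_neg \<kappa> l = (if l = 0 then nev_0 \<kappa>
                  else if even l then nev_neg_even \<kappa> (l div 2)
                  else nev_neg_odd \<kappa> ((l + 1) div 2))"


section \<open>The interpolation problem and the moment problem\<close>

definition has_expansion :: "(complex \<Rightarrow> complex) \<Rightarrow> real list \<Rightarrow> bool" where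
  "has_expansion \<phi> s \<longleftrightarrow>
     nt_smallo (\<lambda>z. \<phi> z - (\<Sum>i<length s. - complex_of_real (s ! i) / z ^ (i + 1)))
               (\<lambda>z. 1 / z ^ length s)"

definition IP_sols :: "int \<Rightarrow> real list \<Rightarrow> (complex \<Rightarrow> complex) set" where
  "IP_sols \<kappa> s = {\<phi>\<in>nev \<kappa>. has_expansion \<phi> s}"

definition MP_sols :: "int \<Rightarrow> real list \<Rightarrow> (complex \<Rightarrow> complex) set" where
  "MP_sols \<kappa> s = {\<phi>\<in>nev_neg \<kappa> (length s - 1). has_expansion \<phi> s}"


section \<open>The Schur algorithm and the resolvent matrix\<close>

definition normal_indices :: "real list \<Rightarrow> nat set" where
  "normal_indices s =
     {j\<in>{1..(length s - 1) div 2 + 1}. Determinant.det (hankel s (j - 1)) \<noteq> 0}"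

definition num_normal :: "real list \<Rightarrow> nat" where
  "num_normal s = card (normal_indices s)"

definition normal_index :: "real list \<Rightarrow> nat \<Rightarrow> nat" where
  "normal_index s j = (0 # sorted_list_of_set (normal_indices s)) ! j"

definition step_size :: "real list \<Rightarrow> nat \<Rightarrow> nat" where
  "step_size s j = normal_index s j - normal_index s (j - 1)"

text \<open>
  One step of the algorithm with \<open>t = (t_0, \<dots>, t_r)\<close>, so \<open>r - 2 d + 1 = length t - 2 d\<close> and
  \<open>r - d + 2 = length t + 1 - d\<close>.
\<close>

definition schur_pair :: "real list \<Rightarrow> nat \<Rightarrow> real poly \<times> real list" where
  "schur_pair t d = (let \<epsilon> = t ! (d - 1) in
     THE (p, u). Polynomial.degree p = d \<and> Polynomial.lead_coeff p = 1 \<and>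
       length u = length t - 2 * d \<and>
       toeplitz (drop (d - 1) t) *
         toeplitz (map (Polynomial.coeff p) (rev [0..<d + 1]) @ map (\<lambda>x. - \<epsilon> * x) u)
       = \<epsilon> \<cdot>\<^sub>m 1\<^sub>m (length t + 1 - d))"

definition schur_scale :: "real list \<Rightarrow> real" where
  "schur_scale u = (THE a. a > 0 \<and> normalized (map (\<lambda>x. x / a\<^sup>2) u))"

primrec schur_seq :: "real list \<Rightarrow> nat \<Rightarrow> real list" where
  "schur_seq s 0 = s"
| "schur_seq s (Suc j) =
     (let u = snd (schur_pair (schur_seq s j) (step_size s (Suc j)))
      in map (\<lambda>x. x / (schur_scale u)\<^sup>2) u)"

text \<open>
  The monic polynomial of degree \<open>m + 1\<close> orthogonal for \<open>t\<close>. The entry of index \<open>2 m + 1\<close> is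
  \<open>x\<close> if \<open>t\<close> has length \<open>2 m + 1\<close>; if \<open>t\<close> is longer, \<open>x\<close> is not used.
\<close>

definition last_poly :: "real list \<Rightarrow> nat \<Rightarrow> real \<Rightarrow> real poly" where
  "last_poly t m x = Polynomial.smult (1 / Determinant.det (hankel t m))
     (Determinant.det (Matrix.mat (m + 2) (m + 2)
        (\<lambda>(i, k). if i \<le> m then [:(t @ [x]) ! (i + k):] else Polynomial.monom 1 k)))"

definition W_eps :: "real list \<Rightarrow> nat \<Rightarrow> real" where
  "W_eps s j = schur_seq s (j - 1) ! (step_size s j - 1)"

definition W_a :: "real list \<Rightarrow> nat \<Rightarrow> real" where
  "W_a s j = (if j = num_normal s then 1
              else schur_scale (snd (schur_pair (schur_seq s (j - 1)) (step_size s j))))"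

definition W_p :: "real list \<Rightarrow> real \<Rightarrow> nat \<Rightarrow> real poly" where
  "W_p s x j =
     (if j = num_normal s
      then last_poly (schur_seq s (j - 1)) ((length s - 1) div 2 - normal_index s (j - 1)) x
      else fst (schur_pair (schur_seq s (j - 1)) (step_size s j)))"

definition W_factor :: "real list \<Rightarrow> real \<Rightarrow> nat \<Rightarrow> complex \<Rightarrow> complex Matrix.mat" where
  "W_factor s x j z =
     (let \<epsilon> = complex_of_real (W_eps s j); a = complex_of_real (W_a s j);
          p = poly (map_poly complex_of_real (W_p s x j)) z
      in mat_of_rows_list 2 [[0, - \<epsilon> / a], [\<epsilon> * a, p / a]])"

definition W_prod :: "real list \<Rightarrow> real \<Rightarrow> complex \<Rightarrow> complex Matrix.mat" where
  "W_prod s x z = foldr (\<lambda>j A. W_factor s x j z * A) [1..<num_normal s + 1] (1\<^sub>m 2)"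


section \<open>Parametrization by a linear fractional transformation\<close>

definition lft_den ::
    "(complex \<Rightarrow> complex Matrix.mat) \<Rightarrow> (complex \<Rightarrow> complex) \<Rightarrow> complex \<Rightarrow> complex" where
  "lft_den W \<tau> z = W z $$ (1, 0) * \<tau> z + W z $$ (1, 1)"

definition lft ::
    "(complex \<Rightarrow> complex Matrix.mat) \<Rightarrow> (complex \<Rightarrow> complex) \<Rightarrow> complex \<Rightarrow> complex" where
  "lft W \<tau> = sym_ext (\<lambda>z. (W z $$ (0, 0) * \<tau> z + W z $$ (0, 1)) / lft_den W \<tau> z)"

text \<open>The denominator does not vanish identically, so that the fraction is meromorphic.\<close>

definition lft_defined ::
    "(complex \<Rightarrow> complex Matrix.mat) \<Rightarrow> (complex \<Rightarrow> complex) \<Rightarrow> bool" where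
  "lft_defined W \<tau> \<longleftrightarrow> (\<forall>\<^sub>\<approx>z\<in>\<complex>\<^sub>+. lft_den W \<tau> z \<noteq> 0)"

text \<open>
  The solution set \<open>A\<close> is parametrized by \<open>\<tau> \<in> B\<close>: the formula is a bijection from \<open>B\<close> to \<open>A\<close>,
  and whenever it defines \<open>\<phi>\<close> from a meromorphic \<open>\<tau>\<close>, \<open>\<phi> \<in> A\<close> is equivalent to \<open>\<tau> \<in> B\<close>.
\<close>

definition parametrized_by ::
    "(complex \<Rightarrow> complex) set \<Rightarrow> (complex \<Rightarrow> complex Matrix.mat) \<Rightarrow>
     (complex \<Rightarrow> complex) set \<Rightarrow> bool" where
  "parametrized_by A W B \<longleftrightarrow>
     (\<forall>\<tau>\<in>B. lft_defined W \<tau>) \<and> bij_betw (lft W) B A \<and>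
     (\<forall>\<tau>\<in>mero_sym. lft_defined W \<tau> \<longrightarrow> (lft W \<tau> \<in> A \<longleftrightarrow> \<tau> \<in> B))"

end

theory Submission imports Defs
begin

text \<open>
  One step of the algorithm is \<open>- 1 / \<phi> = \<epsilon> p + a\<^sup>2 \<tau>\<close>. The kernels of \<open>\<phi>\<close> and \<open>- 1 / \<phi>\<close> are congruent, and the
  kernel of the polynomial \<open>\<epsilon> p\<close> is a Hermitian form in the powers of \<open>\<lambda>\<close> with matrix the Bezoutian \<open>B\<close>
  of \<open>\<epsilon> p\<close> and \<open>1\<close>. If \<open>\<tau>(\<lambda>) = o(\<lambda>)\<close>, the two summands do not interact at infinity, so \<open>\<phi>\<close> has exactly
  \<open>\<nu>\<^sub>-(B)\<close> more negative squares than \<open>\<tau>\<close>. Expanding the kernel of \<open>\<phi>\<close> at infinity gives a congruence of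
  the Hankel matrix of \<open>s\<close> with the direct sum of \<open>B\<close> and the Hankel matrix of the next sequence, so
  these numbers add up to \<open>\<nu>\<^sub>-(S\<^sub>n)\<close>. Asymptotic expansions and the integrability condition at infinity
  are passed on from \<open>\<phi>\<close> to \<open>\<tau>\<close> and back.
\<close>

text \<open>The condition \<open>\<tau>(\<lambda>) = o(\<lambda>)\<close> makes the count exact: a
  linearly growing parameter could cancel the leading term of a linear \<open>\<epsilon> p\<close>.
  A sum never has more negative squares than its summands together; the converse needs test vectors
  for the two summands that do not see each other, and these exist only in the limit of points
  running to infinity. Hence negative squares are counted by vectors whose Gram matrix is merely
  close to \<open>-I\<close>. For odd \<open>\<ell>\<close> the moment class allows arbitrary real
  coefficients and any \<open>\<kappa>' \<le> \<kappa>\<close>. The coefficients are forced except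
  the last, which adds a real constant; the bound on \<open>\<kappa>'\<close> is another limit along
  the imaginary axis. Step sizes are defined by normal indices, while the algorithm uses the first
  nonzero entry. The two agree because the Hankel congruence shifts the normal indices from one
  sequence to the next. Solvability for every \<open>\<kappa> \<ge> \<nu>\<^sub>-\<close> needs
  parameters with any number of negative squares: iterate
  \<open>\<tau> \<mapsto> - 1 / (- \<lambda> + \<tau>)\<close> from 0.\<close>

declare sum.lessThan_Suc [simp del]

section \<open>Diagonalization of Hermitian matrices\<close>

lemma index_mult_mat_sum:
  fixes A B :: "'a::semiring_0 Matrix.mat"
  assumes "A \<in> carrier_mat m n" "B \<in> carrier_mat n k" "i < m" "j < k"
  shows "(A * B) $$ (i, j) = (\<Sum>l<n. A $$ (i, l) * B $$ (l, j))"
  using assms by (auto simp: scalar_prod_def lessThan_atLeast0)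

text \<open>Padding with zero rows gives a square matrix with a zero row, hence determinant 0 and a
  nonzero kernel vector. This is the dimension count behind the orthonormal completion and behind
  every comparison of numbers of negative squares.\<close>

lemma homogeneous_system_nontrivial:
  fixes c :: "nat \<Rightarrow> nat \<Rightarrow> 'a::field"
  assumes "m < n"
  shows "\<exists>x. (\<exists>i<n. x i \<noteq> 0) \<and> (\<forall>a<m. (\<Sum>i<n. c a i * x i) = 0)"
proof -
  define A where "A = Matrix.mat n n (\<lambda>(a, i). if a < m then c a i else 0)"
  have A: "A \<in> carrier_mat n n" by (simp add: A_def)
  have "Determinant.det A = 0"
    using laplace_expansion_row[OF A assms] assms by (simp add: A_def)
  then obtain v where v: "v \<in> carrier_vec n" "v \<noteq> 0\<^sub>v n" "A *\<^sub>v v = 0\<^sub>v n"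
    using det_0_iff_vec_prod_zero_field[OF A] by auto
  have "(\<Sum>i<n. c a i * vec_index v i) = 0" if "a < m" for a
  proof -
    have "vec_index (A *\<^sub>v v) a = 0" using v that assms by simp
    moreover have "vec_index (A *\<^sub>v v) a = (\<Sum>i<n. c a i * vec_index v i)"
      using that assms v(1) by (auto simp: A_def scalar_prod_def lessThan_atLeast0)
    ultimately show ?thesis by simp
  qed
  moreover have "\<exists>i<n. vec_index v i \<noteq> 0"
    using v by (metis carrier_vecD eq_vecI index_zero_vec)
  ultimately show ?thesis by blast
qed

definition orthonormal_upto :: "nat \<Rightarrow> nat \<Rightarrow> (nat \<Rightarrow> nat \<Rightarrow> complex) \<Rightarrow> bool" where
  "orthonormal_upto n k W \<longleftrightarrow>
     (\<forall>a<k. \<forall>b<k. (\<Sum>i<n. cnj (W a i) * W b i) = (if a = b then 1 else 0))"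

lemma normalize_vector:
  fixes x :: "nat \<Rightarrow> complex"
  assumes "i < n" "x i \<noteq> 0"
  obtains r where "r > 0" "(\<Sum>i<n. cnj (of_real r * x i) * (of_real r * x i)) = 1"
proof
  define s where "s = (\<Sum>i<n. (cmod (x i))\<^sup>2)"
  have s: "s > 0" unfolding s_def using assms by (intro sum_pos2[of _ i]) auto
  show "inverse (sqrt s) > 0" using s by simp
  have "(\<Sum>i<n. cnj (of_real (inverse (sqrt s)) * x i) * (of_real (inverse (sqrt s)) * x i))
      = (\<Sum>i<n. of_real ((inverse (sqrt s))\<^sup>2 * (cmod (x i))\<^sup>2))"
    unfolding of_real_mult complex_norm_square
    by (intro sum.cong refl) (simp add: power2_eq_square mult_ac)
  also have "\<dots> = of_real ((inverse (sqrt s))\<^sup>2 * s)"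
    unfolding s_def sum_distrib_left by simp
  also have "(inverse (sqrt s))\<^sup>2 * s = 1" using s by (simp add: power_inverse)
  finally show "(\<Sum>i<n. cnj (of_real (inverse (sqrt s)) * x i) * (of_real (inverse (sqrt s)) * x i)) = 1"
    by simp
qed

text \<open>Orthogonality to the vectors already found is a homogeneous system with fewer equations
  than unknowns, so a further vector exists and only has to be normalized.\<close>

lemma orthonormal_completion:
  assumes "(\<Sum>i<n. cnj (v i) * v i) = 1" "k < n"
  shows "\<exists>W. W 0 = v \<and> orthonormal_upto n (Suc k) W"
  using assms(2)
proof (induction k)
  case 0
  show ?case by (rule exI[of _ "\<lambda>_. v"]) (use assms(1) in \<open>auto simp: orthonormal_upto_def\<close>)
next
  case (Suc k)
  then obtain W where W: "W 0 = v" "orthonormal_upto n (Suc k) W" by auto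
  obtain x where x: "\<exists>i<n. x i \<noteq> 0" "\<forall>a<Suc k. (\<Sum>i<n. cnj (W a i) * x i) = 0"
    using homogeneous_system_nontrivial[OF Suc.prems, of "\<lambda>a i. cnj (W a i)"] by blast
  then obtain r where r: "r > 0" "(\<Sum>i<n. cnj (of_real r * x i) * (of_real r * x i)) = 1"
    using normalize_vector by metis
  define W' where "W' = W(Suc k := (\<lambda>i. of_real r * x i))"
  have 1: "(\<Sum>i<n. cnj (W a i) * (of_real r * x i)) = 0" if "a < Suc k" for a
  proof -
    have "(\<Sum>i<n. cnj (W a i) * (of_real r * x i)) = of_real r * (\<Sum>i<n. cnj (W a i) * x i)"
      by (simp add: sum_distrib_left mult_ac)
    then show ?thesis using x(2) that by simp
  qed
  have 2: "(\<Sum>i<n. cnj (of_real r * x i) * W a i) = 0" if "a < Suc k" for a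
  proof -
    have "(\<Sum>i<n. cnj (of_real r * x i) * W a i) = cnj (\<Sum>i<n. cnj (W a i) * (of_real r * x i))"
      by (simp add: mult_ac)
    then show ?thesis using 1[OF that] by simp
  qed
  have "orthonormal_upto n (Suc (Suc k)) W'"
    unfolding orthonormal_upto_def W'_def
    using W(2) r(2) 1 2 by (auto simp: orthonormal_upto_def less_Suc_eq)
  moreover have "W' 0 = v" using W by (simp add: W'_def)
  ultimately show ?case by blast
qed

definition adj :: "complex Matrix.mat \<Rightarrow> complex Matrix.mat" where
  "adj A = map_mat cnj (transpose_mat A)"

lemma adj_dim [simp]: "dim_row (adj A) = dim_col A" "dim_col (adj A) = dim_row A"
  by (simp_all add: adj_def)

lemma adj_carrier [simp]: "A \<in> carrier_mat m n \<Longrightarrow> adj A \<in> carrier_mat n m"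
  by (simp add: adj_def)

lemma adj_index: "A \<in> carrier_mat m n \<Longrightarrow> i < n \<Longrightarrow> j < m \<Longrightarrow> adj A $$ (i, j) = cnj (A $$ (j, i))"
  by (auto simp: adj_def)

lemma adj_mult:
  assumes "A \<in> carrier_mat m n" "B \<in> carrier_mat n k"
  shows "adj (A * B) = adj B * adj A"
proof (rule eq_matI)
  fix i j assume "i < dim_row (adj B * adj A)" "j < dim_col (adj B * adj A)"
  then have ij: "i < k" "j < m" using assms by (auto simp: adj_def)
  have "adj (A * B) $$ (i, j) = cnj ((A * B) $$ (j, i))"
    using ij assms by (subst adj_index[of _ m k]) auto
  also have "\<dots> = (\<Sum>l<n. cnj (A $$ (j, l)) * cnj (B $$ (l, i)))"
    using ij assms by (subst index_mult_mat_sum[OF assms]) auto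
  also have "\<dots> = (\<Sum>l<n. adj B $$ (i, l) * adj A $$ (l, j))"
    using ij assms by (intro sum.cong refl) (simp add: adj_index mult.commute)
  also have "\<dots> = (adj B * adj A) $$ (i, j)"
    using ij assms by (subst index_mult_mat_sum[of _ k n]) auto
  finally show "adj (A * B) $$ (i, j) = (adj B * adj A) $$ (i, j)" .
qed (use assms in \<open>auto simp: adj_def\<close>)

lemma adj_four_block:
  assumes "A \<in> carrier_mat a b" "B \<in> carrier_mat a c" "C \<in> carrier_mat d b" "D \<in> carrier_mat d c"
  shows "adj (four_block_mat A B C D) = four_block_mat (adj A) (adj C) (adj B) (adj D)"
  by (rule eq_matI) (use assms in \<open>auto simp: adj_def\<close>)

lemma adj_one [simp]: "adj (1\<^sub>m n) = 1\<^sub>m n"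
  by (rule eq_matI) (auto simp: adj_def)

lemma adj_zero [simp]: "adj (0\<^sub>m m n) = 0\<^sub>m n m"
  by (rule eq_matI) (auto simp: adj_def)

lemma adj_adj [simp]: "adj (adj A) = A"
  by (rule eq_matI) (auto simp: adj_def)

text \<open>An eigenvector, which exists over the complex numbers, is completed to a unitary
  \<open>W\<close>. The first column of \<open>adj W * A * W\<close> is then \<open>e\<close> times
  the first unit vector; self-adjointness carries this to the first row, so a 1 by 1 block splits
  off and the induction hypothesis handles the other block.\<close>

lemma hermitian_diagonalization:
  assumes "A \<in> carrier_mat n n" "adj A = A"
  shows "\<exists>U\<in>carrier_mat n n. adj U * U = 1\<^sub>m n \<and> diagonal_mat (adj U * A * U)"
  using assms
proof (induction n arbitrary: A)
  case 0
  then show ?case by (intro bexI[of _ "1\<^sub>m 0"]) (auto simp: diagonal_mat_def)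
next
  case (Suc n)
  note A = Suc.prems(1) and herm = Suc.prems(2)
  have "degree (char_poly A) > 0" using degree_monic_char_poly[OF A] by simp
  then obtain e where "poly (char_poly A) e = 0" using alg_closed_imp_poly_has_root by blast
  then have "eigenvalue A e" using eigenvalue_root_char_poly[OF A] by simp
  then obtain w where w: "w \<in> carrier_vec (Suc n)" "w \<noteq> 0\<^sub>v (Suc n)" "A *\<^sub>v w = e \<cdot>\<^sub>v w"
    using A unfolding eigenvalue_def eigenvector_def by auto
  have "\<exists>i<Suc n. vec_index w i \<noteq> 0"
    using w by (metis carrier_vecD eq_vecI index_zero_vec)
  then obtain i0 where i0: "i0 < Suc n" "vec_index w i0 \<noteq> 0" by blast
  obtain r where r: "r > 0"
    "(\<Sum>i<Suc n. cnj (of_real r * vec_index w i) * (of_real r * vec_index w i)) = 1"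
    using normalize_vector[of i0 "Suc n" "vec_index w", OF i0] by metis
  define v where "v i = of_real r * vec_index w i" for i
  have Aw: "(\<Sum>j<Suc n. A $$ (i, j) * vec_index w j) = e * vec_index w i" if "i < Suc n" for i
  proof -
    have "vec_index (A *\<^sub>v w) i = (\<Sum>j<Suc n. A $$ (i, j) * vec_index w j)"
      using that w(1) A by (auto simp: scalar_prod_def lessThan_atLeast0)
    then show ?thesis using w that by simp
  qed
  have Av: "(\<Sum>j<Suc n. A $$ (i, j) * v j) = e * v i" if "i < Suc n" for i
  proof -
    have "(\<Sum>j<Suc n. A $$ (i, j) * v j) = of_real r * (\<Sum>j<Suc n. A $$ (i, j) * vec_index w j)"
      unfolding v_def sum_distrib_left by (simp add: mult_ac)
    then show ?thesis using Aw[OF that] by (simp add: v_def mult_ac)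
  qed
  obtain Wf where Wf: "Wf 0 = v" "orthonormal_upto (Suc n) (Suc n) Wf"
    using orthonormal_completion[of v "Suc n" n] r(2) unfolding v_def by auto
  define W where "W = Matrix.mat (Suc n) (Suc n) (\<lambda>(i, l). Wf l i)"
  have W: "W \<in> carrier_mat (Suc n) (Suc n)" by (simp add: W_def)
  have adjW: "adj W $$ (i, l) = cnj (Wf i l)" if "i < Suc n" "l < Suc n" for i l
    using that by (simp add: adj_index[OF W]) (simp add: W_def)
  have WW: "adj W * W = 1\<^sub>m (Suc n)"
  proof (rule eq_matI)
    fix i j assume ij: "i < dim_row (1\<^sub>m (Suc n) :: complex Matrix.mat)"
      "j < dim_col (1\<^sub>m (Suc n) :: complex Matrix.mat)"
    then have "(adj W * W) $$ (i, j) = (\<Sum>l<Suc n. cnj (Wf i l) * Wf j l)"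
      using W by (subst index_mult_mat_sum[of _ "Suc n" "Suc n" _ "Suc n"])
         (auto simp: adjW, simp add: W_def)
    then show "(adj W * W) $$ (i, j) = 1\<^sub>m (Suc n) $$ (i, j)"
      using Wf(2) ij by (simp add: orthonormal_upto_def)
  qed (use W in auto)
  define B where "B = adj W * A * W"
  note WA = mult_carrier_mat[OF adj_carrier[OF W] A]
  have B: "B \<in> carrier_mat (Suc n) (Suc n)" unfolding B_def by (rule mult_carrier_mat[OF WA W])
  have B_eq: "B = adj W * (A * W)"
    unfolding B_def using A W by (intro assoc_mult_mat[of _ "Suc n" "Suc n" _ "Suc n" _ "Suc n"]) auto
  have adjB: "adj B = B"
  proof -
    have "adj B = adj W * adj (adj W * A)"
      unfolding B_def by (rule adj_mult[OF WA W])
    also have "adj (adj W * A) = adj A * W"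
      using adj_mult[OF adj_carrier[OF W] A] by simp
    finally show ?thesis by (simp add: B_eq herm)
  qed
  have AW0: "(A * W) $$ (i, 0) = e * W $$ (i, 0)" if "i < Suc n" for i
    using Av[OF that] that by (subst index_mult_mat_sum[OF A W]) (auto simp: W_def Wf)
  have B0: "B $$ (i, 0) = (if i = 0 then e else 0)" if "i < Suc n" for i
  proof -
    have "B $$ (i, 0) = (adj W * (A * W)) $$ (i, 0)"
      by (simp only: B_eq)
    also have "\<dots> = (\<Sum>l<Suc n. adj W $$ (i, l) * (A * W) $$ (l, 0))"
      using A W that by (subst index_mult_mat_sum[of _ "Suc n" "Suc n" _ "Suc n"]) auto
    also have "\<dots> = e * (\<Sum>l<Suc n. adj W $$ (i, l) * W $$ (l, 0))"
      unfolding sum_distrib_left by (intro sum.cong refl) (simp add: AW0 del: index_mult_mat)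
    also have "(\<Sum>l<Suc n. adj W $$ (i, l) * W $$ (l, 0)) = (adj W * W) $$ (i, 0)"
      using W that by (subst index_mult_mat_sum[of _ "Suc n" "Suc n" _ "Suc n"]) auto
    finally show ?thesis using that by (simp add: WW)
  qed
  have B0': "B $$ (0, i) = (if i = 0 then e else 0)" if "i < Suc n" for i
  proof (cases "i = 0")
    case False
    have "B $$ (0, i) = adj B $$ (0, i)" by (simp add: adjB)
    also have "\<dots> = 0" using False that B0[OF that] by (subst adj_index[OF B]) auto
    finally show ?thesis using False by simp
  qed (use B0 in auto)
  define B1 where "B1 = Matrix.mat 1 1 (\<lambda>_. e)"
  define B2 where "B2 = Matrix.mat n n (\<lambda>(i, j). B $$ (Suc i, Suc j))"
  have B1: "B1 \<in> carrier_mat 1 1" and B2: "B2 \<in> carrier_mat n n" by (simp_all add: B1_def B2_def)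
  have Bblock: "B = four_block_mat B1 (0\<^sub>m 1 n) (0\<^sub>m n 1) B2"
    by (rule eq_matI) (use B B0 B0' in \<open>auto simp: B1_def B2_def\<close>)
  have adjB2: "adj B2 = B2"
  proof (rule eq_matI)
    fix i j assume "i < dim_row B2" "j < dim_col B2"
    then have ij: "i < n" "j < n" using B2 by auto
    have "cnj (B $$ (Suc j, Suc i)) = adj B $$ (Suc i, Suc j)"
      using ij by (subst adj_index[OF B]) auto
    then show "adj B2 $$ (i, j) = B2 $$ (i, j)"
      using ij by (subst adj_index[OF B2]) (auto simp: adjB B2_def)
  qed (use B2 in auto)
  from Suc.IH[OF B2 adjB2] obtain U2 where U2: "U2 \<in> carrier_mat n n" "adj U2 * U2 = 1\<^sub>m n"
    "diagonal_mat (adj U2 * B2 * U2)" by auto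
  define V where "V = four_block_mat (1\<^sub>m 1) (0\<^sub>m 1 n) (0\<^sub>m n 1) U2"
  have V: "V \<in> carrier_mat (Suc n) (Suc n)" unfolding V_def using U2 by auto
  have adjV: "adj V = four_block_mat (1\<^sub>m 1) (0\<^sub>m 1 n) (0\<^sub>m n 1) (adj U2)"
    unfolding V_def using U2 by (subst adj_four_block[of _ 1 1 _ n _ n]) auto
  have blk: "four_block_mat P (0\<^sub>m 1 n) (0\<^sub>m n 1) Q * four_block_mat P' (0\<^sub>m 1 n) (0\<^sub>m n 1) Q'
      = four_block_mat (P * P') (0\<^sub>m 1 n) (0\<^sub>m n 1) (Q * Q')"
    if "P \<in> carrier_mat 1 1" "P' \<in> carrier_mat 1 1" "Q \<in> carrier_mat n n" "Q' \<in> carrier_mat n n"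
    for P P' Q Q' :: "complex Matrix.mat"
    using that by (subst mult_four_block_mat[of _ 1 1 _ n _ n _ _ 1 _ n]) auto
  have VV: "adj V * V = 1\<^sub>m (Suc n)"
  proof -
    have "adj V * V = four_block_mat (1\<^sub>m 1) (0\<^sub>m 1 n) (0\<^sub>m n 1) (1\<^sub>m n)"
      unfolding adjV unfolding V_def using U2 by (subst blk) auto
    then show ?thesis by auto
  qed
  have VBV: "adj V * B * V = four_block_mat B1 (0\<^sub>m 1 n) (0\<^sub>m n 1) (adj U2 * B2 * U2)"
  proof -
    have "adj V * B = four_block_mat B1 (0\<^sub>m 1 n) (0\<^sub>m n 1) (adj U2 * B2)"
      unfolding adjV Bblock using U2 B1 B2 by (subst blk) auto
    then show ?thesis unfolding V_def using U2 B1 mult_carrier_mat[OF adj_carrier[OF U2(1)] B2]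
      by (simp add: blk del: One_nat_def)
  qed
  have diag: "diagonal_mat (adj V * B * V)"
    using U2 B1 B2 unfolding VBV diagonal_mat_def by (auto simp del: index_mult_mat(1))
  define U where "U = W * V"
  have U: "U \<in> carrier_mat (Suc n) (Suc n)" using W V by (simp add: U_def)
  note as = assoc_mult_mat[of _ "Suc n" "Suc n" _ "Suc n" _ "Suc n"]
  have adjU: "adj U = adj V * adj W" unfolding U_def by (rule adj_mult[OF W V])
  have c: "adj W \<in> carrier_mat (Suc n) (Suc n)" "adj V \<in> carrier_mat (Suc n) (Suc n)"
    using V W by auto
  have UA: "adj U * X * U = adj V * (adj W * X * W) * V" if "X \<in> carrier_mat (Suc n) (Suc n)" for X
    unfolding adjU unfolding U_def
    using W V that c by (simp add: as mult_carrier_mat[of _ "Suc n" "Suc n" _ "Suc n"])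
  have 1: "adj U * U = 1\<^sub>m (Suc n)"
    using UA[of "1\<^sub>m (Suc n)"] U V W c by (simp add: WW VV)
  then show ?case using U diag UA[OF A] by (auto simp: B_def)
qed

section \<open>Counting negative eigenvalues\<close>

lemma order_prod_linear:
  "Polynomial.order a (\<Prod>l\<leftarrow>xs. [:- f l, 1:]) = length (filter (\<lambda>l. f l = a) xs)"
  for a :: "'a::field"
proof (induction xs)
  case Nil
  then show ?case by (simp add: order_0I)
next
  case (Cons x xs)
  have "(\<Prod>l\<leftarrow>xs. [:- f l, 1:]) \<noteq> 0" by (auto simp: prod_list_zero_iff)
  then have "Polynomial.order a (\<Prod>l\<leftarrow>x # xs. [:- f l, 1:])
      = Polynomial.order a [:- f x, 1:] + Polynomial.order a (\<Prod>l\<leftarrow>xs. [:- f l, 1:])"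
    unfolding list.map prod_list.Cons by (intro order_mult no_zero_divisors) simp_all
  moreover have "Polynomial.order a [:- f x, 1:] = (if f x = a then 1 else 0)"
    using order_power_n_n[of a 1] by (auto intro!: order_0I)
  ultimately show ?case using Cons by simp
qed

section \<open>Hermitian forms and test vectors for the number of negative eigenvalues\<close>

definition qf :: "nat \<Rightarrow> (nat \<Rightarrow> nat \<Rightarrow> complex) \<Rightarrow> (nat \<Rightarrow> complex) \<Rightarrow> (nat \<Rightarrow> complex) \<Rightarrow> complex" where
  "qf n A x y = (\<Sum>i<n. \<Sum>j<n. cnj (x i) * A i j * y j)"

definition herm :: "nat \<Rightarrow> (nat \<Rightarrow> nat \<Rightarrow> complex) \<Rightarrow> bool" where
  "herm n A \<longleftrightarrow> (\<forall>i<n. \<forall>j<n. A j i = cnj (A i j))"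

text \<open>Entries are given by an index function instead of a matrix, so that sampling a kernel at
  points, changing coordinates and evaluating on vectors are all plain sums.\<close>

definition nneg :: "nat \<Rightarrow> (nat \<Rightarrow> nat \<Rightarrow> complex) \<Rightarrow> nat" where
  "nneg n A = neg_eigs (Matrix.mat n n (\<lambda>(i, j). A i j))"

text \<open>The matrix is similar to a real diagonal one, so its characteristic polynomial is a
  product of linear factors and the order of a root counts the equal diagonal entries. Summing over
  the negative roots therefore counts negative entries with multiplicity. This is where
  \<open>neg_eigs\<close> is tied to quadratic forms; everything later argues with the form.\<close>

lemma spectral_decomposition:
  assumes "herm n A"
  obtains U lam where "orthonormal_upto n n U"
    "\<And>i j. i < n \<Longrightarrow> j < n \<Longrightarrow> A i j = (\<Sum>l<n. of_real (lam l) * U l i * cnj (U l j))"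
    "nneg n A = card {l. l < n \<and> lam l < (0::real)}"
proof -
  define M where "M = Matrix.mat n n (\<lambda>(i, j). A i j)"
  have M: "M \<in> carrier_mat n n" by (simp add: M_def)
  have "adj M = M"
  proof (rule eq_matI)
    fix i j assume "i < dim_row M" "j < dim_col M"
    then have ij: "i < n" "j < n" using M by auto
    then have "adj M $$ (i, j) = cnj (A j i)" by (simp add: adj_index[OF M]) (simp add: M_def)
    moreover have "A i j = cnj (A j i)" using ij assms unfolding herm_def by blast
    ultimately show "adj M $$ (i, j) = M $$ (i, j)" using ij by (simp add: M_def)
  qed (use M in auto)
  then obtain Um where Um: "Um \<in> carrier_mat n n" "adj Um * Um = 1\<^sub>m n"
    "diagonal_mat (adj Um * M * Um)" using hermitian_diagonalization[OF M] by auto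
  note aU = adj_carrier[OF Um(1)]
  have Um2: "Um * adj Um = 1\<^sub>m n"
    using mat_mult_left_right_inverse[OF aU Um(1) Um(2)] .
  define D where "D = adj Um * M * Um"
  have D: "D \<in> carrier_mat n n" unfolding D_def using mult_carrier_mat[OF mult_carrier_mat[OF aU M] Um(1)] .
  note as = assoc_mult_mat[of _ n n _ n _ n] and cc = mult_carrier_mat[of _ n n _ n]
  have MD: "M = Um * D * adj Um"
  proof -
    have "Um * D * adj Um = (Um * adj Um) * M * (Um * adj Um)"
      unfolding D_def using Um(1) aU M by (simp only: as cc)
    then show ?thesis using M by (simp add: Um2)
  qed
  have aD: "adj D = D"
    unfolding D_def using adj_mult[OF mult_carrier_mat[OF aU M] Um(1)] adj_mult[OF aU M]
      \<open>adj M = M\<close> Um(1) aU M by (simp add: as)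
  define lam where "lam l = Re (D $$ (l, l))" for l
  have lam: "D $$ (l, m) = (if l = m then of_real (lam l) else 0)" if "l < n" "m < n" for l m
  proof (cases "l = m")
    case True
    have "D $$ (l, l) = cnj (D $$ (l, l))" using adj_index[OF D that(1) that(1)] aD by simp
    then show ?thesis using True by (simp add: lam_def complex_eq_iff)
  next
    case False
    then show ?thesis using Um(3) D that unfolding D_def[symmetric] diagonal_mat_def by auto
  qed
  define U where "U l i = Um $$ (i, l)" for l i
  have 1: "orthonormal_upto n n U"
    unfolding orthonormal_upto_def
  proof (intro allI impI)
    fix a b assume ab: "a < n" "b < n"
    have "(adj Um * Um) $$ (a, b) = (\<Sum>i<n. cnj (U a i) * U b i)"
      using ab by (subst index_mult_mat_sum[OF aU Um(1)]) (auto simp: adj_index[OF Um(1)] U_def)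
    then show "(\<Sum>i<n. cnj (U a i) * U b i) = (if a = b then 1 else 0)"
      using ab by (simp add: Um(2))
  qed
  have 2: "A i j = (\<Sum>l<n. of_real (lam l) * U l i * cnj (U l j))" if ij: "i < n" "j < n" for i j
  proof -
    have *: "(Um * D) $$ (i, l) = of_real (lam l) * U l i" if "l < n" for l
    proof -
      have "(Um * D) $$ (i, l) = (\<Sum>m<n. Um $$ (i, m) * D $$ (m, l))"
        by (rule index_mult_mat_sum[OF Um(1) D ij(1) that])
      also have "\<dots> = (\<Sum>m<n. if m = l then Um $$ (i, l) * of_real (lam l) else 0)"
        by (intro sum.cong refl) (auto simp: lam that)
      finally have "(Um * D) $$ (i, l) = (\<Sum>m<n. if m = l then Um $$ (i, l) * of_real (lam l) else 0)" .
      then show ?thesis using that by (simp add: U_def mult.commute)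
    qed
    have "A i j = M $$ (i, j)" using ij by (simp add: M_def)
    also have "\<dots> = (Um * D * adj Um) $$ (i, j)" using MD by simp
    also have "\<dots> = (\<Sum>l<n. (Um * D) $$ (i, l) * adj Um $$ (l, j))"
      using index_mult_mat_sum[OF mult_carrier_mat[OF Um(1) D] aU ij] .
    also have "\<dots> = (\<Sum>l<n. of_real (lam l) * U l i * cnj (U l j))"
      using ij by (intro sum.cong refl) (simp add: * adj_index[OF Um(1)] U_def del: index_mult_mat(1))
    finally show ?thesis .
  qed
  have "similar_mat_wit M D Um (adj Um)"
    by (rule similar_mat_witI[OF Um2 Um(2) MD M D Um(1) aU])
  then have "similar_mat M D"
    unfolding similar_mat_def by blast
  then have "char_poly M = char_poly D" by (rule char_poly_similar)
  also have "\<dots> = (\<Prod>a\<leftarrow>diag_mat D. [:- a, 1:])"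
    using D lam by (intro char_poly_upper_triangular[OF D]) (auto simp: upper_triangular_def)
  also have "diag_mat D = map (\<lambda>l. of_real (lam l)) [0..<n]"
    unfolding diag_mat_def using D lam by auto
  finally have cp: "char_poly M = (\<Prod>l\<leftarrow>[0..<n]. [:- complex_of_real (lam l), 1:])"
    by (simp add: comp_def)
  have ord: "Polynomial.order (complex_of_real y) (char_poly M) = card {l. l < n \<and> lam l = y}" for y
    unfolding cp order_prod_linear length_filter_conv_card
    by (intro arg_cong[where f = card]) auto
  define S where "S = {l. l < n \<and> lam l < 0}"
  have "poly (char_poly M) (complex_of_real y) = 0 \<longleftrightarrow> (\<exists>l<n. lam l = y)" for y
    unfolding cp poly_prod_list
    by (simp only: prod_list_zero_iff map_map set_map set_upt comp_def image_iff) (auto simp: Bex_def)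
  then have set: "{x. x < 0 \<and> poly (char_poly M) (complex_of_real x) = 0} = lam ` S"
    unfolding S_def by auto
  have "card S = (\<Sum>y\<in>lam ` S. \<Sum>l\<in>{l\<in>S. lam l = y}. 1)"
    by (subst sum.image_gen[symmetric]) (auto simp: S_def)
  also have "\<dots> = (\<Sum>y\<in>lam ` S. card {l. l < n \<and> lam l = y})"
    by (intro sum.cong refl) (auto simp: S_def intro!: arg_cong[where f = card])
  finally have "nneg n A = card {l. l < n \<and> lam l < 0}"
    unfolding nneg_def M_def[symmetric] neg_eigs_def set ord S_def[symmetric] by simp
  then show ?thesis using that 1 2 by blast
qed

lemma qf_sum_right: "qf n A x (\<lambda>i. \<Sum>b<k. c b * V b i) = (\<Sum>b<k. c b * qf n A x (V b))"
proof -
  have "qf n A x (\<lambda>i. \<Sum>b<k. c b * V b i) = (\<Sum>i<n. \<Sum>j<n. \<Sum>b<k. c b * (cnj (x i) * A i j * V b j))"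
    unfolding qf_def by (simp add: sum_distrib_left mult_ac)
  also have "\<dots> = (\<Sum>i<n. \<Sum>b<k. \<Sum>j<n. c b * (cnj (x i) * A i j * V b j))"
    by (intro sum.cong refl sum.swap)
  also have "\<dots> = (\<Sum>b<k. \<Sum>i<n. \<Sum>j<n. c b * (cnj (x i) * A i j * V b j))"
    by (rule sum.swap)
  finally show ?thesis by (simp add: qf_def sum_distrib_left)
qed

lemma qf_sum_left: "qf n A (\<lambda>i. \<Sum>b<k. c b * V b i) y = (\<Sum>b<k. cnj (c b) * qf n A (V b) y)"
proof -
  have "qf n A (\<lambda>i. \<Sum>b<k. c b * V b i) y = (\<Sum>i<n. \<Sum>j<n. \<Sum>b<k. cnj (c b) * (cnj (V b i) * A i j * y j))"
    unfolding qf_def by (simp add: sum_distrib_left sum_distrib_right mult_ac)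
  also have "\<dots> = (\<Sum>i<n. \<Sum>b<k. \<Sum>j<n. cnj (c b) * (cnj (V b i) * A i j * y j))"
    by (intro sum.cong refl sum.swap)
  also have "\<dots> = (\<Sum>b<k. \<Sum>i<n. \<Sum>j<n. cnj (c b) * (cnj (V b i) * A i j * y j))"
    by (rule sum.swap)
  finally show ?thesis by (simp add: qf_def sum_distrib_left)
qed

lemma qf_zero [simp]: "qf n A (\<lambda>_. 0) y = 0" "qf n A x (\<lambda>_. 0) = 0"
  by (simp_all add: qf_def)

lemma qf_cong:
  "(\<And>i. i < n \<Longrightarrow> x i = x' i) \<Longrightarrow> (\<And>i. i < n \<Longrightarrow> y i = y' i) \<Longrightarrow>
   (\<And>i j. i < n \<Longrightarrow> j < n \<Longrightarrow> A i j = A' i j) \<Longrightarrow> qf n A x y = qf n A' x' y'"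
  unfolding qf_def by (intro sum.cong refl) auto

lemma qf_spectral:
  assumes "\<And>i j. i < n \<Longrightarrow> j < n \<Longrightarrow> A i j = (\<Sum>l<n. of_real (lam l) * U l i * cnj (U l j))"
  shows "qf n A x y = (\<Sum>l<n. of_real (lam l) * cnj (\<Sum>i<n. cnj (U l i) * x i) * (\<Sum>i<n. cnj (U l i) * y i))"
proof -
  have "qf n A x y = (\<Sum>i<n. \<Sum>j<n. \<Sum>l<n. of_real (lam l) * (U l i * cnj (x i)) * (cnj (U l j) * y j))"
    unfolding qf_def using assms by (intro sum.cong refl) (simp add: sum_distrib_left sum_distrib_right mult_ac)
  also have "\<dots> = (\<Sum>i<n. \<Sum>l<n. \<Sum>j<n. of_real (lam l) * (U l i * cnj (x i)) * (cnj (U l j) * y j))"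
    by (intro sum.cong refl sum.swap)
  also have "\<dots> = (\<Sum>l<n. \<Sum>i<n. \<Sum>j<n. of_real (lam l) * (U l i * cnj (x i)) * (cnj (U l j) * y j))"
    by (rule sum.swap)
  also have "\<dots> = (\<Sum>l<n. of_real (lam l) * cnj (\<Sum>i<n. cnj (U l i) * x i) * (\<Sum>i<n. cnj (U l i) * y i))"
    by (intro sum.cong refl)
      (simp only: cnj_sum complex_cnj_mult complex_cnj_cnj mult.assoc sum_product, simp only: sum_distrib_left mult.assoc)
  finally show ?thesis .
qed

text \<open>Eigenvectors of the negative eigenvalues, divided by \<open>sqrt (- lam)\<close>, have
  Gram matrix \<open>-I\<close>. They provide the lower bounds on negative eigenvalues; the
  functionals below provide the upper bounds.\<close>

lemma nneg_vectors:
  assumes "herm n A"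
  obtains V where "\<And>a b. a < nneg n A \<Longrightarrow> b < nneg n A \<Longrightarrow> qf n A (V a) (V b) = (if a = b then -1 else 0)"
proof -
  obtain U lam where U: "orthonormal_upto n n U"
    "\<And>i j. i < n \<Longrightarrow> j < n \<Longrightarrow> A i j = (\<Sum>l<n. of_real (lam l) * U l i * cnj (U l j))"
    "nneg n A = card {l. l < n \<and> lam l < (0::real)}"
    by (rule spectral_decomposition[OF assms]) blast
  obtain h where h: "bij_betw h {..<nneg n A} {l. l < n \<and> lam l < 0}"
    using ex_bij_betw_nat_finite[of "{l. l < n \<and> lam l < 0}"] U(3) by (auto simp: lessThan_atLeast0)
  have hn: "h a < n" "lam (h a) < 0" if "a < nneg n A" for a
    using bij_betwE[OF h] that by auto
  define V where "V a i = U (h a) i / of_real (sqrt (- lam (h a)))" for a i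
  have c: "(\<Sum>i<n. cnj (U l i) * V a i) = (if l = h a then 1 / of_real (sqrt (- lam (h a))) else 0)"
    if "l < n" "a < nneg n A" for l a
  proof -
    have "(\<Sum>i<n. cnj (U l i) * V a i) = (\<Sum>i<n. cnj (U l i) * U (h a) i) / of_real (sqrt (- lam (h a)))"
      unfolding V_def by (simp add: sum_divide_distrib)
    then show ?thesis using U(1) hn that by (simp add: orthonormal_upto_def)
  qed
  have "qf n A (V a) (V b) = (if a = b then -1 else 0)" if ab: "a < nneg n A" "b < nneg n A" for a b
  proof -
    have "qf n A (V a) (V b) = (\<Sum>l<n. if l = h a then (if h a = h b then
        of_real (lam (h a)) / (of_real (sqrt (- lam (h a))) * of_real (sqrt (- lam (h a)))) else 0) else 0)"
      using ab by (subst qf_spectral[of n A lam U, OF U(2)], simp, simp) (intro sum.cong refl, auto simp: c)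
    also have "\<dots> = (if h a = h b then -1 else 0)"
      using hn[OF ab(1)] unfolding of_real_mult[symmetric] by (auto simp: abs_of_neg)
    also have "h a = h b \<longleftrightarrow> a = b" using h ab by (auto simp: bij_betw_def inj_on_def)
    finally show ?thesis .
  qed
  then show ?thesis using that by blast
qed

text \<open>The functionals are the coordinates along the negative eigenvectors: where they all
  vanish, only the nonnegative terms of the spectral sum are left.\<close>

lemma nneg_functionals:
  assumes "herm n A"
  obtains W where "\<And>x. (\<And>a. a < nneg n A \<Longrightarrow> (\<Sum>i<n. W a i * x i) = 0) \<Longrightarrow> Re (qf n A x x) \<ge> 0"
proof -
  obtain U lam where U: "orthonormal_upto n n U"
    "\<And>i j. i < n \<Longrightarrow> j < n \<Longrightarrow> A i j = (\<Sum>l<n. of_real (lam l) * U l i * cnj (U l j))"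
    "nneg n A = card {l. l < n \<and> lam l < (0::real)}"
    by (rule spectral_decomposition[OF assms]) blast
  obtain h where h: "bij_betw h {..<nneg n A} {l. l < n \<and> lam l < 0}"
    using ex_bij_betw_nat_finite[of "{l. l < n \<and> lam l < 0}"] U(3) by (auto simp: lessThan_atLeast0)
  show ?thesis
  proof (rule that[of "\<lambda>a i. cnj (U (h a) i)"])
    fix x assume x: "\<And>a. a < nneg n A \<Longrightarrow> (\<Sum>i<n. cnj (U (h a) i) * x i) = 0"
    have "Re (of_real (lam l) * cnj (\<Sum>i<n. cnj (U l i) * x i) * (\<Sum>i<n. cnj (U l i) * x i)) \<ge> 0"
      if "l < n" for l
    proof (cases "lam l < 0")
      case True
      then have "l \<in> h ` {..<nneg n A}" using bij_betw_imp_surj_on[OF h] that by simp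
      then obtain a where "a < nneg n A" "l = h a" by auto
      then show ?thesis using x by simp
    next
      case False
      have "of_real (lam l) * cnj (\<Sum>i<n. cnj (U l i) * x i) * (\<Sum>i<n. cnj (U l i) * x i)
         = of_real (lam l * (cmod (\<Sum>i<n. cnj (U l i) * x i))\<^sup>2)"
        unfolding of_real_mult complex_norm_square by (simp add: mult_ac)
      then show ?thesis using False by (metis Re_complex_of_real mult_nonneg_nonneg not_less zero_le_power2)
    qed
    then show "Re (qf n A x x) \<ge> 0"
      by (subst qf_spectral[of n A lam U, OF U(2)], simp, simp) (unfold Re_sum, intro sum_nonneg, auto)
  qed
qed

text \<open>Fewer than \<open>k\<close> conditions on combinations of \<open>k\<close> vectors leave
  a nonzero coefficient vector \<open>c\<close>. Entrywise errors of at most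
  \<open>1 / (k + 1)\<close> in the Gram matrix change the form by at most
  \<open>k / (k + 1)\<close> times the squared norm of \<open>c\<close>, which cannot outweigh the
  exact part, minus that squared norm.\<close>

lemma negative_vector_in_kernel:
  fixes F :: "nat \<Rightarrow> nat \<Rightarrow> complex"
  assumes "p < k"
    and V: "\<And>a b. a < k \<Longrightarrow> b < k \<Longrightarrow>
      cmod (qf n C (V a) (V b) - (if a = b then -1 else 0)) \<le> 1 / (real k + 1)"
  obtains x where "\<And>a. a < p \<Longrightarrow> (\<Sum>i<n. F a i * x i) = 0" "Re (qf n C x x) < 0"
proof -
  obtain c where c: "\<exists>b<k. c b \<noteq> 0" "\<And>a. a < p \<Longrightarrow> (\<Sum>b<k. (\<Sum>i<n. F a i * V b i) * c b) = 0"
    using homogeneous_system_nontrivial[OF assms(1), of "\<lambda>a b. \<Sum>i<n. F a i * V b i"] by blast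
  define x where "x i = (\<Sum>b<k. c b * V b i)" for i
  have "(\<Sum>i<n. F a i * x i) = 0" if "a < p" for a
  proof -
    have "(\<Sum>i<n. F a i * x i) = (\<Sum>i<n. \<Sum>b<k. F a i * V b i * c b)"
      unfolding x_def by (simp add: sum_distrib_left mult_ac)
    also have "\<dots> = (\<Sum>b<k. \<Sum>i<n. F a i * V b i * c b)" by (rule sum.swap)
    finally show ?thesis using c(2)[OF that] by (simp add: sum_distrib_right)
  qed
  moreover have "Re (qf n C x x) < 0"
  proof -
    define s where "s = (\<Sum>b<k. (cmod (c b))\<^sup>2)"
    define E where "E a b = qf n C (V a) (V b) - (if a = b then -1 else 0)" for a b
    have s: "s > 0" unfolding s_def using c(1) by (auto intro!: sum_pos2)
    have "qf n C x x = (\<Sum>a<k. \<Sum>b<k. cnj (c a) * c b * qf n C (V a) (V b))"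
      unfolding x_def qf_sum_left qf_sum_right by (simp add: sum_distrib_left mult_ac)
    also have "\<dots> = (\<Sum>a<k. \<Sum>b<k. cnj (c a) * c b * E a b + (if a = b then - (cnj (c a) * c b) else 0))"
      unfolding E_def by (intro sum.cong refl) (auto simp: algebra_simps)
    also have "\<dots> = (\<Sum>a<k. \<Sum>b<k. cnj (c a) * c b * E a b) - (\<Sum>a<k. cnj (c a) * c a)"
      by (simp add: sum.distrib sum_negf sum_subtractf)
    also have "(\<Sum>a<k. cnj (c a) * c a) = of_real s"
      unfolding s_def of_real_sum complex_norm_square by (simp add: mult.commute)
    finally have 1: "qf n C x x = (\<Sum>a<k. \<Sum>b<k. cnj (c a) * c b * E a b) - of_real s" .
    have "Re (\<Sum>a<k. \<Sum>b<k. cnj (c a) * c b * E a b) \<le> (\<Sum>a<k. \<Sum>b<k. cmod (cnj (c a) * c b * E a b))"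
      by (intro order.trans[OF complex_Re_le_cmod] order.trans[OF norm_sum] sum_mono norm_sum)
    also have "\<dots> \<le> (\<Sum>a<k. \<Sum>b<k. ((cmod (c a))\<^sup>2 + (cmod (c b))\<^sup>2) / 2 * (1 / (real k + 1)))"
    proof (intro sum_mono)
      fix a b assume "a \<in> {..<k}" "b \<in> {..<k}"
      then have "cmod (E a b) \<le> 1 / (real k + 1)" using V by (simp add: E_def)
      moreover have "cmod (c a) * cmod (c b) \<le> ((cmod (c a))\<^sup>2 + (cmod (c b))\<^sup>2) / 2"
        using sum_squares_bound[of "cmod (c a)" "cmod (c b)"] by simp
      ultimately have "(cmod (c a) * cmod (c b)) * cmod (E a b)
          \<le> ((cmod (c a))\<^sup>2 + (cmod (c b))\<^sup>2) / 2 * (1 / (real k + 1))"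
        by (intro mult_mono) auto
      then show "cmod (cnj (c a) * c b * E a b) \<le> ((cmod (c a))\<^sup>2 + (cmod (c b))\<^sup>2) / 2 * (1 / (real k + 1))"
        by (simp add: norm_mult)
    qed
    also have "\<dots> = (\<Sum>a<k. \<Sum>b<k. (cmod (c a))\<^sup>2 + (cmod (c b))\<^sup>2) * (1 / (2 * (real k + 1)))"
      unfolding sum_distrib_right by (intro sum.cong refl) (simp add: field_simps)
    also have "(\<Sum>a<k. \<Sum>b<k. (cmod (c a))\<^sup>2 + (cmod (c b))\<^sup>2) = 2 * real k * s"
      unfolding sum.distrib by (simp add: s_def sum_distrib_left[symmetric])
    also have "2 * real k * s * (1 / (2 * (real k + 1))) = real k * s / (real k + 1)"
      by (simp add: field_simps)
    also have "\<dots> < s" using s by (simp add: field_simps)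
    finally show ?thesis unfolding 1 by simp
  qed
  ultimately show ?thesis using that by blast
qed

text \<open>If there were fewer negative eigenvalues than test vectors, some combination of the
  vectors would be annihilated by all functionals of \<open>nneg_functionals\<close> and still be
  negative. The tolerance lets the criterion be used with test vectors whose Gram matrix is right
  only in the limit.\<close>

lemma nneg_geI:
  assumes "herm n A"
    and V: "\<And>a b. a < k \<Longrightarrow> b < k \<Longrightarrow>
      cmod (qf n A (V a) (V b) - (if a = b then -1 else 0)) \<le> 1 / (real k + 1)"
  shows "k \<le> nneg n A"
proof (rule ccontr)
  assume "\<not> k \<le> nneg n A"
  then have k: "nneg n A < k" by simp
  obtain W where W: "\<And>x. (\<And>a. a < nneg n A \<Longrightarrow> (\<Sum>i<n. W a i * x i) = 0) \<Longrightarrow> Re (qf n A x x) \<ge> 0"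
    using nneg_functionals[OF assms(1)] by blast
  obtain x where "\<And>a. a < nneg n A \<Longrightarrow> (\<Sum>i<n. W a i * x i) = 0" "Re (qf n A x x) < 0"
    using negative_vector_in_kernel[OF k V, of W] by blast
  then show False using W[of x] by simp
qed

text \<open>With too many negative vectors of \<open>C\<close>, some combination of them is mapped
  by \<open>X\<close> and \<open>Y\<close> into the kernels of the functionals of \<open>B\<close>
  and of \<open>A\<close>, where both forms are nonnegative.\<close>

lemma nneg_subadditive:
  assumes "herm n C" "herm d B" "herm m A"
    and "\<And>x. Re (qf n C x x) \<ge> Re (qf d B (\<lambda>r. \<Sum>i<n. X r i * x i) (\<lambda>r. \<Sum>i<n. X r i * x i))
       + Re (qf m A (\<lambda>r. \<Sum>i<n. Y r i * x i) (\<lambda>r. \<Sum>i<n. Y r i * x i))"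
  shows "nneg n C \<le> nneg d B + nneg m A"
proof (rule ccontr)
  assume "\<not> nneg n C \<le> nneg d B + nneg m A"
  then have k: "nneg d B + nneg m A < nneg n C" by simp
  obtain WB where WB: "\<And>x. (\<And>a. a < nneg d B \<Longrightarrow> (\<Sum>i<d. WB a i * x i) = 0) \<Longrightarrow> Re (qf d B x x) \<ge> 0"
    using nneg_functionals[OF assms(2)] by blast
  obtain WA where WA: "\<And>x. (\<And>a. a < nneg m A \<Longrightarrow> (\<Sum>i<m. WA a i * x i) = 0) \<Longrightarrow> Re (qf m A x x) \<ge> 0"
    using nneg_functionals[OF assms(3)] by blast
  obtain V where V: "\<And>a b. a < nneg n C \<Longrightarrow> b < nneg n C \<Longrightarrow> qf n C (V a) (V b) = (if a = b then -1 else 0)"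
    using nneg_vectors[OF assms(1)] by blast
  \<comment> \<open>The functionals of \<open>B\<close> pulled back along \<open>X\<close>, followed
    by those of \<open>A\<close> pulled back along \<open>Y\<close>, in one numbering.\<close>
  define F where "F a i = (if a < nneg d B then \<Sum>r<d. WB a r * X r i
      else \<Sum>r<m. WA (a - nneg d B) r * Y r i)" for a i
  obtain x where x: "\<And>a. a < nneg d B + nneg m A \<Longrightarrow> (\<Sum>i<n. F a i * x i) = 0" "Re (qf n C x x) < 0"
    using negative_vector_in_kernel[OF k, of n C V F] V by auto
  have sw: "(\<Sum>r<q. w r * (\<Sum>i<n. Z r i * x i)) = (\<Sum>i<n. (\<Sum>r<q. w r * Z r i) * x i)"
    for q and w :: "nat \<Rightarrow> complex" and Z
    unfolding sum_distrib_left sum_distrib_right by (subst sum.swap) (simp add: mult_ac)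
  have "Re (qf d B (\<lambda>r. \<Sum>i<n. X r i * x i) (\<lambda>r. \<Sum>i<n. X r i * x i)) \<ge> 0"
  proof (rule WB)
    fix a assume "a < nneg d B"
    then show "(\<Sum>r<d. WB a r * (\<Sum>i<n. X r i * x i)) = 0"
      using x(1)[of a] by (simp add: sw F_def)
  qed
  moreover have "Re (qf m A (\<lambda>r. \<Sum>i<n. Y r i * x i) (\<lambda>r. \<Sum>i<n. Y r i * x i)) \<ge> 0"
  proof (rule WA)
    fix a assume "a < nneg m A"
    then show "(\<Sum>r<m. WA a r * (\<Sum>i<n. Y r i * x i)) = 0"
      using x(1)[of "nneg d B + a"] by (simp add: sw F_def)
  qed
  ultimately show False using assms(4)[of x] x(2) by linarith
qed

text \<open>Negative vectors of either summand are lifted with 0 in the other component; the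
  hypothesis then gives the joint Gram matrix \<open>-I\<close>, the mixed entries being 0.\<close>

lemma nneg_superadditive:
  assumes "herm n C" "herm d B" "herm m A"
    and "\<And>b c b' c'. qf n C (L b c) (L b' c') = qf d B b b' + qf m A c c'"
  shows "nneg d B + nneg m A \<le> nneg n C"
proof -
  obtain VB where VB: "\<And>a b. a < nneg d B \<Longrightarrow> b < nneg d B \<Longrightarrow> qf d B (VB a) (VB b) = (if a = b then -1 else 0)"
    using nneg_vectors[OF assms(2)] by blast
  obtain VA where VA: "\<And>a b. a < nneg m A \<Longrightarrow> b < nneg m A \<Longrightarrow> qf m A (VA a) (VA b) = (if a = b then -1 else 0)"
    using nneg_vectors[OF assms(3)] by blast
  define V where "V a = (if a < nneg d B then L (VB a) (\<lambda>_. 0) else L (\<lambda>_. 0) (VA (a - nneg d B)))" for a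
  have "qf n C (V a) (V b) = (if a = b then -1 else 0)"
    if "a < nneg d B + nneg m A" "b < nneg d B + nneg m A" for a b
    using that by (auto simp: V_def assms(4) VA VB)
  then show ?thesis by (intro nneg_geI[OF assms(1), where V = V]) auto
qed

section \<open>Negative squares of kernels\<close>

lemma det_nonzero_right_inverse:
  fixes A :: "'a::field Matrix.mat"
  assumes "A \<in> carrier_mat n n" "Determinant.det A \<noteq> 0"
  obtains B where "B \<in> carrier_mat n n" "A * B = 1\<^sub>m n"
proof -
  have "A \<in> Units (ring_mat TYPE('a) n ())" using det_non_zero_imp_unit[OF assms] .
  then show ?thesis using that by (auto simp: Units_def ring_mat_simps)
qed

text \<open>The Vandermonde matrix at the nodes \<open>1, ..., d\<close> is invertible, since a
  polynomial of degree below \<open>d\<close> with \<open>d\<close> roots is 0. The columns of the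
  inverse are weights on the nodes with a single nonvanishing moment; they will allow the first
  \<open>d\<close> moments of a test vector to be prescribed.\<close>

lemma vandermonde_dual:
  obtains D :: "nat \<Rightarrow> nat \<Rightarrow> complex" where
    "\<And>r s. r < d \<Longrightarrow> s < d \<Longrightarrow> (\<Sum>l<d. of_nat (l + 1) ^ s * D l r) = (if r = s then 1 else 0)"
proof -
  define M where "M = Matrix.mat d d (\<lambda>(s, l). (of_nat (l + 1) :: complex) ^ s)"
  have M: "M \<in> carrier_mat d d" by (simp add: M_def)
  have "Determinant.det M \<noteq> 0"
  proof
    assume "Determinant.det M = 0"
    then have "Determinant.det (transpose_mat M) = 0" using Determinant.det_transpose[OF M] by simp
    then obtain v where v: "v \<in> carrier_vec d" "v \<noteq> 0\<^sub>v d" "transpose_mat M *\<^sub>v v = 0\<^sub>v d"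
      using det_0_iff_vec_prod_zero_field[of "transpose_mat M" d] M by auto
    define p where "p = (\<Sum>s<d. Polynomial.monom (vec_index v s) s)"
    have root: "poly p (of_nat (l + 1)) = 0" if "l < d" for l
    proof -
      have "vec_index (transpose_mat M *\<^sub>v v) l = 0" using v(3) that by simp
      then have "(\<Sum>s<d. of_nat (l + 1) ^ s * vec_index v s) = 0"
        using that v(1) by (auto simp: M_def scalar_prod_def lessThan_atLeast0)
      then show ?thesis unfolding p_def by (simp add: poly_sum poly_monom mult.commute)
    qed
    have "p = 0"
    proof (rule ccontr)
      assume "p \<noteq> 0"
      have "d \<noteq> 0" using v by auto
      then have "degree p < d"
        unfolding p_def by (intro degree_sum_less) (auto intro: le_less_trans[OF degree_monom_le])
      have "card ((\<lambda>l. of_nat (l + 1) :: complex) ` {..<d}) = d"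
        by (subst card_image) (auto simp: inj_on_def)
      moreover have "card ((\<lambda>l. of_nat (l + 1) :: complex) ` {..<d}) \<le> card {x. poly p x = 0}"
        using root poly_roots_finite[OF \<open>p \<noteq> 0\<close>] by (intro card_mono) auto
      ultimately show False
        using card_poly_roots_bound[OF \<open>p \<noteq> 0\<close>] \<open>degree p < d\<close> by linarith
    qed
    have "vec_index v s = 0" if "s < d" for s
    proof -
      have "poly.coeff p s = vec_index v s"
        unfolding p_def using that by (simp add: coeff_sum)
      then show ?thesis using \<open>p = 0\<close> by simp
    qed
    then show False using v by (metis carrier_vecD eq_vecI index_zero_vec)
  qed
  then obtain D where D: "D \<in> carrier_mat d d" "M * D = 1\<^sub>m d"
    using det_nonzero_right_inverse[OF M] by blast
  have "(\<Sum>l<d. of_nat (l + 1) ^ s * D $$ (l, r)) = (if r = s then 1 else 0)" if "r < d" "s < d" for r s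
  proof -
    have "(M * D) $$ (s, r) = (\<Sum>l<d. of_nat (l + 1) ^ s * D $$ (l, r))"
      using index_mult_mat_sum[OF M D(1) that(2,1)] that by (simp add: M_def)
    then show ?thesis using D(2) that by auto
  qed
  then show ?thesis using that[of "\<lambda>l r. D $$ (l, r)"] by blast
qed

section \<open>Negative squares of Hermitian kernels, witnessed by test vectors\<close>

definition kern :: "(complex \<Rightarrow> complex) \<Rightarrow> complex \<Rightarrow> complex \<Rightarrow> complex" where
  "kern \<phi> z w = (\<phi> z - cnj (\<phi> w)) / (z - cnj w)"

definition herm_kernel :: "(complex \<Rightarrow> complex \<Rightarrow> complex) \<Rightarrow> complex set \<Rightarrow> bool" where
  "herm_kernel K S \<longleftrightarrow> (\<forall>z\<in>S. \<forall>w\<in>S. K w z = cnj (K z w))"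

text \<open>This means at least \<open>k\<close> negative squares. Exact test vectors instead of
  eigenvalues make the notion monotone in \<open>k\<close> and in \<open>S\<close> and let factors
  of the kernel be absorbed into the vectors; two such statements, for \<open>k\<close> and
  \<open>Suc k\<close>, pin down the exact number.\<close>

definition negsq :: "(complex \<Rightarrow> complex \<Rightarrow> complex) \<Rightarrow> complex set \<Rightarrow> nat \<Rightarrow> bool" where
  "negsq K S k \<longleftrightarrow> (\<exists>n z V. (\<forall>i<n. z i \<in> S) \<and>
     (\<forall>a<k. \<forall>b<k. qf n (\<lambda>i j. K (z i) (z j)) (V a) (V b) = (if a = b then -1 else 0)))"

lemma kern_cnj: "kern \<phi> w z = cnj (kern \<phi> z w)"
proof -
  have "kern \<phi> w z = (- (\<phi> w - cnj (\<phi> z))) / (- (w - cnj z))"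
    unfolding kern_def by (rule minus_divide_divide[symmetric])
  then show ?thesis by (simp add: kern_def)
qed

lemma herm_kern [simp]: "herm_kernel (kern \<phi>) S"
  unfolding herm_kernel_def using kern_cnj by blast

lemma herm_kernel_imp_herm: "herm_kernel K S \<Longrightarrow> (\<And>i. i < n \<Longrightarrow> z i \<in> S) \<Longrightarrow> herm n (\<lambda>i j. K (z i) (z j))"
  unfolding herm_kernel_def herm_def by blast

lemma negsq_0 [simp]: "negsq K S 0"
  unfolding negsq_def by (rule exI[of _ 0]) auto

lemma negsq_mono: "negsq K S k \<Longrightarrow> k' \<le> k \<Longrightarrow> negsq K S k'"
  unfolding negsq_def by (elim ex_forward conj_forward) auto

lemma negsq_subset: "negsq K S k \<Longrightarrow> S \<subseteq> S' \<Longrightarrow> negsq K S' k"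
  unfolding negsq_def by blast

lemma negsqI_nneg:
  assumes "herm_kernel K S" "\<And>i. i < n \<Longrightarrow> z i \<in> S" "k \<le> nneg n (\<lambda>i j. K (z i) (z j))"
  shows "negsq K S k"
proof -
  obtain V where V: "\<And>a b. a < nneg n (\<lambda>i j. K (z i) (z j)) \<Longrightarrow> b < nneg n (\<lambda>i j. K (z i) (z j)) \<Longrightarrow>
      qf n (\<lambda>i j. K (z i) (z j)) (V a) (V b) = (if a = b then -1 else 0)"
    by (rule nneg_vectors[OF herm_kernel_imp_herm[OF assms(1), of n z]]) (use assms(2) in auto)
  then show ?thesis unfolding negsq_def using assms(2,3)
    by (intro exI[of _ n] exI[of _ z] exI[of _ V]) auto
qed

lemma negsqE_nneg:
  assumes "herm_kernel K S" "negsq K S k"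
  obtains n z where "\<And>i. i < n \<Longrightarrow> z i \<in> S" "k \<le> nneg n (\<lambda>i j. K (z i) (z j))"
proof -
  obtain n z V where z: "\<forall>i<n. z i \<in> S"
    and V: "\<forall>a<k. \<forall>b<k. qf n (\<lambda>i j. K (z i) (z j)) (V a) (V b) = (if a = b then -1 else 0)"
    using assms(2) unfolding negsq_def by blast
  have "k \<le> nneg n (\<lambda>i j. K (z i) (z j))"
    using V z by (intro nneg_geI[where V = V] herm_kernel_imp_herm[OF assms(1)]) auto
  then show ?thesis using that z by blast
qed

text \<open>Points and vectors may both move with the parameter. Once the Gram matrix is within
  \<open>1 / (k + 1)\<close> of \<open>-I\<close>, which happens at some parameter as the filter is
  not trivial, the criterion \<open>nneg_geI\<close> applies at that one parameter.\<close>

lemma negsq_limitI: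
  fixes F :: "real filter"
  assumes "herm_kernel K S" "F \<noteq> bot" "\<forall>\<^sub>F y in F. \<forall>i<n. z y i \<in> S"
    and lim: "\<And>a b. a < k \<Longrightarrow> b < k \<Longrightarrow>
      ((\<lambda>y. qf n (\<lambda>i j. K (z y i) (z y j)) (V y a) (V y b)) \<longlongrightarrow> (if a = b then -1 else 0)) F"
  shows "negsq K S k"
proof -
  have "\<forall>\<^sub>F y in F. \<forall>a\<in>{..<k}. \<forall>b\<in>{..<k}. dist (qf n (\<lambda>i j. K (z y i) (z y j)) (V y a) (V y b)) (if a = b then -1 else 0)
      < 1 / (real k + 1)"
    using lim by (intro eventually_ball_finite ballI finite_lessThan tendstoD) auto
  then obtain y where y: "\<forall>i<n. z y i \<in> S" "\<forall>a\<in>{..<k}. \<forall>b\<in>{..<k}.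
      dist (qf n (\<lambda>i j. K (z y i) (z y j)) (V y a) (V y b)) (if a = b then -1 else 0) < 1 / (real k + 1)"
    using eventually_happens'[OF assms(2) eventually_conj[OF assms(3)]] by blast
  have "k \<le> nneg n (\<lambda>i j. K (z y i) (z y j))"
    using y by (intro nneg_geI[where V = "V y"] herm_kernel_imp_herm[OF assms(1)])
       (auto simp: dist_norm less_imp_le)
  then show ?thesis using negsqI_nneg[OF assms(1)] y(1) by blast
qed

lemma negsq_scale:
  assumes "\<And>z w. z \<in> S \<Longrightarrow> w \<in> S \<Longrightarrow> K1 z w = c z * cnj (c w) * K2 z w" "negsq K1 S k"
  shows "negsq K2 S k"
proof -
  obtain n z V where z: "\<forall>i<n. z i \<in> S"
    and V: "\<forall>a<k. \<forall>b<k. qf n (\<lambda>i j. K1 (z i) (z j)) (V a) (V b) = (if a = b then -1 else 0)"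
    using assms(2) unfolding negsq_def by blast
  have "qf n (\<lambda>i j. K1 (z i) (z j)) (V a) (V b) = qf n (\<lambda>i j. K2 (z i) (z j))
      (\<lambda>i. cnj (c (z i)) * V a i) (\<lambda>i. cnj (c (z i)) * V b i)" for a b
    unfolding qf_def using z by (intro sum.cong refl) (simp add: assms(1) mult_ac)
  then show ?thesis unfolding negsq_def using z V
    by (intro exI[of _ n] exI[of _ z] exI[of _ "\<lambda>a i. cnj (c (z i)) * V a i"]) auto
qed

text \<open>The points are moved horizontally by a small positive \<open>y\<close>, which brings
  them into \<open>T\<close>, and the Gram matrix depends continuously on \<open>y\<close> because
  \<open>z - cnj w\<close> has no zeros on the upper half-plane. Discrete exceptional sets can thus
  be discarded.\<close>

lemma negsq_dense:
  assumes "S \<subseteq> \<complex>\<^sub>+" "\<And>z. z \<in> S \<Longrightarrow> isCont \<phi> z" "\<And>z. z \<in> S \<Longrightarrow> \<forall>\<^sub>F w in at z. w \<in> T"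
    and "negsq (kern \<phi>) S k"
  shows "negsq (kern \<phi>) T k"
proof -
  obtain n z V where z: "\<forall>i<n. z i \<in> S"
    and V: "\<forall>a<k. \<forall>b<k. qf n (\<lambda>i j. kern \<phi> (z i) (z j)) (V a) (V b) = (if a = b then -1 else 0)"
    using assms(4) unfolding negsq_def by blast
  define zy where "zy y i = z i + complex_of_real y" for y i
  have lim: "((\<lambda>y. zy y i) \<longlongrightarrow> z i) (at_right 0)" for i
    unfolding zy_def by (auto intro!: tendsto_eq_intros)
  have flim: "filterlim (\<lambda>y. zy y i) (at (z i)) (at_right 0)" for i
    using lim by (intro filterlim_atI) (auto simp: zy_def eventually_at_right_less eventually_at_filter)
  have "\<forall>\<^sub>F y in at_right 0. \<forall>i\<in>{..<n}. zy y i \<in> T"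
  proof (intro eventually_ball_finite ballI)
    fix i assume "i \<in> {..<n}"
    then show "\<forall>\<^sub>F y in at_right 0. zy y i \<in> T"
      using eventually_compose_filterlim[OF assms(3) flim] z by simp
  qed simp
  then have 1: "\<forall>\<^sub>F y in at_right 0. \<forall>i<n. zy y i \<in> T" by (simp add: Ball_def)
  have \<phi>: "((\<lambda>y. \<phi> (zy y i)) \<longlongrightarrow> \<phi> (z i)) (at_right 0)" if "i < n" for i
    using isCont_tendsto_compose[OF assms(2) lim] z that by blast
  have K: "((\<lambda>y. kern \<phi> (zy y i) (zy y j)) \<longlongrightarrow> kern \<phi> (z i) (z j)) (at_right 0)" if "i < n" "j < n" for i j
  proof -
    have "Im (z i) > 0" "Im (z j) > 0" using z that assms(1) by auto
    then have "z i - cnj (z j) \<noteq> 0" by (auto simp: complex_eq_iff)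
    then show ?thesis unfolding kern_def using that
      by (intro tendsto_intros \<phi> lim)
  qed
  show ?thesis
  proof (rule negsq_limitI[OF herm_kern _ 1])
    fix a b assume "a < k" "b < k"
    have "((\<lambda>y. qf n (\<lambda>i j. kern \<phi> (zy y i) (zy y j)) (V a) (V b))
        \<longlongrightarrow> qf n (\<lambda>i j. kern \<phi> (z i) (z j)) (V a) (V b)) (at_right 0)"
      unfolding qf_def by (intro tendsto_intros K) auto
    then show "((\<lambda>y. qf n (\<lambda>i j. kern \<phi> (zy y i) (zy y j)) (V a) (V b)) \<longlongrightarrow> (if a = b then -1 else 0)) (at_right 0)"
      using V \<open>a < k\<close> \<open>b < k\<close> by simp
  qed simp
qed

lemma sum_lessThan_add: "(\<Sum>i<m + n. f i) = (\<Sum>i<m. f i) + (\<Sum>i<n. f (m + i))"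
  for f :: "nat \<Rightarrow> 'a::comm_monoid_add"
  by (induction n) (simp_all add: sum.lessThan_Suc add.assoc)

section \<open>Kernels with an added polynomial part\<close>

text \<open>The polynomial part sees a test vector only through its \<open>d\<close> moments against
  the powers of \<open>cnj (z i)\<close>, on which it acts as the form with matrix
  \<open>B\<close>.\<close>

lemma qf_polynomial_kernel:
  "qf n (\<lambda>i j. (\<Sum>r<d. \<Sum>s<d. z i ^ r * B r s * cnj (z j) ^ s) + A i j) x y
   = qf d B (\<lambda>r. \<Sum>i<n. cnj (z i) ^ r * x i) (\<lambda>r. \<Sum>i<n. cnj (z i) ^ r * y i) + qf n A x y"
proof -
  have "qf d B (\<lambda>r. \<Sum>i<n. cnj (z i) ^ r * x i) (\<lambda>r. \<Sum>i<n. cnj (z i) ^ r * y i)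
      = (\<Sum>r<d. \<Sum>s<d. \<Sum>i<n. \<Sum>j<n. cnj (x i) * (z i ^ r * B r s * cnj (z j) ^ s) * y j)"
    unfolding qf_def
    by (intro sum.cong refl) (simp add: sum_distrib_left sum_distrib_right mult_ac)
  also have "\<dots> = (\<Sum>r<d. \<Sum>i<n. \<Sum>s<d. \<Sum>j<n. cnj (x i) * (z i ^ r * B r s * cnj (z j) ^ s) * y j)"
    by (intro sum.cong refl sum.swap)
  also have "\<dots> = (\<Sum>i<n. \<Sum>r<d. \<Sum>s<d. \<Sum>j<n. cnj (x i) * (z i ^ r * B r s * cnj (z j) ^ s) * y j)"
    by (rule sum.swap)
  also have "\<dots> = (\<Sum>i<n. \<Sum>r<d. \<Sum>j<n. \<Sum>s<d. cnj (x i) * (z i ^ r * B r s * cnj (z j) ^ s) * y j)"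
    by (intro sum.cong refl sum.swap)
  also have "\<dots> = (\<Sum>i<n. \<Sum>j<n. \<Sum>r<d. \<Sum>s<d. cnj (x i) * (z i ^ r * B r s * cnj (z j) ^ s) * y j)"
    by (intro sum.cong refl sum.swap)
  also have "\<dots> = qf n (\<lambda>i j. \<Sum>r<d. \<Sum>s<d. z i ^ r * B r s * cnj (z j) ^ s) x y"
    unfolding qf_def by (simp add: sum_distrib_left sum_distrib_right)
  finally show ?thesis unfolding qf_def by (simp add: algebra_simps sum.distrib)
qed

text \<open>At fixed points this is subadditivity, with the moment map as \<open>X\<close> and the
  identity as \<open>Y\<close>. If the difference of naturals is truncated, the claim is about 0
  negative squares and holds trivially.\<close>

lemma negsq_polynomial_add_le:
  assumes "negsq K S k" "herm d B"
    and K: "\<And>z w. z \<in> S \<Longrightarrow> w \<in> S \<Longrightarrow> K z w = (\<Sum>r<d. \<Sum>s<d. z ^ r * B r s * cnj w ^ s) + kern g z w"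
  shows "negsq (kern g) S (k - nneg d B)"
proof -
  have poly_herm: "(\<Sum>r<d. \<Sum>s<d. w ^ r * B r s * cnj z ^ s) = cnj (\<Sum>r<d. \<Sum>s<d. z ^ r * B r s * cnj w ^ s)" for z w
  proof -
    have "(\<Sum>r<d. \<Sum>s<d. w ^ r * B r s * cnj z ^ s) = (\<Sum>s<d. \<Sum>r<d. w ^ r * B r s * cnj z ^ s)"
      by (rule sum.swap)
    also have "\<dots> = (\<Sum>s<d. \<Sum>r<d. cnj (z ^ s * B s r * cnj w ^ r))"
    proof (intro sum.cong refl)
      fix s r assume "s \<in> {..<d}" "r \<in> {..<d}"
      then have "B r s = cnj (B s r)" using assms(2) unfolding herm_def by blast
      then show "w ^ r * B r s * cnj z ^ s = cnj (z ^ s * B s r * cnj w ^ r)" by simp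
    qed
    finally show ?thesis by simp
  qed
  have h: "herm_kernel K S"
    unfolding herm_kernel_def
  proof (intro ballI)
    fix z w assume "z \<in> S" "w \<in> S"
    then show "K w z = cnj (K z w)" using poly_herm[of w z] kern_cnj[of g w z] by (simp add: K)
  qed
  obtain n z where z: "\<And>i. i < n \<Longrightarrow> z i \<in> S" "k \<le> nneg n (\<lambda>i j. K (z i) (z j))"
    using negsqE_nneg[OF h assms(1)] by blast
  have "nneg n (\<lambda>i j. K (z i) (z j)) \<le> nneg d B + nneg n (\<lambda>i j. kern g (z i) (z j))"
  proof (rule nneg_subadditive[where X = "\<lambda>r i. cnj (z i) ^ r" and Y = "\<lambda>r i. if i = r then 1 else 0"])
    show "herm n (\<lambda>i j. K (z i) (z j))" "herm n (\<lambda>i j. kern g (z i) (z j))"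
      using z herm_kernel_imp_herm[OF h] herm_kernel_imp_herm[OF herm_kern[of g S]] by blast+
    fix x
    have "qf n (\<lambda>i j. K (z i) (z j)) x x
       = qf n (\<lambda>i j. (\<Sum>r<d. \<Sum>s<d. z i ^ r * B r s * cnj (z j) ^ s) + kern g (z i) (z j)) x x"
      using z K by (intro qf_cong) auto
    moreover have "qf n (\<lambda>i j. kern g (z i) (z j)) (\<lambda>r. \<Sum>i<n. (if i = r then 1 else 0) * x i)
        (\<lambda>r. \<Sum>i<n. (if i = r then 1 else 0) * x i) = qf n (\<lambda>i j. kern g (z i) (z j)) x x"
      by (intro qf_cong) (simp_all add: if_distrib[of "\<lambda>c. c * _"] cong: if_cong)
    ultimately show "Re (qf n (\<lambda>i j. K (z i) (z j)) x x) \<ge>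
        Re (qf d B (\<lambda>r. \<Sum>i<n. cnj (z i) ^ r * x i) (\<lambda>r. \<Sum>i<n. cnj (z i) ^ r * x i))
      + Re (qf n (\<lambda>i j. kern g (z i) (z j)) (\<lambda>r. \<Sum>i<n. (if i = r then 1 else 0) * x i)
        (\<lambda>r. \<Sum>i<n. (if i = r then 1 else 0) * x i))"
      unfolding qf_polynomial_kernel by simp
  qed (use assms in auto)
  then show ?thesis using z by (intro negsqI_nneg[OF herm_kern, of n z]) auto
qed

text \<open>The factors \<open>l + 1\<close> make the powers of \<open>cnj (far y l)\<close> a
  Vandermonde system whose nodes are fixed up to the common factor
  \<open>- \<i> * y\<close>.\<close>

definition far :: "real \<Rightarrow> nat \<Rightarrow> complex" where
  "far y l = \<i> * of_real (y * real (l + 1))"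

lemma cnj_far: "cnj (far y l) = (- \<i> * of_real y) * of_nat (l + 1)"
  by (simp add: far_def)

text \<open>
  Negative squares of the polynomial part are realized by test vectors supported on points
  \<open>far y l\<close> with \<open>y \<rightarrow> \<infinity>\<close>, on which \<open>kern g\<close> is negligible as \<open>g (i y) = o(y)\<close>; the same points are
  used to make the test vectors for \<open>kern g\<close> invisible to the polynomial part.
\<close>

lemma negsq_polynomial_add_ge:
  assumes S: "S \<subseteq> \<complex>\<^sub>+" and "negsq (kern g) S k" "herm d B"
    and K: "\<And>z w. z \<in> S \<Longrightarrow> w \<in> S \<Longrightarrow> K z w = (\<Sum>r<d. \<Sum>s<d. z ^ r * B r s * cnj w ^ s) + kern g z w"
    and h: "herm_kernel K S"
    and ev: "\<forall>\<^sub>F y in at_top. \<i> * complex_of_real y \<in> S"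
    and g0: "((\<lambda>y. g (\<i> * of_real y) / of_real y) \<longlongrightarrow> 0) at_top"
  shows "negsq K S (k + nneg d B)"
proof -
  obtain n z V where z: "\<forall>i<n. z i \<in> S"
    and V: "\<And>a b. a < k \<Longrightarrow> b < k \<Longrightarrow> qf n (\<lambda>i j. kern g (z i) (z j)) (V a) (V b) = (if a = b then -1 else 0)"
    using assms(2) unfolding negsq_def by blast
  obtain \<beta> where \<beta>: "\<And>a b. a < nneg d B \<Longrightarrow> b < nneg d B \<Longrightarrow> qf d B (\<beta> a) (\<beta> b) = (if a = b then -1 else 0)"
    using nneg_vectors[OF assms(3)] by blast
  obtain D :: "nat \<Rightarrow> nat \<Rightarrow> complex" where
    D: "\<And>r s. r < d \<Longrightarrow> s < d \<Longrightarrow> (\<Sum>l<d. of_nat (l + 1) ^ s * D l r) = (if r = s then 1 else 0)"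
    using vandermonde_dual[of d] by blast
  define m where "m a r = (\<Sum>i<n. cnj (z i) ^ r * V a i)" for a r
  define V' where "V' a i = (if a < k then V a i else 0)" for a i
  \<comment> \<open>Moments that the far points have to produce: for \<open>a < k\<close> they
    cancel the moments \<open>m a\<close> of the given vector, for the remaining indices they
    realize the negative vectors \<open>\<beta>\<close> of \<open>B\<close>.\<close>
  define t where "t a r = (if a < k then - m a r else \<beta> (a - k) r)" for a r
  define M where "M a r = (if a < k then 0 else \<beta> (a - k) r)" for a r
  \<comment> \<open>\<open>D\<close> isolates each moment, and the inverse powers compensate for the
    size of the nodes. Since only nonnegative powers of \<open>1 / y\<close> occur, the coefficients
    stay bounded as \<open>y\<close> grows.\<close>
  define cf where "cf y a l = (\<Sum>r<d. D l r * t a r * inverse (- \<i> * of_real y) ^ r)" for y a l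
  define zy where "zy y i = (if i < n then z i else far y (i - n))" for y i
  define X where "X y a i = (if i < n then V' a i else cf y a (i - n))" for y a i
  have far_pow: "(\<Sum>l<d. cnj (far y l) ^ s * cf y a l) = t a s" if "y > 0" "s < d" for y a s
  proof -
    have "(\<Sum>l<d. cnj (far y l) ^ s * cf y a l)
        = (\<Sum>l<d. \<Sum>r<d. (- \<i> * of_real y) ^ s * inverse (- \<i> * of_real y) ^ r * t a r * (of_nat (l + 1) ^ s * D l r))"
      unfolding cf_def sum_distrib_left cnj_far
      by (intro sum.cong refl) (simp only: power_mult_distrib mult_ac)
    also have "\<dots> = (\<Sum>r<d. \<Sum>l<d. (- \<i> * of_real y) ^ s * inverse (- \<i> * of_real y) ^ r * t a r * (of_nat (l + 1) ^ s * D l r))"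
      by (rule sum.swap)
    also have "\<dots> = (\<Sum>r<d. (- \<i> * of_real y) ^ s * inverse (- \<i> * of_real y) ^ r * t a r * (if r = s then 1 else 0))"
      unfolding sum_distrib_left[symmetric] using D that by (intro sum.cong refl) (simp del: of_nat_add)
    also have "\<dots> = (- \<i> * of_real y) ^ s * inverse (- \<i> * of_real y) ^ s * t a s"
      using that(2) by (simp add: if_distrib[of "\<lambda>c. _ * c"] cong: if_cong)
    also have "\<dots> = ((- \<i> * of_real y) * inverse (- \<i> * of_real y)) ^ s * t a s"
      by (simp only: power_mult_distrib)
    also have "(- \<i> * of_real y) * inverse (- \<i> * of_real y) = 1"
      using that(1) by (intro right_inverse) simp
    also have "1 ^ s * t a s = t a s" by simp
    finally show ?thesis .
  qed
  have moment: "(\<Sum>i<n + d. cnj (zy y i) ^ r * X y a i) = M a r" if "y > 0" "r < d" for y a r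
  proof -
    have "(\<Sum>i<n + d. cnj (zy y i) ^ r * X y a i) = (\<Sum>i<n. cnj (z i) ^ r * V' a i) + (\<Sum>l<d. cnj (far y l) ^ r * cf y a l)"
      unfolding sum_lessThan_add by (simp add: zy_def X_def)
    also have "(\<Sum>i<n. cnj (z i) ^ r * V' a i) = (if a < k then m a r else 0)"
      by (simp add: V'_def m_def)
    finally show ?thesis using far_pow[OF that, of a] by (simp add: t_def M_def)
  qed
  have far_lim: "filterlim (\<lambda>y. y * real (l + 1)) at_top at_top" for l
    by (rule filterlim_at_top_mult_tendsto_pos[OF tendsto_const _ filterlim_ident, THEN filterlim_cong[THEN iffD1, OF refl refl, rotated]]) (auto simp: mult.commute)
  have ev_far: "\<forall>\<^sub>F y in at_top. far y l \<in> S" for l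
    using eventually_compose_filterlim[OF ev far_lim[of l]] by (simp add: far_def)
  have "\<forall>\<^sub>F y in at_top. \<forall>l\<in>{..<d}. far y l \<in> S"
    by (intro eventually_ball_finite ballI ev_far) simp
  then have ev_zy: "\<forall>\<^sub>F y in at_top. \<forall>i<n + d. zy y i \<in> S"
    by eventually_elim (use z in \<open>auto simp: zy_def\<close>)
  have gfar: "((\<lambda>y. g (far y l) / of_real y) \<longlongrightarrow> 0) at_top" for l
  proof -
    have "((\<lambda>y. g (\<i> * of_real (y * real (l + 1))) / of_real (y * real (l + 1)) * of_nat (l + 1)) \<longlongrightarrow> 0 * of_nat (l + 1)) at_top"
      by (intro tendsto_mult tendsto_const filterlim_compose[OF g0 far_lim])
    moreover have "\<forall>\<^sub>F y in at_top. g (\<i> * of_real (y * real (l + 1))) / of_real (y * real (l + 1)) * of_nat (l + 1)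
        = g (far y l) / of_real y"
      using eventually_gt_at_top[of 0]
    proof eventually_elim
      case (elim y)
      have "complex_of_real (y * real (l + 1)) = of_real y * of_nat (l + 1)" by simp
      moreover have "(of_nat (l + 1) :: complex) \<noteq> 0" by (simp only: of_nat_eq_0_iff)
      ultimately show ?case unfolding far_def by simp
    qed
    ultimately show ?thesis using Lim_transform_eventually by fastforce
  qed
  have inv0: "((\<lambda>y. c / complex_of_real y) \<longlongrightarrow> 0) at_top" for c
    by (intro tendsto_divide_0[OF tendsto_const] filterlim_of_real_at_infinity)
  have kfar1: "((\<lambda>y. kern g w (far y l)) \<longlongrightarrow> 0) at_top" for w l
  proof -
    \<comment> \<open>Numerator and denominator of the kernel divided by \<open>y\<close>: the
      former tends to 0 because \<open>g\<close> is \<open>o(y)\<close> on the far points, the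
      latter to a nonzero multiple of \<open>\<i>\<close>.\<close>
    have "((\<lambda>y. (g w / of_real y - cnj (g (far y l) / of_real y)) / (w / of_real y + \<i> * of_nat (l + 1)))
        \<longlongrightarrow> (0 - cnj 0) / (0 + \<i> * of_nat (l + 1))) at_top"
      by (intro tendsto_intros gfar inv0) (simp del: of_nat_Suc)
    then have "((\<lambda>y. (g w / of_real y - cnj (g (far y l) / of_real y)) / (w / of_real y + \<i> * of_nat (l + 1))) \<longlongrightarrow> 0) at_top"
      by simp
    then show ?thesis
    proof (rule Lim_transform_eventually)
      show "\<forall>\<^sub>F y in at_top. (g w / of_real y - cnj (g (far y l) / of_real y)) / (w / of_real y + \<i> * of_nat (l + 1)) = kern g w (far y l)"
        using eventually_gt_at_top[of 0]
      proof eventually_elim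
        case (elim y)
        have "(g w / of_real y - cnj (g (far y l) / of_real y)) / (w / of_real y + \<i> * of_nat (l + 1))
          = ((g w - cnj (g (far y l))) / of_real y) / ((w - cnj (far y l)) / of_real y)"
          using elim by (simp add: far_def diff_divide_distrib add_divide_distrib del: of_nat_Suc)
        then show ?case using elim by (simp add: kern_def)
      qed
    qed
  qed
  have kfar2: "((\<lambda>y. kern g (far y l) w) \<longlongrightarrow> 0) at_top" for w l
  proof -
    have "cnj (kern g w (far y l)) = kern g (far y l) w" for y by (rule kern_cnj[symmetric])
    then show ?thesis using tendsto_cnj[OF kfar1[of w l]] by simp
  qed
  have kfar3: "((\<lambda>y. kern g (far y l) (far y l')) \<longlongrightarrow> 0) at_top" for l l'
  proof -
    have nz: "\<i> * of_nat (l + 1) + \<i> * of_nat (l' + 1) \<noteq> (0::complex)"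
      by (simp add: complex_eq_iff)
    have "((\<lambda>y. (g (far y l) / of_real y - cnj (g (far y l') / of_real y)) / (\<i> * of_nat (l + 1) + \<i> * of_nat (l' + 1)))
        \<longlongrightarrow> (0 - cnj 0) / (\<i> * of_nat (l + 1) + \<i> * of_nat (l' + 1))) at_top"
      by (intro tendsto_intros gfar nz)
    then have "((\<lambda>y. (g (far y l) / of_real y - cnj (g (far y l') / of_real y)) / (\<i> * of_nat (l + 1) + \<i> * of_nat (l' + 1))) \<longlongrightarrow> 0) at_top"
      by simp
    then show ?thesis
    proof (rule Lim_transform_eventually)
      show "\<forall>\<^sub>F y in at_top. (g (far y l) / of_real y - cnj (g (far y l') / of_real y)) / (\<i> * of_nat (l + 1) + \<i> * of_nat (l' + 1))
         = kern g (far y l) (far y l')"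
        using eventually_gt_at_top[of 0]
      proof eventually_elim
        case (elim y)
        have "(g (far y l) / of_real y - cnj (g (far y l') / of_real y)) / (\<i> * of_nat (l + 1) + \<i> * of_nat (l' + 1))
          = ((g (far y l) - cnj (g (far y l'))) / of_real y) / ((far y l - cnj (far y l')) / of_real y)"
          using elim by (simp add: far_def diff_divide_distrib add_divide_distrib del: of_nat_Suc)
        then show ?case using elim by (simp add: kern_def)
      qed
    qed
  qed
  have cf_lim: "\<exists>c. ((\<lambda>y. cf y a l) \<longlongrightarrow> c) at_top" for a l
  proof -
    have "((\<lambda>y. inverse (- \<i> * of_real y)) \<longlongrightarrow> 0) at_top"
      using inv0[of \<i>] by (simp add: divide_inverse)
    then have "((\<lambda>y. cf y a l) \<longlongrightarrow> (\<Sum>r<d. D l r * t a r * 0 ^ r)) at_top"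
      unfolding cf_def by (intro tendsto_intros)
    then show ?thesis by blast
  qed
  obtain c0 where c0: "\<And>a l. ((\<lambda>y. cf y a l) \<longlongrightarrow> c0 a l) at_top"
    using cf_lim by metis
  have lim0: "((\<lambda>y. qf (n + d) (\<lambda>i j. kern g (zy y i) (zy y j)) (X y a) (X y b))
     \<longlongrightarrow> qf n (\<lambda>i j. kern g (z i) (z j)) (V' a) (V' b)) at_top" for a b
  proof -
    have eq: "qf (n + d) (\<lambda>i j. kern g (zy y i) (zy y j)) (X y a) (X y b)
      = (\<Sum>i<n. (\<Sum>j<n. cnj (V' a i) * kern g (z i) (z j) * V' b j) + (\<Sum>l<d. cnj (V' a i) * kern g (z i) (far y l) * cf y b l))
      + (\<Sum>l<d. (\<Sum>j<n. cnj (cf y a l) * kern g (far y l) (z j) * V' b j) + (\<Sum>l'<d. cnj (cf y a l) * kern g (far y l) (far y l') * cf y b l'))" for y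
      unfolding qf_def sum_lessThan_add by (simp add: zy_def X_def)
    have "((\<lambda>y. (\<Sum>i<n. (\<Sum>j<n. cnj (V' a i) * kern g (z i) (z j) * V' b j) + (\<Sum>l<d. cnj (V' a i) * kern g (z i) (far y l) * cf y b l))
      + (\<Sum>l<d. (\<Sum>j<n. cnj (cf y a l) * kern g (far y l) (z j) * V' b j) + (\<Sum>l'<d. cnj (cf y a l) * kern g (far y l) (far y l') * cf y b l')))
     \<longlongrightarrow> (\<Sum>i<n. (\<Sum>j<n. cnj (V' a i) * kern g (z i) (z j) * V' b j) + (\<Sum>l<d. cnj (V' a i) * 0 * c0 b l))
      + (\<Sum>l<d. (\<Sum>j<n. cnj (c0 a l) * 0 * V' b j) + (\<Sum>l'<d. cnj (c0 a l) * 0 * c0 b l'))) at_top"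
      by (intro tendsto_intros kfar1 kfar2 kfar3 c0)
    then show ?thesis unfolding eq by (simp add: qf_def)
  qed
  show ?thesis
  proof (rule negsq_limitI[OF h trivial_limit_at_top_linorder ev_zy])
    fix a b assume ab: "a < k + nneg d B" "b < k + nneg d B"
    have 1: "qf d B (M a) (M b) + qf n (\<lambda>i j. kern g (z i) (z j)) (V' a) (V' b) = (if a = b then -1 else 0)"
    proof (cases "a < k"; cases "b < k")
      assume "a < k" "b < k"
      then have "M a = (\<lambda>_. 0)" "V' a = V a" "V' b = V b" by (auto simp: M_def V'_def)
      then show ?thesis using V \<open>a < k\<close> \<open>b < k\<close> by simp
    next
      assume "a < k" "\<not> b < k"
      then have "M a = (\<lambda>_. 0)" "V' b = (\<lambda>_. 0)" by (auto simp: M_def V'_def)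
      then show ?thesis using \<open>a < k\<close> \<open>\<not> b < k\<close> by auto
    next
      assume "\<not> a < k" "b < k"
      then have "M b = (\<lambda>_. 0)" "V' a = (\<lambda>_. 0)" by (auto simp: M_def V'_def)
      then show ?thesis using \<open>b < k\<close> \<open>\<not> a < k\<close> by auto
    next
      assume *: "\<not> a < k" "\<not> b < k"
      then have "M a = \<beta> (a - k)" "M b = \<beta> (b - k)" "V' a = (\<lambda>_. 0)" by (auto simp: M_def V'_def)
      then show ?thesis using * ab \<beta>[of "a - k" "b - k"] by auto
    qed
    have "((\<lambda>y. qf d B (M a) (M b) + qf (n + d) (\<lambda>i j. kern g (zy y i) (zy y j)) (X y a) (X y b))
      \<longlongrightarrow> (if a = b then -1 else 0)) at_top"
      unfolding 1[symmetric] by (intro tendsto_intros lim0)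
    then show "((\<lambda>y. qf (n + d) (\<lambda>i j. K (zy y i) (zy y j)) (X y a) (X y b)) \<longlongrightarrow> (if a = b then -1 else 0)) at_top"
    proof (rule Lim_transform_eventually)
      show "\<forall>\<^sub>F y in at_top. qf d B (M a) (M b) + qf (n + d) (\<lambda>i j. kern g (zy y i) (zy y j)) (X y a) (X y b)
        = qf (n + d) (\<lambda>i j. K (zy y i) (zy y j)) (X y a) (X y b)"
        using ev_zy eventually_gt_at_top[of 0]
      proof eventually_elim
        case (elim y)
        have "qf (n + d) (\<lambda>i j. K (zy y i) (zy y j)) (X y a) (X y b)
          = qf (n + d) (\<lambda>i j. (\<Sum>r<d. \<Sum>s<d. zy y i ^ r * B r s * cnj (zy y j) ^ s) + kern g (zy y i) (zy y j)) (X y a) (X y b)"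
          using elim by (intro qf_cong) (auto simp: K)
        also have "\<dots> = qf d B (\<lambda>r. \<Sum>i<n + d. cnj (zy y i) ^ r * X y a i) (\<lambda>r. \<Sum>i<n + d. cnj (zy y i) ^ r * X y b i)
          + qf (n + d) (\<lambda>i j. kern g (zy y i) (zy y j)) (X y a) (X y b)"
          by (rule qf_polynomial_kernel)
        also have "qf d B (\<lambda>r. \<Sum>i<n + d. cnj (zy y i) ^ r * X y a i) (\<lambda>r. \<Sum>i<n + d. cnj (zy y i) ^ r * X y b i)
          = qf d B (M a) (M b)"
          using elim by (intro qf_cong) (simp_all add: moment)
        finally show ?case by simp
      qed
    qed
  qed
qed

text \<open>The kernel function of \<open>\<phi>\<close> at \<open>\<i> * y\<close>, scaled by
  \<open>\<i> * y\<close>, has with other kernel functions inner products tending to values of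
  \<open>\<phi>\<close> and their conjugates, and its own square tends to \<open>s0\<close>. Hence
  \<open>K\<close> is the limiting Gram kernel of kernel functions multiplied by conjugated points
  plus this one extra vector, and a single additional point \<open>\<i> * y\<close> suffices to
  transfer test vectors.\<close>

lemma negsq_shift_le:
  assumes S: "S \<subseteq> \<complex>\<^sub>+" and "negsq K S k"
    and K: "\<And>z w. z \<in> S \<Longrightarrow> w \<in> S \<Longrightarrow>
      K z w = z * cnj w * kern \<phi> z w + z * \<phi> z + cnj (w * \<phi> w) + of_real s0"
    and ev: "\<forall>\<^sub>F y in at_top. \<i> * complex_of_real y \<in> S"
    and lim: "((\<lambda>y. \<i> * of_real y * \<phi> (\<i> * of_real y)) \<longlongrightarrow> - of_real s0) at_top"
  shows "negsq (kern \<phi>) S k"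
proof -
  obtain n z V where z: "\<forall>i<n. z i \<in> S"
    and V: "\<And>a b. a < k \<Longrightarrow> b < k \<Longrightarrow> qf n (\<lambda>i j. K (z i) (z j)) (V a) (V b) = (if a = b then -1 else 0)"
    using assms(2) unfolding negsq_def by blast
  define zy where "zy y i = (if i < n then z i else \<i> * complex_of_real y)" for y i
  define T where "T a = (\<Sum>j<n. V a j)" for a
  \<comment> \<open>Besides the factor \<open>cnj (z i)\<close>, every entry of the vector
    contributes equally to the extra point, whence the total \<open>T a\<close> there.\<close>
  define X where "X y a i = (if i < n then cnj (z i) * V a i else \<i> * complex_of_real y * T a)" for y a i
  have ev_zy: "\<forall>\<^sub>F y in at_top. \<forall>i<Suc n. zy y i \<in> S"
    using ev by eventually_elim (use z in \<open>auto simp: zy_def\<close>)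
  define P where "P y = \<i> * of_real y * \<phi> (\<i> * of_real y)" for y
  have P: "(P \<longlongrightarrow> - of_real s0) at_top" using lim by (simp add: P_def[abs_def])
  have inv0: "((\<lambda>y. c / complex_of_real y) \<longlongrightarrow> 0) at_top" for c
    by (intro tendsto_divide_0[OF tendsto_const] filterlim_of_real_at_infinity)
  have k1: "((\<lambda>y. kern \<phi> w (\<i> * of_real y) * (\<i> * of_real y)) \<longlongrightarrow> \<phi> w) at_top" for w
  proof -
    have "((\<lambda>y. (\<phi> w * \<i> + cnj (P y) * (1 / of_real y)) / (w / of_real y + \<i>))
        \<longlongrightarrow> (\<phi> w * \<i> + cnj (- of_real s0) * 0) / (0 + \<i>)) at_top"
      by (intro tendsto_intros inv0 P) simp
    moreover have "(\<phi> w * \<i> + cnj (- of_real s0) * 0) / (0 + \<i>) = \<phi> w"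
      by (simp only: mult_zero_right add_0_right add_0_left nonzero_mult_div_cancel_right complex_i_not_zero not_False_eq_True)
    ultimately have "((\<lambda>y. (\<phi> w * \<i> + cnj (P y) * (1 / of_real y)) / (w / of_real y + \<i>)) \<longlongrightarrow> \<phi> w) at_top"
      by (simp only:)
    then show ?thesis
    proof (rule Lim_transform_eventually)
      show "\<forall>\<^sub>F y in at_top. (\<phi> w * \<i> + cnj (P y) * (1 / of_real y)) / (w / of_real y + \<i>)
          = kern \<phi> w (\<i> * of_real y) * (\<i> * of_real y)"
        using eventually_gt_at_top[of 0]
      proof eventually_elim
        case (elim y)
        have "\<phi> w * \<i> + cnj (P y) * (1 / of_real y) = (\<phi> w - cnj (\<phi> (\<i> * of_real y))) * \<i>"
          using elim by (simp add: P_def field_simps)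
        moreover have "w / of_real y + \<i> = (w - cnj (\<i> * of_real y)) / of_real y"
          using elim by (simp add: field_simps)
        ultimately show ?case by (simp add: kern_def mult_ac)
      qed
    qed
  qed
  have k2: "((\<lambda>y. cnj (\<i> * of_real y) * kern \<phi> (\<i> * of_real y) w) \<longlongrightarrow> cnj (\<phi> w)) at_top" for w
  proof -
    have "((\<lambda>y. cnj (kern \<phi> w (\<i> * of_real y) * (\<i> * of_real y))) \<longlongrightarrow> cnj (\<phi> w)) at_top"
      by (intro tendsto_intros k1)
    then show ?thesis unfolding kern_cnj[of \<phi> w] by (simp add: mult_ac)
  qed
  have k3: "((\<lambda>y. cnj (\<i> * of_real y) * kern \<phi> (\<i> * of_real y) (\<i> * of_real y) * (\<i> * of_real y)) \<longlongrightarrow> of_real s0) at_top"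
  proof -
    have "((\<lambda>y. - (P y + cnj (P y)) / 2) \<longlongrightarrow> - (- of_real s0 + cnj (- of_real s0)) / 2) at_top"
      by (intro tendsto_intros P) simp
    then have "((\<lambda>y. - (P y + cnj (P y)) / 2) \<longlongrightarrow> of_real s0) at_top" by simp
    then show ?thesis
    proof (rule Lim_transform_eventually)
      show "\<forall>\<^sub>F y in at_top. - (P y + cnj (P y)) / 2
          = cnj (\<i> * of_real y) * kern \<phi> (\<i> * of_real y) (\<i> * of_real y) * (\<i> * of_real y)"
        using eventually_gt_at_top[of 0]
      proof eventually_elim
        case (elim y)
        define c where "c = \<i> * complex_of_real y"
        \<comment> \<open>On the imaginary axis conjugation is negation, so the kernel denominator
          is \<open>2 * c\<close> and the scaled diagonal entry becomes minus the real part of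
          \<open>P y\<close>.\<close>
        have c: "cnj c = - c" "c \<noteq> 0" using elim by (simp_all add: c_def)
        show ?case
          unfolding P_def kern_def c_def[symmetric] using c(2) by (simp add: c(1) field_simps)
      qed
    qed
  qed
  show ?thesis
  proof (rule negsq_limitI[OF herm_kern trivial_limit_at_top_linorder ev_zy])
    fix a b assume ab: "a < k" "b < k"
    have eq: "qf (Suc n) (\<lambda>i j. kern \<phi> (zy y i) (zy y j)) (X y a) (X y b)
      = (\<Sum>i<n. (\<Sum>j<n. z i * cnj (V a i) * kern \<phi> (z i) (z j) * (cnj (z j) * V b j))
            + z i * cnj (V a i) * (kern \<phi> (z i) (\<i> * of_real y) * (\<i> * of_real y)) * T b)
      + ((\<Sum>j<n. cnj (T a) * (cnj (\<i> * of_real y) * kern \<phi> (\<i> * of_real y) (z j)) * (cnj (z j) * V b j))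
          + cnj (T a) * (cnj (\<i> * of_real y) * kern \<phi> (\<i> * of_real y) (\<i> * of_real y) * (\<i> * of_real y)) * T b)" for y
      unfolding qf_def sum.lessThan_Suc by (simp add: zy_def X_def mult_ac)
    have "((\<lambda>y. qf (Suc n) (\<lambda>i j. kern \<phi> (zy y i) (zy y j)) (X y a) (X y b)) \<longlongrightarrow>
      (\<Sum>i<n. (\<Sum>j<n. z i * cnj (V a i) * kern \<phi> (z i) (z j) * (cnj (z j) * V b j))
            + z i * cnj (V a i) * \<phi> (z i) * T b)
      + ((\<Sum>j<n. cnj (T a) * cnj (\<phi> (z j)) * (cnj (z j) * V b j)) + cnj (T a) * of_real s0 * T b)) at_top"
      unfolding eq by (intro tendsto_intros k1 k2 k3)
    also have "(\<Sum>i<n. (\<Sum>j<n. z i * cnj (V a i) * kern \<phi> (z i) (z j) * (cnj (z j) * V b j))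
            + z i * cnj (V a i) * \<phi> (z i) * T b)
      + ((\<Sum>j<n. cnj (T a) * cnj (\<phi> (z j)) * (cnj (z j) * V b j)) + cnj (T a) * of_real s0 * T b)
      = qf n (\<lambda>i j. K (z i) (z j)) (V a) (V b)"
    proof -
      have t: "cnj (T a) * x = (\<Sum>i<n. cnj (V a i) * x)" for x by (simp add: T_def sum_distrib_right)
      have e1: "z i * cnj (V a i) * \<phi> (z i) * T b = (\<Sum>j<n. cnj (V a i) * (z i * \<phi> (z i)) * V b j)" for i
        unfolding T_def sum_distrib_left by (simp add: mult_ac)
      have e2: "(\<Sum>j<n. cnj (T a) * cnj (\<phi> (z j)) * (cnj (z j) * V b j))
         = (\<Sum>i<n. \<Sum>j<n. cnj (V a i) * cnj (z j * \<phi> (z j)) * V b j)"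
        by (subst sum.swap) (simp add: T_def sum_distrib_left sum_distrib_right mult_ac)
      have e3: "cnj (T a) * of_real s0 * T b = (\<Sum>i<n. \<Sum>j<n. cnj (V a i) * of_real s0 * V b j)"
        by (simp add: T_def sum_distrib_left sum_distrib_right mult_ac sum_product)
      have "qf n (\<lambda>i j. K (z i) (z j)) (V a) (V b)
        = qf n (\<lambda>i j. z i * cnj (z j) * kern \<phi> (z i) (z j) + z i * \<phi> (z i) + cnj (z j * \<phi> (z j)) + of_real s0) (V a) (V b)"
        using z K by (intro qf_cong) auto
      also have "\<dots> = (\<Sum>i<n. \<Sum>j<n. z i * cnj (V a i) * kern \<phi> (z i) (z j) * (cnj (z j) * V b j)
          + cnj (V a i) * (z i * \<phi> (z i)) * V b j + cnj (V a i) * cnj (z j * \<phi> (z j)) * V b j + cnj (V a i) * of_real s0 * V b j)"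
        unfolding qf_def by (intro sum.cong refl) (simp add: algebra_simps)
      finally show ?thesis unfolding e1 e2 e3 by (simp add: sum.distrib algebra_simps)
    qed
    finally show "((\<lambda>y. qf (Suc n) (\<lambda>i j. kern \<phi> (zy y i) (zy y j)) (X y a) (X y b)) \<longlongrightarrow> (if a = b then -1 else 0)) at_top"
      using V ab by simp
  qed
qed

section \<open>Symmetric meromorphic functions and nontangential limits\<close>

lemma open_upper_half: "open \<complex>\<^sub>+"
  by (rule open_halfspace_Im_gt)

lemma connected_upper_half: "connected \<complex>\<^sub>+"
  by (intro convex_connected convex_halfspace_Im_gt)

lemma eventually_cosparse_upper_half_imp: "(\<forall>\<^sub>\<approx>z\<in>\<complex>\<^sub>+. P z) \<Longrightarrow> Im z > 0 \<Longrightarrow> \<forall>\<^sub>F w in at z. P w"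
  by (rule eventually_cosparse_imp_eventually_at) auto

lemma eventually_upper_half_cosparse: "\<forall>\<^sub>\<approx>z\<in>\<complex>\<^sub>+. Im z > 0"
  using eventually_in_cosparse[OF order.refl open_upper_half] by simp

lemma remove_sings_nicely_meromorphic_eq:
  assumes "f nicely_meromorphic_on A" "z \<in> A"
  shows "remove_sings f z = f z"
  using assms unfolding nicely_meromorphic_on_def by (metis remove_sings_at_pole remove_sings_eqI)

lemma mero_sym_meromorphic: "\<phi> \<in> mero_sym \<Longrightarrow> \<phi> meromorphic_on \<complex>\<^sub>+"
  by (simp add: mero_sym_def nicely_meromorphic_on_def)

text \<open>The representatives have the value 0 at poles, so a nonzero value excludes a
  pole.\<close>

lemma mero_sym_analytic_at:
  assumes "\<phi> \<in> mero_sym" "Im z > 0" "\<phi> z \<noteq> 0"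
  shows "\<phi> analytic_on {z}"
proof -
  have n: "\<phi> nicely_meromorphic_on \<complex>\<^sub>+" using assms by (simp add: mero_sym_def)
  have "\<not> is_pole \<phi> z"
    using remove_sings_nicely_meromorphic_eq[OF n, of z] assms remove_sings_at_pole[of \<phi> z] by auto
  then show ?thesis using nicely_meromorphic_on_imp_analytic_at[OF n, of z] assms by auto
qed

text \<open>Since removable singularities are removed in the representative, agreement on a
  punctured neighbourhood with an analytic function extends to the point itself.\<close>

lemma mero_sym_cong_at:
  assumes "\<phi> \<in> mero_sym" "Im z > 0" "f analytic_on {z}" "\<forall>\<^sub>F w in at z. \<phi> w = f w"
  shows "\<phi> analytic_on {z}" "\<phi> z = f z"
proof -
  have n: "\<phi> nicely_meromorphic_on \<complex>\<^sub>+" using assms by (simp add: mero_sym_def)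
  show eq: "\<phi> z = f z"
    using remove_sings_nicely_meromorphic_eq[OF n, of z] assms remove_sings_cong[OF assms(4) refl] by auto
  have "\<forall>\<^sub>F w in nhds z. \<phi> w = f w"
    using assms(4) eq by (auto simp: eventually_at_filter elim!: eventually_mono)
  then show "\<phi> analytic_on {z}" using assms(3) analytic_at_cong by blast
qed

lemma sym_ext_upper: "Im z > 0 \<Longrightarrow> sym_ext f z = remove_sings f z"
  by (simp add: sym_ext_def)

lemma sym_ext_mero_sym:
  assumes "f meromorphic_on \<complex>\<^sub>+"
  shows "sym_ext f \<in> mero_sym"
proof -
  have ev: "\<forall>\<^sub>F w in at z. sym_ext f w = remove_sings f w" if "Im z > 0" for z
    using eventually_at_in_open'[OF open_upper_half, of z] that
    by (auto elim!: eventually_mono simp: sym_ext_upper)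
  have n: "remove_sings f nicely_meromorphic_on \<complex>\<^sub>+"
    by (rule remove_sings_nicely_meromorphic[OF assms])
  have "sym_ext f nicely_meromorphic_on \<complex>\<^sub>+"
    unfolding nicely_meromorphic_on_def
  proof (intro conjI ballI)
    show "sym_ext f meromorphic_on \<complex>\<^sub>+"
      using n ev by (subst meromorphic_on_cong[where g = "remove_sings f"]) (auto simp: nicely_meromorphic_on_def)
    fix z assume "z \<in> \<complex>\<^sub>+"
    then have z: "Im z > 0" by simp
    have "is_pole (sym_ext f) z \<longleftrightarrow> is_pole (remove_sings f) z"
      by (rule is_pole_cong[OF ev[OF z] refl])
    moreover have "sym_ext f \<midarrow>z\<rightarrow> sym_ext f z \<longleftrightarrow> remove_sings f \<midarrow>z\<rightarrow> remove_sings f z"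
      using tendsto_cong[OF ev[OF z]] sym_ext_upper[OF z, of f] by simp
    ultimately show "is_pole (sym_ext f) z \<and> sym_ext f z = 0 \<or> sym_ext f \<midarrow>z\<rightarrow> sym_ext f z"
      using n z sym_ext_upper[OF z, of f] by (auto simp: nicely_meromorphic_on_def)
  qed
  then show ?thesis by (auto simp: mero_sym_def sym_ext_def)
qed

lemma sym_ext_cosparse:
  assumes "f meromorphic_on \<complex>\<^sub>+"
  shows "\<forall>\<^sub>\<approx>z\<in>\<complex>\<^sub>+. sym_ext f z = f z"
  using eventually_remove_sings_eq[OF assms] eventually_upper_half_cosparse
  by eventually_elim (simp add: sym_ext_upper)

text \<open>Representatives are unique: off the upper half-plane both sides are determined by
  symmetry or vanish by convention. This turns identities that hold off a discrete set into
  equalities of functions.\<close>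

lemma sym_ext_eqI:
  assumes "\<phi> \<in> mero_sym" "\<forall>\<^sub>\<approx>z\<in>\<complex>\<^sub>+. f z = \<phi> z"
  shows "sym_ext f = \<phi>"
proof -
  have n: "\<phi> nicely_meromorphic_on \<complex>\<^sub>+" using assms by (simp add: mero_sym_def)
  have up: "remove_sings f z = \<phi> z" if "Im z > 0" for z
    using remove_sings_nicely_meromorphic_eq[OF n, of z] that
      remove_sings_cong[OF eventually_cosparse_upper_half_imp[OF assms(2) that] refl] by simp
  have low: "\<phi> z = cnj (\<phi> (cnj z))" if "Im z < 0" for z
  proof -
    have "\<forall>z\<in>\<complex>\<^sub>+. \<phi> (cnj z) = cnj (\<phi> z)" using assms(1) by (simp add: mero_sym_def)
    from bspec[OF this, of "cnj z"] that show ?thesis by simp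
  qed
  show ?thesis
  proof
    fix z
    consider "Im z > 0" | "Im z < 0" | "Im z = 0" by linarith
    then show "sym_ext f z = \<phi> z"
    proof cases
      case 2
      then show ?thesis using low[OF 2] up[of "cnj z"] by (simp add: sym_ext_def)
    next
      case 3
      then show ?thesis using assms(1) by (simp add: sym_ext_def mero_sym_def)
    qed (simp add: sym_ext_def up)
  qed
qed

lemma mero_sym_eqI:
  assumes "\<phi> \<in> mero_sym" "\<psi> \<in> mero_sym" "\<forall>\<^sub>\<approx>z\<in>\<complex>\<^sub>+. \<phi> z = \<psi> z"
  shows "\<phi> = \<psi>"
  using sym_ext_eqI[OF assms(1), of \<phi>] sym_ext_eqI[OF assms(2), of \<phi>] assms(3) by simp

lemma mero_sym_analytic_cosparse:
  "\<phi> \<in> mero_sym \<Longrightarrow> \<forall>\<^sub>\<approx>z\<in>\<complex>\<^sub>+. z \<in> holo_points \<phi>"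
  using meromorphic_on_imp_analytic_cosparse[OF mero_sym_meromorphic] eventually_upper_half_cosparse
  by (simp add: holo_points_def eventually_conj_iff)

section \<open>The generalized Nevanlinna classes in terms of test vectors\<close>

lemma neg_eigs_pick_matrix:
  "neg_eigs (pick_matrix \<phi> zs) = nneg (length zs) (\<lambda>i j. kern \<phi> (zs ! i) (zs ! j))"
  unfolding nneg_def pick_matrix_def kern_def ..

lemma negsq_iff_pick:
  "negsq (kern \<phi>) S k \<longleftrightarrow> (\<exists>zs. set zs \<subseteq> S \<and> k \<le> neg_eigs (pick_matrix \<phi> zs))"
proof
  assume "negsq (kern \<phi>) S k"
  then obtain n z where z: "\<And>i. i < n \<Longrightarrow> z i \<in> S" "k \<le> nneg n (\<lambda>i j. kern \<phi> (z i) (z j))"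
    using negsqE_nneg[OF herm_kern] by blast
  have "Matrix.mat n n (\<lambda>(i, j). kern \<phi> (map z [0..<n] ! i) (map z [0..<n] ! j))
     = Matrix.mat n n (\<lambda>(i, j). kern \<phi> (z i) (z j))" by (rule eq_matI) auto
  then have "k \<le> neg_eigs (pick_matrix \<phi> (map z [0..<n]))"
    using z(2) unfolding neg_eigs_pick_matrix nneg_def by simp
  then show "\<exists>zs. set zs \<subseteq> S \<and> k \<le> neg_eigs (pick_matrix \<phi> zs)"
    using z(1) by (intro exI[of _ "map z [0..<n]"]) auto
next
  assume "\<exists>zs. set zs \<subseteq> S \<and> k \<le> neg_eigs (pick_matrix \<phi> zs)"
  then obtain zs where "set zs \<subseteq> S" "k \<le> nneg (length zs) (\<lambda>i j. kern \<phi> (zs ! i) (zs ! j))"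
    unfolding neg_eigs_pick_matrix by blast
  then show "negsq (kern \<phi>) S k" by (intro negsqI_nneg[OF herm_kern]) auto
qed

abbreviation negsq_fun :: "(complex \<Rightarrow> complex) \<Rightarrow> nat \<Rightarrow> bool" where
  "negsq_fun \<phi> \<equiv> negsq (kern \<phi>) (holo_points \<phi>)"

text \<open>The maximal number of negative eigenvalues of Pick matrices is the \<open>k\<close> for
  which \<open>k\<close> negative squares are attained and \<open>Suc k\<close> are not. Membership
  can then be moved between functions by equivalences for \<open>negsq_fun\<close> alone.\<close>

lemma nev_iff:
  "\<phi> \<in> nev \<kappa> \<longleftrightarrow> \<phi> \<in> mero_sym \<and> (\<exists>k. \<kappa> = int k \<and> negsq_fun \<phi> k \<and> \<not> negsq_fun \<phi> (Suc k))"
proof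
  assume "\<phi> \<in> nev \<kappa>"
  then have m: "\<phi> \<in> mero_sym"
    and le: "\<And>zs. set zs \<subseteq> holo_points \<phi> \<Longrightarrow> int (neg_eigs (pick_matrix \<phi> zs)) \<le> \<kappa>"
    and ex: "\<exists>zs. set zs \<subseteq> holo_points \<phi> \<and> int (neg_eigs (pick_matrix \<phi> zs)) = \<kappa>"
    by (auto simp: nev_def)
  then obtain zs where zs: "set zs \<subseteq> holo_points \<phi>" "\<kappa> = int (neg_eigs (pick_matrix \<phi> zs))" by auto
  have "negsq_fun \<phi> (neg_eigs (pick_matrix \<phi> zs))" using zs unfolding negsq_iff_pick by blast
  moreover have "\<not> negsq_fun \<phi> (Suc (neg_eigs (pick_matrix \<phi> zs)))"
    unfolding negsq_iff_pick using le zs(2) by fastforce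
  ultimately show "\<phi> \<in> mero_sym \<and> (\<exists>k. \<kappa> = int k \<and> negsq_fun \<phi> k \<and> \<not> negsq_fun \<phi> (Suc k))"
    using m zs by blast
next
  assume "\<phi> \<in> mero_sym \<and> (\<exists>k. \<kappa> = int k \<and> negsq_fun \<phi> k \<and> \<not> negsq_fun \<phi> (Suc k))"
  then obtain k where k: "\<phi> \<in> mero_sym" "\<kappa> = int k" "negsq_fun \<phi> k" "\<not> negsq_fun \<phi> (Suc k)" by blast
  have le: "neg_eigs (pick_matrix \<phi> zs) \<le> k" if "set zs \<subseteq> holo_points \<phi>" for zs
    using k(4) that unfolding negsq_iff_pick by (metis not_less_eq_eq)
  obtain zs where "set zs \<subseteq> holo_points \<phi>" "k \<le> neg_eigs (pick_matrix \<phi> zs)"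
    using k(3) unfolding negsq_iff_pick by blast
  with le have "set zs \<subseteq> holo_points \<phi>" "neg_eigs (pick_matrix \<phi> zs) = k" by (auto intro: antisym)
  then show "\<phi> \<in> nev \<kappa>" unfolding nev_def using k le by auto
qed

text \<open>By density the points may be restricted to any generic set of holomorphy points, in
  particular to one where an identity between meromorphic functions holds pointwise.\<close>

lemma negsq_fun_generic:
  assumes "\<phi> \<in> mero_sym" "T \<subseteq> holo_points \<phi>" "\<forall>\<^sub>\<approx>z\<in>\<complex>\<^sub>+. z \<in> T"
  shows "negsq_fun \<phi> k \<longleftrightarrow> negsq (kern \<phi>) T k"
proof
  assume "negsq_fun \<phi> k"
  then show "negsq (kern \<phi>) T k"
  proof (rule negsq_dense[rotated -1])
    show "holo_points \<phi> \<subseteq> \<complex>\<^sub>+" by (auto simp: holo_points_def)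
    fix z assume z: "z \<in> holo_points \<phi>"
    then show "isCont \<phi> z" by (auto simp: holo_points_def intro: analytic_at_imp_isCont)
    show "\<forall>\<^sub>F w in at z. w \<in> T"
      using z by (intro eventually_cosparse_upper_half_imp[OF assms(3)]) (simp add: holo_points_def)
  qed
qed (use assms negsq_subset in blast)

section \<open>Nontangential approach to infinity\<close>

lemma eventually_nontang_upper: "\<delta> > 0 \<Longrightarrow> \<forall>\<^sub>F z in nontang \<delta>. Im z > 0"
  unfolding nontang_def eventually_inf_principal
  by (intro always_eventually allI impI) (use Arg_lt_pi in force)

lemma nontang_le_at_infinity: "nontang \<delta> \<le> at_infinity"
  by (simp add: nontang_def)

lemma filterlim_imag_axis_nontang:
  assumes "\<delta> < pi / 2"
  shows "filterlim (\<lambda>y. \<i> * complex_of_real y) (nontang \<delta>) at_top"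
proof -
  have "filterlim (\<lambda>y. norm (\<i> * complex_of_real y)) at_top at_top"
    by (rule filterlim_at_top_mono[OF filterlim_ident]) (simp add: norm_mult abs_ge_self)
  then have "filterlim (\<lambda>y. \<i> * complex_of_real y) at_infinity at_top"
    by (rule filterlim_norm_at_top_imp_at_infinity)
  moreover have "\<forall>\<^sub>F y in at_top. \<delta> < Arg (\<i> * complex_of_real y) \<and> Arg (\<i> * complex_of_real y) < pi - \<delta>"
    using eventually_gt_at_top[of 0]
    by eventually_elim (use assms in \<open>simp add: mult.commute[of \<i>] Arg_times_of_real\<close>)
  ultimately show ?thesis
    unfolding nontang_def filterlim_inf filterlim_principal by simp
qed

text \<open>A small value at a point says nothing about a pole there, as the value at a pole is 0 by
  convention. But the points near a pole lie in the same sector, and there \<open>\<phi>\<close>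
  exceeds every bound, against \<open>cmod (\<phi> w) < cmod w\<close>.\<close>

lemma eventually_nontang_analytic:
  assumes "\<phi> \<in> mero_sym" "\<delta> > 0" "((\<lambda>z. \<phi> z / z) \<longlongrightarrow> 0) (nontang \<delta>)"
  shows "\<forall>\<^sub>F z in nontang \<delta>. \<phi> analytic_on {z}"
proof -
  define sec where "sec = (\<lambda>z. \<delta> < Arg z \<and> Arg z < pi - \<delta>)"
  have "\<forall>\<^sub>F z in nontang \<delta>. cmod (\<phi> z / z) < 1"
    using order_tendstoD(2)[OF tendsto_norm[OF assms(3)], of 1] by simp
  then obtain R where R: "\<And>z. cmod z \<ge> R \<Longrightarrow> sec z \<Longrightarrow> cmod (\<phi> z / z) < 1"
    unfolding nontang_def eventually_inf_principal eventually_at_infinity sec_def by auto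
  have an: "\<phi> analytic_on {z}" if z: "cmod z > R" "sec z" for z
  proof (rule ccontr)
    assume na: "\<not> \<phi> analytic_on {z}"
    have Im: "Im z > 0" using z(2) assms(2) Arg_lt_pi[of z] by (auto simp: sec_def)
    then have "z \<notin> \<real>\<^sub>\<le>\<^sub>0" by (auto simp: complex_nonpos_Reals_iff)
    then have "isCont Arg z" by (rule continuous_at_Arg)
    then have "(Arg \<longlongrightarrow> Arg z) (at z)" by (simp add: isCont_def)
    then have 1: "\<forall>\<^sub>F w in at z. sec w"
      unfolding sec_def using z(2) unfolding sec_def by (intro eventually_conj order_tendstoD) auto
    have lim: "((\<lambda>w. cmod w) \<longlongrightarrow> cmod z) (at z)" by (intro tendsto_intros)
    have 2: "\<forall>\<^sub>F w in at z. cmod w > R" "\<forall>\<^sub>F w in at z. cmod w < cmod z + 1"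
      using order_tendstoD[OF lim] z(1) by auto
    have "is_pole \<phi> z"
      using nicely_meromorphic_on_imp_analytic_at[of \<phi> "\<complex>\<^sub>+" z] assms(1) na Im by (auto simp: mero_sym_def)
    then have "filterlim \<phi> at_infinity (at z)" by (simp add: is_pole_def)
    then have 3: "\<forall>\<^sub>F w in at z. cmod (\<phi> w) \<ge> cmod z + 1"
      by (subst (asm) filterlim_at_infinity[OF order.refl]) (auto dest!: spec[of _ "cmod z + 1"] simp: add_nonneg_pos)
    have "\<forall>\<^sub>F w in at z. False"
      using 1 2 3
    proof eventually_elim
      case (elim w)
      have "cmod (\<phi> w) / cmod w < 1" using R[of w] elim by (simp add: norm_divide)
      moreover have "cmod w > 0"
        using elim assms(2) by (auto simp: sec_def Arg_zero)
      ultimately have "cmod (\<phi> w) < cmod w" by simp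
      then show False using elim by linarith
    qed
    then show False by simp
  qed
  show ?thesis
    unfolding nontang_def eventually_inf_principal eventually_at_infinity
    by (rule exI[of _ "R + 1"]) (use an in \<open>auto simp: sec_def\<close>)
qed

section \<open>Negative squares along one step\<close>

definition cpoly :: "real poly \<Rightarrow> complex \<Rightarrow> complex" where
  "cpoly p z = poly (map_poly complex_of_real p) z"

lemma cpoly_altdef: "cpoly p z = (\<Sum>i\<le>degree p. of_real (coeff p i) * z ^ i)"
  by (simp add: cpoly_def poly_altdef)

lemma cpoly_cnj: "cpoly p (cnj z) = cnj (cpoly p z)"
  by (simp add: cpoly_altdef)

lemma cpoly_analytic [analytic_intros]: "cpoly p analytic_on S"
  unfolding cpoly_altdef[abs_def] by (intro analytic_intros)

lemma cpoly_meromorphic [meromorphic_intros]: "cpoly p meromorphic_on S"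
  by (intro analytic_on_imp_meromorphic_on cpoly_analytic)

definition bezout_coeff :: "real poly \<Rightarrow> nat \<Rightarrow> nat \<Rightarrow> complex" where
  "bezout_coeff p r s = of_real (coeff p (r + s + 1))"

lemma herm_bezout_coeff: "herm d (bezout_coeff p)"
  by (simp add: herm_def bezout_coeff_def add.commute)

lemma kern_cpoly:
  assumes "Im z > 0" "Im w > 0"
  shows "kern (cpoly p) z w = (\<Sum>r<degree p. \<Sum>s<degree p. z ^ r * bezout_coeff p r s * cnj w ^ s)"
proof -
  have ne: "z - cnj w \<noteq> 0" using assms by (auto simp: complex_eq_iff)
  have "cpoly p z - cnj (cpoly p w) = (\<Sum>i\<le>degree p. of_real (coeff p i) * z ^ i) - (\<Sum>i\<le>degree p. of_real (coeff p i) * cnj w ^ i)"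
    unfolding cpoly_cnj[symmetric] unfolding cpoly_altdef ..
  also have "\<dots> = (z - cnj w) * (\<Sum>r<degree p. \<Sum>s<degree p - r. of_real (coeff p (r + s + 1)) * cnj w ^ s * z ^ r)"
  proof (cases "degree p \<ge> 1")
    case True
    from polyfun_diff_alt[where a = "\<lambda>i. complex_of_real (coeff p i)" and x = z and y = "cnj w", OF this]
    show ?thesis by simp
  qed (simp add: not_le)
  also have "(\<Sum>r<degree p. \<Sum>s<degree p - r. of_real (coeff p (r + s + 1)) * cnj w ^ s * z ^ r)
    = (\<Sum>r<degree p. \<Sum>s<degree p. z ^ r * bezout_coeff p r s * cnj w ^ s)"
    by (intro sum.cong refl sum.mono_neutral_cong_left)
       (auto simp: bezout_coeff_def coeff_eq_0)
  finally show ?thesis using ne by (simp add: kern_def)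
qed

section \<open>One step as a relation between meromorphic functions\<close>

text \<open>Here \<open>q\<close> stands for \<open>\<epsilon> p\<close>. The formula is required
  only off a discrete set, because the conventional value 0 at a pole of \<open>\<tau>\<close> need
  not produce the value 0 that \<open>\<phi>\<close> has there.\<close>

definition step_rel :: "real poly \<Rightarrow> real \<Rightarrow> (complex \<Rightarrow> complex) \<Rightarrow> (complex \<Rightarrow> complex) \<Rightarrow> bool" where
  "step_rel q a \<phi> \<tau> \<longleftrightarrow> \<phi> \<in> mero_sym \<and> \<tau> \<in> mero_sym \<and>
     (\<forall>\<^sub>\<approx>z\<in>\<complex>\<^sub>+. cpoly q z + of_real (a\<^sup>2) * \<tau> z \<noteq> 0 \<and> \<phi> z = - 1 / (cpoly q z + of_real (a\<^sup>2) * \<tau> z))"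

lemma step_rel_forward_at:
  assumes "step_rel q a \<phi> \<tau>" "Im z > 0" "\<tau> analytic_on {z}" "cpoly q z + of_real (a\<^sup>2) * \<tau> z \<noteq> 0"
  shows "\<phi> analytic_on {z}" "\<phi> z = - 1 / (cpoly q z + of_real (a\<^sup>2) * \<tau> z)"
proof -
  have "(\<lambda>w. - 1 / (cpoly q w + of_real (a\<^sup>2) * \<tau> w)) analytic_on {z}"
    using assms by (intro analytic_intros) auto
  moreover have "\<forall>\<^sub>F w in at z. \<phi> w = - 1 / (cpoly q w + of_real (a\<^sup>2) * \<tau> w)"
    using assms(1,2) unfolding step_rel_def
    by (elim conjE) (rule eventually_cosparse_upper_half_imp, erule eventually_mono, blast)
  ultimately show "\<phi> analytic_on {z}" "\<phi> z = - 1 / (cpoly q z + of_real (a\<^sup>2) * \<tau> z)"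
    using mero_sym_cong_at[of \<phi> z] assms by (auto simp: step_rel_def)
qed

lemma step_rel_backward_at:
  assumes "step_rel q a \<phi> \<tau>" "a \<noteq> 0" "Im z > 0" "\<phi> z \<noteq> 0"
  shows "\<tau> analytic_on {z}" "\<tau> z = (- 1 / \<phi> z - cpoly q z) / of_real (a\<^sup>2)"
proof -
  have \<phi>: "\<phi> analytic_on {z}" using assms by (intro mero_sym_analytic_at) (auto simp: step_rel_def)
  then have "(\<lambda>w. (- 1 / \<phi> w - cpoly q w) / of_real (a\<^sup>2)) analytic_on {z}"
    using assms by (intro analytic_intros) auto
  moreover have "\<forall>\<^sub>\<approx>w\<in>\<complex>\<^sub>+. \<tau> w = (- 1 / \<phi> w - cpoly q w) / of_real (a\<^sup>2)"
    using assms(1)[unfolded step_rel_def, THEN conjunct2, THEN conjunct2]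
  proof eventually_elim
    case (elim w)
    then have "- 1 / \<phi> w = cpoly q w + of_real (a\<^sup>2) * \<tau> w" by simp
    then show ?case using assms(2) by simp
  qed
  then have "\<forall>\<^sub>F w in at z. \<tau> w = (- 1 / \<phi> w - cpoly q w) / of_real (a\<^sup>2)"
    by (rule eventually_cosparse_upper_half_imp) fact
  ultimately show "\<tau> analytic_on {z}" "\<tau> z = (- 1 / \<phi> z - cpoly q z) / of_real (a\<^sup>2)"
    using mero_sym_cong_at[of \<tau> z] assms by (auto simp: step_rel_def)
qed

text \<open>One point of holomorphy with a nonzero denominator excludes that the denominator
  vanishes identically, since on the connected half-plane a meromorphic function is either
  generically 0 or generically nonzero.\<close>

lemma step_rel_exists_forward:
  assumes "\<tau> \<in> mero_sym" "\<exists>z\<in>\<complex>\<^sub>+. \<tau> analytic_on {z} \<and> cpoly q z + of_real (a\<^sup>2) * \<tau> z \<noteq> 0"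
  shows "\<exists>\<phi>. step_rel q a \<phi> \<tau>"
proof -
  define Q where "Q z = cpoly q z + of_real (a\<^sup>2) * \<tau> z" for z
  have Q: "Q meromorphic_on \<complex>\<^sub>+"
    unfolding Q_def using mero_sym_meromorphic[OF assms(1)] by (intro meromorphic_intros)
  have nz: "\<forall>\<^sub>\<approx>z\<in>\<complex>\<^sub>+. Q z \<noteq> 0"
  proof (rule ccontr)
    assume "\<not> (\<forall>\<^sub>\<approx>z\<in>\<complex>\<^sub>+. Q z \<noteq> 0)"
    then have ev0: "\<forall>\<^sub>\<approx>z\<in>\<complex>\<^sub>+. Q z = 0"
      using meromorphic_imp_constant_or_avoid[OF Q open_upper_half connected_upper_half] by blast
    obtain z where z: "Im z > 0" "\<tau> analytic_on {z}" "Q z \<noteq> 0" using assms(2) by (auto simp: Q_def)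
    have "Q analytic_on {z}" unfolding Q_def using z by (intro analytic_intros)
    then have "Q \<midarrow>z\<rightarrow> Q z" by (intro isContD analytic_at_imp_isCont)
    moreover have "Q \<midarrow>z\<rightarrow> 0"
      using eventually_cosparse_upper_half_imp[OF ev0 z(1)] by (intro tendsto_eventually)
    ultimately show False using z(3) LIM_unique by blast
  qed
  have m: "(\<lambda>z. - 1 / Q z) meromorphic_on \<complex>\<^sub>+" using Q by (intro meromorphic_intros)
  have "step_rel q a (sym_ext (\<lambda>z. - 1 / Q z)) \<tau>"
    unfolding step_rel_def Q_def[symmetric]
    using sym_ext_mero_sym[OF m] sym_ext_cosparse[OF m] nz assms(1) by (simp add: eventually_conj_iff)
  then show ?thesis by blast
qed

lemma step_rel_exists_backward:
  assumes "\<phi> \<in> mero_sym" "\<exists>z\<in>\<complex>\<^sub>+. \<phi> z \<noteq> 0" "a \<noteq> 0"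
  shows "\<exists>\<tau>. step_rel q a \<phi> \<tau>"
proof -
  have n: "\<phi> nicely_meromorphic_on \<complex>\<^sub>+" using assms by (simp add: mero_sym_def)
  have nz: "\<forall>\<^sub>\<approx>z\<in>\<complex>\<^sub>+. \<phi> z \<noteq> 0"
    using nicely_meromorphic_imp_constant_or_avoid[OF n open_upper_half connected_upper_half, of 0] assms(2) by blast
  have m: "(\<lambda>z. (- 1 / \<phi> z - cpoly q z) / of_real (a\<^sup>2)) meromorphic_on \<complex>\<^sub>+"
    using mero_sym_meromorphic[OF assms(1)] by (intro meromorphic_intros)
  define \<tau> where "\<tau> = sym_ext (\<lambda>z. (- 1 / \<phi> z - cpoly q z) / of_real (a\<^sup>2))"
  have "\<forall>\<^sub>\<approx>z\<in>\<complex>\<^sub>+. cpoly q z + of_real (a\<^sup>2) * \<tau> z \<noteq> 0 \<and> \<phi> z = - 1 / (cpoly q z + of_real (a\<^sup>2) * \<tau> z)"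
    using sym_ext_cosparse[OF m] nz
  proof eventually_elim
    case (elim z)
    then have "cpoly q z + of_real (a\<^sup>2) * \<tau> z = - 1 / \<phi> z" using assms(3) by (simp add: \<tau>_def)
    then show ?case using elim by simp
  qed
  then have "step_rel q a \<phi> \<tau>" unfolding step_rel_def \<tau>_def using assms(1) sym_ext_mero_sym[OF m] by blast
  then show ?thesis by blast
qed

lemma kern_neg_inverse:
  assumes "Q z \<noteq> 0" "Q w \<noteq> 0" "\<phi> z = - 1 / Q z" "\<phi> w = - 1 / Q w"
  shows "kern \<phi> z w = \<phi> z * cnj (\<phi> w) * kern Q z w"
proof -
  have "\<phi> z - cnj (\<phi> w) = \<phi> z * cnj (\<phi> w) * (Q z - cnj (Q w))"
    using assms(1,2) unfolding assms(3,4) by (simp add: field_simps)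
  then show ?thesis by (simp add: kern_def)
qed

section \<open>Growth of the denominator at infinity\<close>

lemma cpoly_div_power_tendsto:
  "((\<lambda>z. cpoly q z / z ^ degree q) \<longlongrightarrow> of_real (lead_coeff q)) at_infinity"
proof -
  have "((\<lambda>z. poly (map_poly complex_of_real (reflect_poly q)) (1 / z)) \<longlongrightarrow> poly (map_poly complex_of_real (reflect_poly q)) 0) at_infinity"
    by (rule isCont_tendsto_compose[OF _ tendsto_divide_0[OF tendsto_const filterlim_ident]]) simp
  moreover have "poly (map_poly complex_of_real (reflect_poly q)) 0 = of_real (lead_coeff q)"
    by (simp add: poly_0_coeff_0 coeff_map_poly)
  moreover have "\<forall>\<^sub>F z in at_infinity. poly (map_poly complex_of_real (reflect_poly q)) (1 / z) = cpoly q z / z ^ degree q"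
    unfolding eventually_at_infinity
  proof (intro exI[of _ 1] allI impI)
    fix z :: complex assume "1 \<le> norm z"
    then have z: "z \<noteq> 0" by auto
    have "map_poly complex_of_real (reflect_poly q) = reflect_poly (map_poly complex_of_real q)"
      by (simp add: poly_eq_iff coeff_map_poly coeff_reflect_poly degree_map_poly)
    then show "poly (map_poly complex_of_real (reflect_poly q)) (1 / z) = cpoly q z / z ^ degree q"
      using z poly_reflect_poly_nz[of "1 / z" "map_poly complex_of_real q"]
      by (simp add: cpoly_def degree_map_poly power_divide)
  qed
  ultimately show ?thesis using Lim_transform_eventually by fastforce
qed

lemma step_denominator_tendsto:
  assumes "F \<le> at_infinity" "((\<lambda>z. \<tau> z / z) \<longlongrightarrow> 0) F" "degree q \<ge> 1"
  shows "((\<lambda>z. (cpoly q z + of_real (a\<^sup>2) * \<tau> z) / z ^ degree q) \<longlongrightarrow> of_real (lead_coeff q)) F"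
proof -
  have "((\<lambda>z. 1 / z) \<longlongrightarrow> (0::complex)) F"
    by (intro tendsto_mono[OF assms(1)] tendsto_divide_0[OF tendsto_const] filterlim_ident)
  then have "\<forall>\<^sub>F z in F. norm ((1 / z) ^ (degree q - 1)) \<le> 1"
    using order_tendstoD(2)[OF tendsto_norm, of "\<lambda>z. 1 / z" 0 F 1]
    by (auto elim!: eventually_mono simp: norm_power norm_divide power_le_one)
  then have "\<forall>\<^sub>F z in F. norm (\<tau> z / z * (1 / z) ^ (degree q - 1)) \<le> norm (\<tau> z / z)"
    by eventually_elim (simp only: norm_mult, rule mult_left_le, auto)
  then have "((\<lambda>z. \<tau> z / z * (1 / z) ^ (degree q - 1)) \<longlongrightarrow> 0) F"
    by (rule Lim_null_comparison[OF _ tendsto_norm_zero[OF assms(2)]])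
  moreover have "((\<lambda>z. cpoly q z / z ^ degree q) \<longlongrightarrow> of_real (lead_coeff q)) F"
    using tendsto_mono[OF assms(1) cpoly_div_power_tendsto] .
  ultimately have "((\<lambda>z. cpoly q z / z ^ degree q + of_real (a\<^sup>2) * (\<tau> z / z * (1 / z) ^ (degree q - 1)))
      \<longlongrightarrow> of_real (lead_coeff q) + of_real (a\<^sup>2) * 0) F" by (intro tendsto_intros)
  moreover have "cpoly q z / z ^ degree q + of_real (a\<^sup>2) * (\<tau> z / z * (1 / z) ^ (degree q - 1))
      = (cpoly q z + of_real (a\<^sup>2) * \<tau> z) / z ^ degree q" for z
    using assms(3) by (cases "degree q") (auto simp: add_divide_distrib power_divide field_simps)
  ultimately show ?thesis by simp
qed

lemma step_denominator_nonzero: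
  assumes "F \<le> at_infinity" "((\<lambda>z. \<tau> z / z) \<longlongrightarrow> 0) F" "degree q \<ge> 1"
  shows "\<forall>\<^sub>F z in F. cpoly q z + of_real (a\<^sup>2) * \<tau> z \<noteq> 0"
proof -
  have "of_real (lead_coeff q) \<noteq> (0::complex)" using assms(3) by auto
  from tendsto_imp_eventually_ne[OF step_denominator_tendsto[OF assms, of a] this]
  show ?thesis by eventually_elim auto
qed

definition nt_small :: "(complex \<Rightarrow> complex) \<Rightarrow> bool" where
  "nt_small \<tau> \<longleftrightarrow> (\<forall>\<delta>>0. ((\<lambda>z. \<tau> z / z) \<longlongrightarrow> 0) (nontang \<delta>))"

text \<open>Two congruences frame the polynomial perturbation: multiplication by
  \<open>\<phi>\<close> links the kernels of \<open>\<phi>\<close> and of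
  \<open>Q = - 1 / \<phi>\<close>, and the constant \<open>a\<close> links those of \<open>g\<close>
  and \<open>\<tau>\<close>. What lies between \<open>Q\<close> and \<open>g\<close> is exactly the
  polynomial part.\<close>

lemma step_negsq:
  assumes rel: "step_rel q a \<phi> \<tau>" and "a \<noteq> 0" "nt_small \<tau>" "degree q \<ge> 1"
  defines "\<nu> \<equiv> nneg (degree q) (bezout_coeff q)"
  shows "negsq_fun \<tau> k \<Longrightarrow> negsq_fun \<phi> (k + \<nu>)" "negsq_fun \<phi> k \<Longrightarrow> negsq_fun \<tau> (k - \<nu>)"
proof -
  define Q where "Q z = cpoly q z + of_real (a\<^sup>2) * \<tau> z" for z
  \<comment> \<open>Generic points at which the step formula holds pointwise and both functions are
    holomorphic. Far out the imaginary axis belongs to this set, since the denominator does not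
    vanish there; the far points of the perturbation argument need this.\<close>
  define S where "S = {z. z \<in> holo_points \<tau> \<and> z \<in> holo_points \<phi> \<and> Q z \<noteq> 0 \<and> \<phi> z = - 1 / Q z}"
  have \<phi>\<tau>: "\<phi> \<in> mero_sym" "\<tau> \<in> mero_sym" using rel by (auto simp: step_rel_def)
  have cos: "\<forall>\<^sub>\<approx>z\<in>\<complex>\<^sub>+. z \<in> S"
    unfolding S_def Q_def using rel mero_sym_analytic_cosparse[OF \<phi>\<tau>(1)] mero_sym_analytic_cosparse[OF \<phi>\<tau>(2)]
    by (simp add: step_rel_def eventually_conj_iff)
  have S: "S \<subseteq> holo_points \<tau>" "S \<subseteq> holo_points \<phi>" "S \<subseteq> \<complex>\<^sub>+" by (auto simp: S_def holo_points_def)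
  have \<tau>0: "((\<lambda>z. \<tau> z / z) \<longlongrightarrow> 0) (nontang 1)" using assms by (simp add: nt_small_def)
  have one: "(0::real) < 1" by simp
  have "\<forall>\<^sub>F z in nontang 1. z \<in> S"
    using eventually_nontang_upper[OF one] eventually_nontang_analytic[OF \<phi>\<tau>(2) one \<tau>0]
      step_denominator_nonzero[OF nontang_le_at_infinity \<tau>0 assms(4), of a]
  proof eventually_elim
    case (elim z)
    then show ?case using step_rel_forward_at[OF rel, of z] by (auto simp: S_def Q_def holo_points_def)
  qed
  then have ev: "\<forall>\<^sub>F y in at_top. \<i> * complex_of_real y \<in> S"
    by (rule eventually_compose_filterlim[OF _ filterlim_imag_axis_nontang]) (use pi_gt3 in simp)
  define g where "g z = of_real (a\<^sup>2) * \<tau> z" for z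
  have K: "kern Q z w = (\<Sum>r<degree q. \<Sum>s<degree q. z ^ r * bezout_coeff q r s * cnj w ^ s) + kern g z w"
    if "z \<in> S" "w \<in> S" for z w
  proof -
    have "kern Q z w = kern (cpoly q) z w + kern g z w"
      by (simp add: kern_def Q_def g_def add_divide_distrib[symmetric] algebra_simps)
    then show ?thesis using kern_cpoly[of z w q] that S(3) by auto
  qed
  have kg: "kern g z w = of_real (a\<^sup>2) * kern \<tau> z w" for z w
    by (simp add: kern_def g_def right_diff_distrib)
  have sc1: "negsq (kern \<tau>) S j \<longleftrightarrow> negsq (kern g) S j" for j
  proof
    show "negsq (kern \<tau>) S j \<Longrightarrow> negsq (kern g) S j"
      by (rule negsq_scale[where c = "\<lambda>_. of_real (1 / a)"])
         (use assms(2) in \<open>simp_all add: kg power2_eq_square\<close>)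
    show "negsq (kern g) S j \<Longrightarrow> negsq (kern \<tau>) S j"
      by (rule negsq_scale[where c = "\<lambda>_. of_real a"])
         (use assms(2) in \<open>simp_all add: kg power2_eq_square\<close>)
  qed
  have kq: "kern \<phi> z w = \<phi> z * cnj (\<phi> w) * kern Q z w" if "z \<in> S" "w \<in> S" for z w
    using that by (intro kern_neg_inverse) (auto simp: S_def)
  have sc2: "negsq (kern \<phi>) S j \<longleftrightarrow> negsq (kern Q) S j" for j
  proof
    show "negsq (kern \<phi>) S j \<Longrightarrow> negsq (kern Q) S j"
      by (rule negsq_scale[where c = \<phi>]) (use kq in auto)
    show "negsq (kern Q) S j \<Longrightarrow> negsq (kern \<phi>) S j"
    proof (rule negsq_scale[where c = "\<lambda>z. 1 / \<phi> z"])
      fix z w assume zw: "z \<in> S" "w \<in> S"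
      then have "\<phi> z \<noteq> 0" "\<phi> w \<noteq> 0" by (auto simp: S_def)
      then show "kern Q z w = 1 / \<phi> z * cnj (1 / \<phi> w) * kern \<phi> z w" by (simp add: kq[OF zw])
    qed
  qed
  have gen: "negsq_fun \<tau> j \<longleftrightarrow> negsq (kern g) S j" "negsq_fun \<phi> j \<longleftrightarrow> negsq (kern Q) S j" for j
    using negsq_fun_generic[OF \<phi>\<tau>(2) S(1) cos] negsq_fun_generic[OF \<phi>\<tau>(1) S(2) cos] sc1 sc2 by auto
  have g0: "((\<lambda>y. g (\<i> * of_real y) / of_real y) \<longlongrightarrow> 0) at_top"
  proof -
    have "((\<lambda>y. of_real (a\<^sup>2) * \<i> * (\<tau> (\<i> * of_real y) / (\<i> * of_real y))) \<longlongrightarrow> of_real (a\<^sup>2) * \<i> * 0) at_top"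
      by (intro tendsto_intros filterlim_compose[OF \<tau>0 filterlim_imag_axis_nontang]) (use pi_gt3 in simp)
    then show ?thesis by (simp add: g_def field_simps)
  qed
  show "negsq_fun \<tau> k \<Longrightarrow> negsq_fun \<phi> (k + \<nu>)"
    unfolding gen \<nu>_def by (rule negsq_polynomial_add_ge[OF S(3) _ herm_bezout_coeff K herm_kern ev g0])
  show "negsq_fun \<phi> k \<Longrightarrow> negsq_fun \<tau> (k - \<nu>)"
    unfolding gen \<nu>_def by (rule negsq_polynomial_add_le[OF _ herm_bezout_coeff K])
qed

lemma step_nev:
  assumes "step_rel q a \<phi> \<tau>" "a \<noteq> 0" "nt_small \<tau>" "degree q \<ge> 1"
  defines "\<nu> \<equiv> nneg (degree q) (bezout_coeff q)"
  shows "\<phi> \<in> nev \<kappa> \<longleftrightarrow> \<tau> \<in> nev (\<kappa> - int \<nu>)"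
proof -
  note up = step_negsq(1)[OF assms(1-4), folded \<nu>_def] and down = step_negsq(2)[OF assms(1-4), folded \<nu>_def]
  have m: "\<phi> \<in> mero_sym" "\<tau> \<in> mero_sym" using assms by (auto simp: step_rel_def)
  have *: "negsq_fun \<phi> (k + \<nu>) \<longleftrightarrow> negsq_fun \<tau> k" for k
    using up[of k] down[of "k + \<nu>"] by auto
  show ?thesis
  proof
    assume "\<phi> \<in> nev \<kappa>"
    then obtain k where k: "\<kappa> = int k" "negsq_fun \<phi> k" "\<not> negsq_fun \<phi> (Suc k)" by (auto simp: nev_iff)
    \<comment> \<open>\<open>\<tau>\<close> always has at least 0 negative squares, so
      \<open>\<phi>\<close> has at least \<open>\<nu>\<close>.\<close>
    have "k \<ge> \<nu>"
    proof (rule ccontr)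
      assume "\<not> k \<ge> \<nu>"
      then have "negsq_fun \<phi> (Suc k)" using *[of 0] negsq_mono[of _ _ "0 + \<nu>" "Suc k"] by auto
      then show False using k by simp
    qed
    then show "\<tau> \<in> nev (\<kappa> - int \<nu>)"
      unfolding nev_iff using k m *[of "k - \<nu>"] *[of "Suc (k - \<nu>)"]
      by (intro conjI exI[of _ "k - \<nu>"]) auto
  next
    assume "\<tau> \<in> nev (\<kappa> - int \<nu>)"
    then obtain k where k: "\<kappa> - int \<nu> = int k" "negsq_fun \<tau> k" "\<not> negsq_fun \<tau> (Suc k)" by (auto simp: nev_iff)
    then show "\<phi> \<in> nev \<kappa>"
      unfolding nev_iff using m *[of k] *[of "Suc k"] by (intro conjI exI[of _ "k + \<nu>"]) auto
  qed
qed

section \<open>Asymptotic expansions along one step\<close>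

definition Pf :: "real list \<Rightarrow> complex \<Rightarrow> complex" where
  "Pf t z = (\<Sum>i<length t. - complex_of_real (t ! i) / z ^ (i + 1))"

text \<open>The order \<open>m\<close> is kept apart from the length of \<open>t\<close> and may be
  negative: when the sequence is used up, an expansion of order -1 or 0 with no terms still carries
  information.\<close>

definition expands :: "int \<Rightarrow> real list \<Rightarrow> (complex \<Rightarrow> complex) \<Rightarrow> bool" where
  "expands m t \<phi> \<longleftrightarrow> (\<forall>\<delta>>0. ((\<lambda>z. z powi m * (\<phi> z - Pf t z)) \<longlongrightarrow> 0) (nontang \<delta>))"

lemma eventually_nontang_nonzero: "\<delta> > 0 \<Longrightarrow> \<forall>\<^sub>F z in nontang \<delta>. z \<noteq> 0"
  by (rule eventually_mono[OF eventually_nontang_upper]) auto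

lemma nt_smallo_iff:
  assumes "\<And>z. z \<noteq> 0 \<Longrightarrow> g z \<noteq> 0"
  shows "nt_smallo f g \<longleftrightarrow> (\<forall>\<delta>>0. ((\<lambda>z. f z / g z) \<longlongrightarrow> 0) (nontang \<delta>))"
  unfolding nt_smallo_def
proof (intro all_cong1 imp_cong refl)
  fix \<delta> :: real assume "\<delta> > 0"
  then have "\<forall>\<^sub>F z in nontang \<delta>. g z \<noteq> 0"
    by (intro eventually_mono[OF eventually_nontang_nonzero]) (use assms in auto)
  then show "f \<in> o[nontang \<delta>](g) \<longleftrightarrow> ((\<lambda>z. f z / g z) \<longlongrightarrow> 0) (nontang \<delta>)"
    using smalloI_tendsto smalloD_tendsto by blast
qed

lemma has_expansion_iff: "has_expansion \<phi> t \<longleftrightarrow> expands (int (length t)) t \<phi>"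
  unfolding has_expansion_def expands_def
  by (subst nt_smallo_iff) (simp_all add: Pf_def mult.commute)

lemma nt_smallo_id_iff: "nt_smallo \<tau> (\<lambda>z. z) \<longleftrightarrow> expands (-1) [] \<tau>"
  unfolding expands_def by (subst nt_smallo_iff) (simp_all add: Pf_def divide_inverse mult.commute)

lemma nt_smallo_one_iff: "nt_smallo \<tau> (\<lambda>z. 1) \<longleftrightarrow> expands 0 [] \<tau>"
  unfolding expands_def by (subst nt_smallo_iff) (simp_all add: Pf_def)

lemma nt_small_iff: "nt_small \<tau> \<longleftrightarrow> expands (-1) [] \<tau>"
  unfolding expands_def nt_small_def by (simp add: Pf_def divide_inverse mult.commute)

lemma powi_nonpos_tendsto_0:
  fixes f :: "complex \<Rightarrow> complex"
  assumes "F \<le> at_infinity" "k \<le> 0" "(f \<longlongrightarrow> 0) F"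
  shows "((\<lambda>z. z powi k * f z) \<longlongrightarrow> 0) F"
proof (rule Lim_null_comparison[OF _ tendsto_norm_zero[OF assms(3)]])
  have "\<forall>\<^sub>F z in at_infinity. norm (z::complex) \<ge> 1" by (auto simp: eventually_at_infinity)
  then have "\<forall>\<^sub>F z in F. norm z \<ge> 1" using assms(1) by (rule filter_leD[rotated])
  then show "\<forall>\<^sub>F z in F. norm (z powi k * f z) \<le> norm (f z)"
  proof eventually_elim
    case (elim z)
    have "norm (z powi k) = inverse (norm z) ^ nat (- k)"
      using assms(2) by (cases "k = 0") (auto simp: power_int_def norm_power norm_inverse)
    also have "\<dots> \<le> 1" using elim by (intro power_le_one) (auto simp: inverse_le_1_iff)
    finally show ?case by (simp add: norm_mult mult_left_le_one_le)
  qed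
qed

lemma tendsto_inverse_at_infinity: "F \<le> at_infinity \<Longrightarrow> ((\<lambda>z. 1 / z) \<longlongrightarrow> (0::complex)) F"
  by (rule tendsto_mono[OF _ tendsto_divide_0[OF tendsto_const filterlim_ident]])

lemma poly_inverse_tendsto:
  "F \<le> at_infinity \<Longrightarrow> ((\<lambda>z. poly R (1 / z)) \<longlongrightarrow> poly R (0::complex)) F"
  by (rule isCont_tendsto_compose[OF _ tendsto_inverse_at_infinity]) simp

lemma Pf_tendsto_0: "F \<le> at_infinity \<Longrightarrow> (Pf t \<longlongrightarrow> 0) F"
proof -
  assume F: "F \<le> at_infinity"
  have "((\<lambda>z. \<Sum>i<length t. - complex_of_real (t ! i) * (1 / z) ^ (i + 1)) \<longlongrightarrow> (\<Sum>i<length t. - complex_of_real (t ! i) * 0 ^ (i + 1))) F"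
    by (intro tendsto_intros tendsto_inverse_at_infinity F)
  then show ?thesis by (simp add: Pf_def[abs_def] power_divide)
qed

lemma expands_weaken:
  assumes "expands m t \<tau>" "m' \<le> m"
  shows "\<forall>\<delta>>0. ((\<lambda>z. z powi m' * (\<tau> z - Pf t z)) \<longlongrightarrow> 0) (nontang \<delta>)"
proof (intro allI impI)
  fix \<delta> :: real assume d: "\<delta> > 0"
  have "((\<lambda>z. z powi (m' - m) * (z powi m * (\<tau> z - Pf t z))) \<longlongrightarrow> 0) (nontang \<delta>)"
    by (rule powi_nonpos_tendsto_0[OF nontang_le_at_infinity]) (use assms d in \<open>auto simp: expands_def\<close>)
  then show "((\<lambda>z. z powi m' * (\<tau> z - Pf t z)) \<longlongrightarrow> 0) (nontang \<delta>)"
  proof (rule Lim_transform_eventually)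
    show "\<forall>\<^sub>F z in nontang \<delta>. z powi (m' - m) * (z powi m * (\<tau> z - Pf t z)) = z powi m' * (\<tau> z - Pf t z)"
      using eventually_nontang_nonzero[OF d]
      by eventually_elim (simp add: mult.assoc[symmetric] power_int_add[symmetric])
  qed
qed

lemma expands_imp_nt_small:
  assumes "expands m t \<tau>" "m \<ge> -1"
  shows "nt_small \<tau>"
  unfolding nt_small_def
proof (intro allI impI)
  fix \<delta> :: real assume d: "\<delta> > 0"
  have "((\<lambda>z. z powi -1 * (\<tau> z - Pf t z) + 1 / z * Pf t z) \<longlongrightarrow> 0 + 0 * 0) (nontang \<delta>)"
    using expands_weaken[OF assms] d
    by (intro tendsto_intros Pf_tendsto_0 tendsto_inverse_at_infinity nontang_le_at_infinity) auto
  then show "((\<lambda>z. \<tau> z / z) \<longlongrightarrow> 0) (nontang \<delta>)"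
    by (simp add: divide_inverse algebra_simps)
qed

definition seq_poly :: "(nat \<Rightarrow> complex) \<Rightarrow> nat \<Rightarrow> complex poly" where
  "seq_poly c n = (\<Sum>i<n. Polynomial.monom (c i) i)"

lemma poly_seq_poly: "poly (seq_poly c n) x = (\<Sum>i<n. c i * x ^ i)"
  by (simp add: seq_poly_def poly_sum poly_monom)

lemma coeff_seq_poly: "coeff (seq_poly c n) k = (if k < n then c k else 0)"
  by (simp add: seq_poly_def coeff_sum)

text \<open>
  The coefficients of \<open>\<epsilon> z\<^sup>-\<^sup>d (\<epsilon> p(z) - \<Sum> u\<^sub>i z\<^sup>-\<^sup>i\<^sup>-\<^sup>1)\<close> as a power series in \<open>1 / z\<close>, i.e. the first row of
  the second Toeplitz factor.
\<close>

definition E_coeff :: "nat \<Rightarrow> real poly \<Rightarrow> real \<Rightarrow> real list \<Rightarrow> nat \<Rightarrow> real" where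
  "E_coeff d p \<epsilon> u i = (if i \<le> d then coeff p (d - i) else - \<epsilon> * u ! (i - d - 1))"

section \<open>Truncated series identities behind one step\<close>

text \<open>The convolution equations are the first row of the Toeplitz identity. The bound
  \<open>2 * d \<le> length t + 1\<close> admits the last step for even \<open>\<ell>\<close>, where
  \<open>length t = 2 * d - 1\<close> and the subtraction in the length of \<open>u\<close>
  truncates to 0.\<close>

definition schur_rel :: "real list \<Rightarrow> nat \<Rightarrow> real \<Rightarrow> real poly \<Rightarrow> real list \<Rightarrow> bool" where
  "schur_rel t d \<epsilon> p u \<longleftrightarrow> d \<ge> 1 \<and> 2 * d \<le> length t + 1 \<and> length u = length t - 2 * d \<and>
     (\<forall>i<d - 1. t ! i = 0) \<and> t ! (d - 1) = \<epsilon> \<and> (\<epsilon> = 1 \<or> \<epsilon> = -1) \<and> degree p = d \<and> lead_coeff p = 1 \<and>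
     (\<forall>k\<le>length t - d. (\<Sum>i\<le>k. t ! (d - 1 + i) * E_coeff d p \<epsilon> u (k - i)) = (if k = 0 then \<epsilon> else 0))"

text \<open>Both factors are rewritten as polynomials in \<open>1 / z\<close>, namely
  \<open>cP\<close> for \<open>Pf t\<close> and \<open>eP\<close> for the polynomial plus the tail
  \<open>Pf u\<close>. The convolution equations say that \<open>cP * eP\<close> and
  \<open>\<epsilon>\<close> agree up to order \<open>length t - d\<close>, so their difference is
  divisible by the next power of the variable; \<open>\<epsilon> * \<epsilon> = 1\<close> turns this
  into the smallness of \<open>Pf t * Q + 1\<close>.\<close>

lemma schur_rel_asymptotics:
  assumes "schur_rel t d \<epsilon> p u"
  obtains cP eP R where
    "\<And>z. z \<noteq> 0 \<Longrightarrow> z ^ d * Pf t z = - poly cP (1 / z)" "poly cP 0 = of_real \<epsilon>"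
    "\<And>z. z \<noteq> 0 \<Longrightarrow> (cpoly (Polynomial.smult \<epsilon> p) z + Pf u z) / z ^ d = of_real \<epsilon> * poly eP (1 / z)" "poly eP 0 = 1"
    "\<And>z. z \<noteq> 0 \<Longrightarrow> z ^ (length t - d) * (Pf t z * (cpoly (Polynomial.smult \<epsilon> p) z + Pf u z) + 1) = 1 / z * poly R (1 / z)"
proof -
  define N where "N = length t - d"
  have d: "d \<ge> 1" "2 * d \<le> length t + 1" "length u = length t - 2 * d" "\<And>i. i < d - 1 \<Longrightarrow> t ! i = 0"
    "t ! (d - 1) = \<epsilon>" "\<epsilon> = 1 \<or> \<epsilon> = -1" "degree p = d" "lead_coeff p = 1"
    and conv: "\<And>k. k \<le> N \<Longrightarrow> (\<Sum>i\<le>k. t ! (d - 1 + i) * E_coeff d p \<epsilon> u (k - i)) = (if k = 0 then \<epsilon> else 0)"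
    using assms unfolding schur_rel_def N_def by blast+
  have len: "length t = (d - 1) + (N + 1)" using d by (simp add: N_def)
  define cP where "cP = seq_poly (\<lambda>i. of_real (t ! (d - 1 + i))) (N + 1)"
  define eP where "eP = seq_poly (\<lambda>i. of_real (E_coeff d p \<epsilon> u i)) (d + 1 + length u)"
  have eps: "complex_of_real \<epsilon> * of_real \<epsilon> = 1" using d(6) by auto
  have 1: "z ^ d * Pf t z = - poly cP (1 / z)" if "z \<noteq> 0" for z
  proof -
    have "Pf t z = (\<Sum>i<N + 1. - complex_of_real (t ! (d - 1 + i)) / z ^ (d - 1 + i + 1))"
      unfolding Pf_def len sum_lessThan_add using d(4) by simp
    also have "z ^ d * \<dots> = - (\<Sum>i<N + 1. complex_of_real (t ! (d - 1 + i)) * (z ^ d / z ^ (d + i)))"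
      unfolding sum_distrib_left sum_negf[symmetric] using d(1) by (intro sum.cong refl) (simp add: field_simps)
    also have "\<dots> = - (\<Sum>i<N + 1. complex_of_real (t ! (d - 1 + i)) * (1 / z) ^ i)"
      using that by (simp add: power_add power_divide)
    finally show ?thesis by (simp add: cP_def poly_seq_poly)
  qed
  have 2: "(cpoly (Polynomial.smult \<epsilon> p) z + Pf u z) / z ^ d = of_real \<epsilon> * poly eP (1 / z)" if "z \<noteq> 0" for z
  proof -
    have "cpoly (Polynomial.smult \<epsilon> p) z = of_real \<epsilon> * (\<Sum>i\<le>d. of_real (coeff p i) * z ^ i)"
      using d(6,7) by (auto simp: cpoly_altdef sum_distrib_left sum_negf)
    also have "(\<Sum>i\<le>d. complex_of_real (coeff p i) * z ^ i) = (\<Sum>i\<le>d. of_real (coeff p (d - i)) * z ^ (d - i))"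
      by (rule sum.nat_diff_reindex[symmetric, where n = "Suc d", unfolded lessThan_Suc_atMost, simplified, THEN trans[OF refl]])
    also have "\<dots> = z ^ d * (\<Sum>i<d + 1. of_real (E_coeff d p \<epsilon> u i) * (1 / z) ^ i)"
      unfolding sum_distrib_left Suc_eq_plus1[symmetric] lessThan_Suc_atMost
      using that by (intro sum.cong refl) (simp add: E_coeff_def power_diff power_divide)
    finally have q: "cpoly (Polynomial.smult \<epsilon> p) z = of_real \<epsilon> * (z ^ d * (\<Sum>i<d + 1. of_real (E_coeff d p \<epsilon> u i) * (1 / z) ^ i))" .
    have "of_real \<epsilon> * (z ^ d * (\<Sum>i<length u. of_real (E_coeff d p \<epsilon> u (d + 1 + i)) * (1 / z) ^ (d + 1 + i)))
      = (\<Sum>i<length u. (of_real \<epsilon> * of_real \<epsilon>) * (- complex_of_real (u ! i) / z ^ (i + 1)))"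
      unfolding sum_distrib_left
      using that by (intro sum.cong refl) (simp add: E_coeff_def power_add power_divide)
    also have "\<dots> = Pf u z" by (simp add: eps Pf_def)
    finally have "cpoly (Polynomial.smult \<epsilon> p) z + Pf u z = of_real \<epsilon> * (z ^ d * poly eP (1 / z))"
      unfolding q eP_def poly_seq_poly sum_lessThan_add[of _ "d + 1"] by (simp only: distrib_left)
    then show ?thesis using that by simp
  qed
  have "coeff (cP * eP - [:of_real \<epsilon>:]) k = 0" if "k < N + 1" for k
  proof -
    have "coeff (cP * eP) k = (\<Sum>i\<le>k. of_real (t ! (d - 1 + i) * E_coeff d p \<epsilon> u (k - i)))"
      unfolding coeff_mult cP_def eP_def coeff_seq_poly
      using that d len by (intro sum.cong refl) auto
    also have "\<dots> = of_real (if k = 0 then \<epsilon> else 0)"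
      unfolding of_real_sum[symmetric] using conv[of k] that by simp
    finally show ?thesis by (simp add: coeff_pCons split: nat.split)
  qed
  then have "Polynomial.monom 1 (N + 1) dvd cP * eP - [:of_real \<epsilon>:]"
    by (subst monom_1_dvd_iff') auto
  then obtain R0 where R0: "cP * eP - [:of_real \<epsilon>:] = Polynomial.monom 1 (N + 1) * R0" by (auto elim: dvdE)
  have 3: "z ^ N * (Pf t z * (cpoly (Polynomial.smult \<epsilon> p) z + Pf u z) + 1)
      = 1 / z * poly (Polynomial.smult (- of_real \<epsilon>) R0) (1 / z)" if z: "z \<noteq> 0" for z
  proof -
    have "poly (cP * eP - [:of_real \<epsilon>:]) (1 / z) = (1 / z) ^ (N + 1) * poly R0 (1 / z)"
      unfolding R0 by (simp add: poly_monom)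
    then have ce: "poly cP (1 / z) * poly eP (1 / z) = of_real \<epsilon> + (1 / z) ^ (N + 1) * poly R0 (1 / z)"
      by (simp add: algebra_simps)
    have "Pf t z * (cpoly (Polynomial.smult \<epsilon> p) z + Pf u z)
      = (z ^ d * Pf t z) * ((cpoly (Polynomial.smult \<epsilon> p) z + Pf u z) / z ^ d)" using z by simp
    also have "\<dots> = - of_real \<epsilon> * (poly cP (1 / z) * poly eP (1 / z))"
      unfolding 1[OF z] 2[OF z] by simp
    also have "\<dots> = - (of_real \<epsilon> * of_real \<epsilon>) - of_real \<epsilon> * ((1 / z) ^ (N + 1) * poly R0 (1 / z))"
      unfolding ce by (simp add: algebra_simps)
    finally have "Pf t z * (cpoly (Polynomial.smult \<epsilon> p) z + Pf u z) + 1
       = - of_real \<epsilon> * ((1 / z) ^ (N + 1) * poly R0 (1 / z))" by (simp add: eps)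
    then show ?thesis using z by (simp add: power_divide)
  qed
  show ?thesis
    by (rule that[of cP eP "Polynomial.smult (- of_real \<epsilon>) R0"])
       (use 1 2 3 d in \<open>simp_all add: N_def cP_def eP_def poly_0_coeff_0 coeff_seq_poly E_coeff_def\<close>)
qed

text \<open>Used with \<open>v = z ^ (length t - d)\<close>, \<open>w = z ^ d\<close>,
  \<open>P = Pf t z\<close>, \<open>f = \<phi> z\<close>, and \<open>Q\<close> the polynomial plus
  \<open>Pf u z\<close>. The right-hand side is arranged so that every piece has a limit:
  \<open>v * (P * Q + 1)\<close> and \<open>v * w * (f - P)\<close> tend to 0, \<open>Q / w\<close>
  to \<open>\<epsilon>\<close> and \<open>w * P\<close> to \<open>- \<epsilon>\<close>.\<close>

lemma step_identity_forward:
  fixes v w P Q f :: complex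
  assumes "v \<noteq> 0" "w \<noteq> 0" "f \<noteq> 0"
  shows "(v / w) * (- 1 / f - Q) = - (v * (P * Q + 1) + (v * w * (f - P)) * (Q / w)) / (w * P + (1 / v) * (v * w * (f - P)))"
proof -
  have "w * P + (1 / v) * (v * w * (f - P)) = w * f" using assms by (simp add: algebra_simps)
  moreover have "v * (P * Q + 1) + (v * w * (f - P)) * (Q / w) = v * (1 + f * Q)"
    using assms by (simp add: algebra_simps)
  ultimately show ?thesis using assms by (simp add: field_simps)
qed

text \<open>The forward identity with \<open>P\<close> and \<open>Q\<close> exchanged and
  \<open>w\<close> replaced by its inverse.\<close>

lemma step_identity_backward:
  fixes v w P Q g :: complex
  assumes "v \<noteq> 0" "w \<noteq> 0" "g \<noteq> 0"
  shows "(v * w) * (- 1 / g - P) = - (v * (P * Q + 1) + w * P * ((v / w) * (g - Q))) / (Q / w + (1 / v) * ((v / w) * (g - Q)))"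
proof -
  have "Q / w + (1 / v) * ((v / w) * (g - Q)) = g / w" using assms by (simp add: field_simps)
  moreover have "w * P * ((v / w) * (g - Q)) = v * P * (g - Q)" using assms by simp
  then have "v * (P * Q + 1) + w * P * ((v / w) * (g - Q)) = v * (1 + P * g)"
    by (simp add: algebra_simps)
  ultimately show ?thesis using assms by (simp add: field_simps)
qed

text \<open>The exponent \<open>m - 2 * d\<close> can be -1, hence the integer powers;
  \<open>m - d\<close> and \<open>d\<close> are natural and suffice to express everything.\<close>

lemma powi_split:
  fixes z :: "'a::field"
  assumes "z \<noteq> 0" "2 * d \<le> m + 1" "d \<ge> 1"
  shows "z powi int m = z ^ (m - d) * z ^ d" "z powi (- int (m - d)) = 1 / z ^ (m - d)"
    "z powi (int m - 2 * int d) = z ^ (m - d) / z ^ d"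
proof -
  have "m = (m - d) + d" using assms by simp
  then show "z powi int m = z ^ (m - d) * z ^ d" by (metis power_add power_int_of_nat)
  show "z powi (- int (m - d)) = 1 / z ^ (m - d)"
    by (simp only: power_int_minus power_int_of_nat divide_inverse mult_1)
  have "int m - 2 * int d = int (m - d) - int d" using assms by simp
  then show "z powi (int m - 2 * int d) = z ^ (m - d) / z ^ d"
    by (simp only: power_int_diff[OF disjI1[OF assms(1)]] power_int_of_nat)
qed

lemma Pf_scale: "Pf u z = of_real (a\<^sup>2) * Pf (map (\<lambda>x. x / a\<^sup>2) u) z" if "a \<noteq> 0"
  using that by (simp add: Pf_def sum_distrib_left)

lemma step_expands_forward:
  assumes sr: "schur_rel t d \<epsilon> p u" and rel: "step_rel (Polynomial.smult \<epsilon> p) a \<phi> \<tau>" and a: "a \<noteq> 0"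
    and \<phi>: "expands (int (length t)) t \<phi>"
  shows "expands (int (length t) - 2 * int d) (map (\<lambda>x. x / a\<^sup>2) u) \<tau>"
  unfolding expands_def
proof (intro allI impI)
  fix \<delta> :: real assume \<delta>: "\<delta> > 0"
  obtain cP eP R where
    cP: "\<And>z. z \<noteq> 0 \<Longrightarrow> z ^ d * Pf t z = - poly cP (1 / z)" "poly cP 0 = of_real \<epsilon>" and
    eP: "\<And>z. z \<noteq> 0 \<Longrightarrow> (cpoly (Polynomial.smult \<epsilon> p) z + Pf u z) / z ^ d = of_real \<epsilon> * poly eP (1 / z)" "poly eP 0 = 1" and
    R: "\<And>z. z \<noteq> 0 \<Longrightarrow> z ^ (length t - d) * (Pf t z * (cpoly (Polynomial.smult \<epsilon> p) z + Pf u z) + 1) = 1 / z * poly R (1 / z)"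
    using schur_rel_asymptotics[OF sr] by metis
  have d: "d \<ge> 1" "2 * d \<le> length t + 1" "\<epsilon> = 1 \<or> \<epsilon> = -1" using sr by (auto simp: schur_rel_def)
  then have eps: "complex_of_real \<epsilon> \<noteq> 0" by auto
  define Q where "Q z = cpoly (Polynomial.smult \<epsilon> p) z + Pf u z" for z
  define x where "x z = z powi int (length t) * (\<phi> z - Pf t z)" for z
  let ?N = "length t - d"
  have N: "length t = ?N + d" using d by simp
  note F = nontang_le_at_infinity[of \<delta>]
  have x0: "(x \<longlongrightarrow> 0) (nontang \<delta>)" using \<phi> \<delta> by (simp add: expands_def x_def[abs_def])
  have x0': "((\<lambda>z. z powi (- int ?N) * x z) \<longlongrightarrow> 0) (nontang \<delta>)"
    by (intro powi_nonpos_tendsto_0 F x0) simp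
  have den: "((\<lambda>z. - poly cP (1 / z) + z powi (- int ?N) * x z) \<longlongrightarrow> - poly cP 0 + 0) (nontang \<delta>)"
    by (intro tendsto_intros poly_inverse_tendsto F x0')
  have "((\<lambda>z. - (1 / z * poly R (1 / z) + x z * (of_real \<epsilon> * poly eP (1 / z))) / (- poly cP (1 / z) + z powi (- int ?N) * x z))
     \<longlongrightarrow> - (0 * poly R 0 + 0 * (of_real \<epsilon> * poly eP 0)) / (- poly cP 0 + 0)) (nontang \<delta>)"
    by (intro tendsto_intros den poly_inverse_tendsto tendsto_inverse_at_infinity F x0) (use cP(2) eps in simp)
  then have lim: "((\<lambda>z. - (1 / z * poly R (1 / z) + x z * (of_real \<epsilon> * poly eP (1 / z))) / (- poly cP (1 / z) + z powi (- int ?N) * x z) / of_real (a\<^sup>2))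
     \<longlongrightarrow> 0 / of_real (a\<^sup>2)) (nontang \<delta>)"
    using a by (intro tendsto_divide tendsto_const) auto
  have "\<forall>\<^sub>F z in nontang \<delta>. - poly cP (1 / z) + z powi (- int ?N) * x z \<noteq> 0"
    by (rule tendsto_imp_eventually_ne[OF den]) (use cP(2) eps in simp)
  then have "\<forall>\<^sub>F z in nontang \<delta>. - (1 / z * poly R (1 / z) + x z * (of_real \<epsilon> * poly eP (1 / z))) / (- poly cP (1 / z) + z powi (- int ?N) * x z) / of_real (a\<^sup>2)
      = z powi (int (length t) - 2 * int d) * (\<tau> z - Pf (map (\<lambda>x. x / a\<^sup>2) u) z)"
    using eventually_nontang_upper[OF \<delta>]
  proof eventually_elim
    case (elim z)
    then have z: "z \<noteq> 0" by auto
    note pw = powi_split[OF z, of d "length t", OF d(2,1)]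
    have x: "x z = z ^ ?N * z ^ d * (\<phi> z - Pf t z)" by (simp only: x_def pw)
    have "z ^ d * Pf t z + 1 / z ^ ?N * x z \<noteq> 0" using elim(1) by (simp add: cP(1)[OF z] pw(2))
    \<comment> \<open>The denominator of the identity is \<open>z ^ d * \<phi> z\<close>. Its limit
      is nonzero, so eventually \<open>\<phi> z\<close> is nonzero and \<open>\<tau> z\<close> can
      be computed from it.\<close>
    moreover have "z ^ d * Pf t z + 1 / z ^ ?N * x z = z ^ d * \<phi> z"
      using z by (simp add: x algebra_simps)
    ultimately have nz: "\<phi> z \<noteq> 0" by auto
    have \<tau>: "\<tau> z = (- 1 / \<phi> z - cpoly (Polynomial.smult \<epsilon> p) z) / of_real (a\<^sup>2)"
      using step_rel_backward_at(2)[OF rel a] elim nz by auto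
    have "of_real (a\<^sup>2) * (\<tau> z - Pf (map (\<lambda>x. x / a\<^sup>2) u) z) = - 1 / \<phi> z - Q z"
      using a unfolding right_diff_distrib Pf_scale[OF a, symmetric] by (simp add: \<tau> Q_def)
    then have "\<tau> z - Pf (map (\<lambda>x. x / a\<^sup>2) u) z = (- 1 / \<phi> z - Q z) / of_real (a\<^sup>2)"
      using a by (simp add: eq_divide_eq mult.commute)
    then have "z powi (int (length t) - 2 * int d) * (\<tau> z - Pf (map (\<lambda>x. x / a\<^sup>2) u) z)
      = (z ^ ?N / z ^ d) * (- 1 / \<phi> z - Q z) / of_real (a\<^sup>2)"
      by (simp only: pw times_divide_eq_right)
    also have "(z ^ ?N / z ^ d) * (- 1 / \<phi> z - Q z) = - (z ^ ?N * (Pf t z * Q z + 1) + x z * (Q z / z ^ d)) / (z ^ d * Pf t z + (1 / z ^ ?N) * x z)"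
      unfolding x by (rule step_identity_forward) (use z nz in auto)
    finally show ?case unfolding Q_def R[OF z] eP(1)[OF z] cP(1)[OF z] pw(2) by simp
  qed
  then show "((\<lambda>z. z powi (int (length t) - 2 * int d) * (\<tau> z - Pf (map (\<lambda>x. x / a\<^sup>2) u) z)) \<longlongrightarrow> 0) (nontang \<delta>)"
    using Lim_transform_eventually[OF lim] by simp
qed

lemma step_expands_backward:
  assumes sr: "schur_rel t d \<epsilon> p u" and rel: "step_rel (Polynomial.smult \<epsilon> p) a \<phi> \<tau>" and a: "a \<noteq> 0"
    and \<tau>: "expands (int (length t) - 2 * int d) (map (\<lambda>x. x / a\<^sup>2) u) \<tau>"
  shows "expands (int (length t)) t \<phi>"
  unfolding expands_def
proof (intro allI impI)
  fix \<delta> :: real assume \<delta>: "\<delta> > 0"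
  obtain cP eP R where
    cP: "\<And>z. z \<noteq> 0 \<Longrightarrow> z ^ d * Pf t z = - poly cP (1 / z)" "poly cP 0 = of_real \<epsilon>" and
    eP: "\<And>z. z \<noteq> 0 \<Longrightarrow> (cpoly (Polynomial.smult \<epsilon> p) z + Pf u z) / z ^ d = of_real \<epsilon> * poly eP (1 / z)" "poly eP 0 = 1" and
    R: "\<And>z. z \<noteq> 0 \<Longrightarrow> z ^ (length t - d) * (Pf t z * (cpoly (Polynomial.smult \<epsilon> p) z + Pf u z) + 1) = 1 / z * poly R (1 / z)"
    using schur_rel_asymptotics[OF sr] by metis
  have d: "d \<ge> 1" "2 * d \<le> length t + 1" "\<epsilon> = 1 \<or> \<epsilon> = -1" using sr by (auto simp: schur_rel_def)
  then have eps: "complex_of_real \<epsilon> \<noteq> 0" by auto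
  define Q where "Q z = cpoly (Polynomial.smult \<epsilon> p) z + Pf u z" for z
  define g where "g z = cpoly (Polynomial.smult \<epsilon> p) z + of_real (a\<^sup>2) * \<tau> z" for z
  define y where "y z = z powi (int (length t) - 2 * int d) * (g z - Q z)" for z
  let ?N = "length t - d"
  have N: "length t = ?N + d" using d by simp
  note F = nontang_le_at_infinity[of \<delta>]
  have "((\<lambda>z. of_real (a\<^sup>2) * (z powi (int (length t) - 2 * int d) * (\<tau> z - Pf (map (\<lambda>x. x / a\<^sup>2) u) z))) \<longlongrightarrow> of_real (a\<^sup>2) * 0) (nontang \<delta>)"
    using \<tau> \<delta> by (intro tendsto_intros) (simp add: expands_def)
  moreover have "of_real (a\<^sup>2) * (z powi (int (length t) - 2 * int d) * (\<tau> z - Pf (map (\<lambda>x. x / a\<^sup>2) u) z)) = y z" for z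
    unfolding y_def g_def Q_def Pf_scale[OF a, of u] by (simp add: algebra_simps)
  ultimately have y0: "(y \<longlongrightarrow> 0) (nontang \<delta>)" by simp
  have y0': "((\<lambda>z. z powi (- int ?N) * y z) \<longlongrightarrow> 0) (nontang \<delta>)"
    by (intro powi_nonpos_tendsto_0 F y0) simp
  have den: "((\<lambda>z. of_real \<epsilon> * poly eP (1 / z) + z powi (- int ?N) * y z) \<longlongrightarrow> of_real \<epsilon> * poly eP 0 + 0) (nontang \<delta>)"
    by (intro tendsto_intros poly_inverse_tendsto F y0')
  have lim: "((\<lambda>z. - (1 / z * poly R (1 / z) + - poly cP (1 / z) * y z) / (of_real \<epsilon> * poly eP (1 / z) + z powi (- int ?N) * y z))
     \<longlongrightarrow> - (0 * poly R 0 + - poly cP 0 * 0) / (of_real \<epsilon> * poly eP 0 + 0)) (nontang \<delta>)"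
    by (intro tendsto_intros den poly_inverse_tendsto tendsto_inverse_at_infinity F y0) (use eP(2) eps in simp)
  \<comment> \<open>The bound on \<open>d\<close> in \<open>schur_rel\<close> makes the order at
    least -1, which is just enough for \<open>o(z)\<close>.\<close>
  have \<tau>0: "nt_small \<tau>" by (rule expands_imp_nt_small[OF \<tau>]) (use d in linarith)
  have "degree (Polynomial.smult \<epsilon> p) \<ge> 1" using sr by (auto simp: schur_rel_def)
  then have "\<forall>\<^sub>F z in nontang \<delta>. g z \<noteq> 0"
    unfolding g_def using \<tau>0 \<delta> by (intro step_denominator_nonzero[OF F]) (auto simp: nt_small_def)
  moreover have "\<forall>\<^sub>F z in nontang \<delta>. \<tau> analytic_on {z}"
    using rel \<tau>0 \<delta> by (intro eventually_nontang_analytic) (auto simp: step_rel_def nt_small_def)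
  ultimately have "\<forall>\<^sub>F z in nontang \<delta>. - (1 / z * poly R (1 / z) + - poly cP (1 / z) * y z) / (of_real \<epsilon> * poly eP (1 / z) + z powi (- int ?N) * y z)
      = z powi int (length t) * (\<phi> z - Pf t z)"
    using eventually_nontang_upper[OF \<delta>]
  proof eventually_elim
    case (elim z)
    then have z: "z \<noteq> 0" by auto
    note pw = powi_split[OF z, of d "length t", OF d(2,1)]
    have \<phi>: "\<phi> z = - 1 / g z"
      using step_rel_forward_at(2)[OF rel elim(3,2)] elim(1) by (simp add: g_def)
    have "z powi int (length t) * (\<phi> z - Pf t z) = (z ^ ?N * z ^ d) * (- 1 / g z - Pf t z)"
      by (simp only: pw \<phi>)
    also have "\<dots> = - (z ^ ?N * (Pf t z * Q z + 1) + z ^ d * Pf t z * ((z ^ ?N / z ^ d) * (g z - Q z)))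
       / (Q z / z ^ d + (1 / z ^ ?N) * ((z ^ ?N / z ^ d) * (g z - Q z)))"
      by (rule step_identity_backward) (use z elim in auto)
    also have "(z ^ ?N / z ^ d) * (g z - Q z) = y z" by (simp only: y_def pw)
    finally show ?case unfolding Q_def R[OF z] eP(1)[OF z] cP(1)[OF z] pw(2) by simp
  qed
  then show "((\<lambda>z. z powi int (length t) * (\<phi> z - Pf t z)) \<longlongrightarrow> 0) (nontang \<delta>)"
    using Lim_transform_eventually[OF lim] by simp
qed

section \<open>Integrability along one step\<close>

lemma set_integrable_inverse_square:
  assumes "a > 0"
  shows "set_integrable lborel {a..} (\<lambda>y::real. 1 / y ^ 2)"
proof -
  have "(\<lambda>y::real. 1 / y ^ 2) integrable_on {a..}"
    using has_integral_inverse_power_to_inf[of 2 a] assms by (auto simp: integrable_on_def)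
  then have "(\<lambda>y::real. 1 / y ^ 2) absolutely_integrable_on {a..}"
    by (intro nonnegative_absolutely_integrable_1) auto
  moreover have "(\<lambda>y::real. indicator {a..} y *\<^sub>R (1 / y ^ 2)) \<in> borel_measurable lborel"
    by measurable
  ultimately show ?thesis unfolding set_integrable_def using integrable_completion by blast
qed

definition tail_integrable :: "(real \<Rightarrow> real) \<Rightarrow> bool" where
  "tail_integrable f \<longleftrightarrow> (\<forall>\<^sub>F \<eta> in at_top. set_integrable lborel {\<eta>..} (\<lambda>y. \<bar>f y\<bar> / y))"

text \<open>An error \<open>C / y\<close> becomes \<open>C / y ^ 2\<close> under the weight
  \<open>1 / y\<close> and is integrable at infinity. Continuity of \<open>g\<close> far out
  supplies measurability.\<close>

lemma tail_integrable_compare: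
  assumes f: "tail_integrable f" and cont: "\<forall>\<^sub>F y in at_top. isCont g y"
    and bound: "\<forall>\<^sub>F y in at_top. \<bar>g y\<bar> \<le> c * \<bar>f y\<bar> + C / y"
  shows "tail_integrable g"
proof -
  obtain \<eta>0 where \<eta>0: "\<And>\<eta>. \<eta> \<ge> \<eta>0 \<Longrightarrow> set_integrable lborel {\<eta>..} (\<lambda>y. \<bar>f y\<bar> / y) \<and> isCont g \<eta> \<and> \<bar>g \<eta>\<bar> \<le> c * \<bar>f \<eta>\<bar> + C / \<eta>"
    using eventually_conj[OF f[unfolded tail_integrable_def] eventually_conj[OF cont bound]]
    unfolding eventually_at_top_linorder by auto
  have "set_integrable lborel {\<eta>..} (\<lambda>y. \<bar>g y\<bar> / y)" if \<eta>: "\<eta> \<ge> max \<eta>0 1" for \<eta>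
  proof (rule set_integrable_bound)
    show "set_integrable lborel {\<eta>..} (\<lambda>y. c * (\<bar>f y\<bar> / y) + C * (1 / y ^ 2))"
      using \<eta> \<eta>0[of \<eta>] set_integrable_inverse_square[of \<eta>]
      by (intro set_integral_add(1) set_integrable_mult_right) auto
    have "continuous_on {\<eta>..} (\<lambda>y. \<bar>g y\<bar> / y)"
      using \<eta> \<eta>0 by (intro continuous_intros continuous_at_imp_continuous_on) auto
    then show "set_borel_measurable lborel {\<eta>..} (\<lambda>y. \<bar>g y\<bar> / y)"
      unfolding set_borel_measurable_def
      using borel_measurable_continuous_on_indicator[of "{\<eta>..}" "\<lambda>y. \<bar>g y\<bar> / y"] by simp
    show "AE y\<in>{\<eta>..} in lborel. norm (\<bar>g y\<bar> / y) \<le> norm (c * (\<bar>f y\<bar> / y) + C * (1 / y ^ 2))"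
    proof (intro AE_I2 impI)
      fix y assume "y \<in> {\<eta>..}"
      then have y: "y \<ge> \<eta>0" "y > 0" using \<eta> by auto
      have "\<bar>g y\<bar> / y \<le> (c * \<bar>f y\<bar> + C / y) / y"
        using \<eta>0[OF y(1)] y(2) by (intro divide_right_mono) auto
      also have "\<dots> = c * (\<bar>f y\<bar> / y) + C * (1 / y ^ 2)"
        by (simp add: add_divide_distrib power2_eq_square)
      finally show "norm (\<bar>g y\<bar> / y) \<le> norm (c * (\<bar>f y\<bar> / y) + C * (1 / y ^ 2))"
        using y(2) by simp
    qed
  qed
  then show ?thesis unfolding tail_integrable_def eventually_at_top_linorder by blast
qed

lemma tail_integrable_cong:
  assumes "\<forall>\<^sub>F y in at_top. f y = g y" "tail_integrable f"
  shows "tail_integrable g"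
proof -
  obtain \<eta>0 where \<eta>0: "\<And>\<eta>. \<eta> \<ge> \<eta>0 \<Longrightarrow> set_integrable lborel {\<eta>..} (\<lambda>y. \<bar>f y\<bar> / y) \<and> f \<eta> = g \<eta>"
    using eventually_conj[OF assms(2)[unfolded tail_integrable_def] assms(1)]
    unfolding eventually_at_top_linorder by auto
  have "set_integrable lborel {\<eta>..} (\<lambda>y. \<bar>g y\<bar> / y)" if "\<eta> \<ge> \<eta>0" for \<eta>
  proof -
    have "set_integrable lborel {\<eta>..} (\<lambda>y. \<bar>f y\<bar> / y) \<longleftrightarrow> set_integrable lborel {\<eta>..} (\<lambda>y. \<bar>g y\<bar> / y)"
      using \<eta>0 that by (intro set_integrable_cong) auto
    then show ?thesis using \<eta>0[OF that] by simp
  qed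
  then show ?thesis unfolding tail_integrable_def eventually_at_top_linorder by blast
qed

section \<open>Remainders of expansions on the imaginary axis\<close>

text \<open>For \<open>length t = 2 * k\<close> this is the expression defining
  \<open>shifted \<phi> k 0 ((!) t)\<close>, that is, the shifted function whose constant is 0 and
  whose coefficients are those of the expansion.\<close>

definition remainder :: "real list \<Rightarrow> (complex \<Rightarrow> complex) \<Rightarrow> complex \<Rightarrow> complex" where
  "remainder t \<phi> z = z ^ length t * (\<phi> z - Pf t z)"

definition remainder_integrable :: "real list \<Rightarrow> (complex \<Rightarrow> complex) \<Rightarrow> bool" where
  "remainder_integrable t \<phi> \<longleftrightarrow> tail_integrable (\<lambda>y. Im (remainder t \<phi> (\<i> * of_real y)))"

lemma expands_iff_remainder:
  "expands (int (length t)) t \<phi> \<longleftrightarrow> (\<forall>\<delta>>0. (remainder t \<phi> \<longlongrightarrow> 0) (nontang \<delta>))"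
  by (simp add: expands_def remainder_def[abs_def])

lemma one_less_pi_half: "(1::real) < pi / 2"
  using pi_gt3 by simp

lemma eventually_imag_axis: "(\<forall>\<^sub>F z in nontang 1. P z) \<Longrightarrow> \<forall>\<^sub>F y in at_top. P (\<i> * complex_of_real y)"
  by (rule eventually_compose_filterlim[OF _ filterlim_imag_axis_nontang[OF one_less_pi_half]])

lemma nontang_one_nonbot: "nontang 1 \<noteq> bot"
proof
  assume "nontang 1 = bot"
  then have "\<forall>\<^sub>F y in at_top. False" using eventually_imag_axis[of "\<lambda>_. False"] by simp
  then have "at_top = (bot :: real filter)" using eventually_False by blast
  then show False by simp
qed

lemma analytic_Pf: "z \<noteq> 0 \<Longrightarrow> Pf t analytic_on {z}"
  unfolding Pf_def[abs_def] by (intro analytic_intros) auto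

lemma isCont_Im_remainder:
  assumes "\<phi> \<in> mero_sym" "nt_small \<phi>"
  shows "\<forall>\<^sub>F y in at_top. isCont (\<lambda>y. Im (remainder t \<phi> (\<i> * of_real y))) y"
proof -
  have "\<forall>\<^sub>F z in nontang 1. \<phi> analytic_on {z}"
    using assms by (intro eventually_nontang_analytic) (auto simp: nt_small_def)
  then have "\<forall>\<^sub>F z in nontang 1. isCont (remainder t \<phi>) z"
    using eventually_nontang_nonzero[of 1, OF less_numeral_extra(1)]
  proof eventually_elim
    case (elim z)
    then have "remainder t \<phi> analytic_on {z}"
      unfolding remainder_def[abs_def] by (intro analytic_intros analytic_Pf)
    then show ?case by (rule analytic_at_imp_isCont)
  qed
  then have "\<forall>\<^sub>F y in at_top. isCont (remainder t \<phi>) (\<i> * complex_of_real y)" by (rule eventually_imag_axis)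
  then show ?thesis
  proof eventually_elim
    case (elim y)
    have "isCont (\<lambda>y. \<i> * complex_of_real y) y" by (intro continuous_intros)
    from isCont_o2[OF this elim] show ?case by (rule continuous_Im)
  qed
qed

text \<open>Subtracting the two remainders in the forward identity, the term linear in the remainder
  \<open>x\<close> gets the coefficient \<open>\<epsilon> * eP - cP\<close>, whose constant term
  vanishes and which thus is \<open>O(1 / z)\<close>. The quadratic term carries
  \<open>1 / z ^ (length t - d)\<close>, and the term free of \<open>x\<close> is
  \<open>O(1 / z)\<close> by the series identity.\<close>

lemma step_remainder_bounded:
  assumes sr: "schur_rel t d \<epsilon> p u" and rel: "step_rel (Polynomial.smult \<epsilon> p) a \<phi> \<tau>" and a: "a \<noteq> 0"
    and \<phi>: "expands (int (length t)) t \<phi>" and len: "2 * d \<le> length t"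
  obtains C where "\<forall>\<^sub>F z in nontang 1.
    cmod (of_real (a\<^sup>2) * remainder (map (\<lambda>x. x / a\<^sup>2) u) \<tau> z - remainder t \<phi> z) \<le> C / cmod z"
proof -
  obtain cP eP R where
    cP: "\<And>z. z \<noteq> 0 \<Longrightarrow> z ^ d * Pf t z = - poly cP (1 / z)" "poly cP 0 = of_real \<epsilon>" and
    eP: "\<And>z. z \<noteq> 0 \<Longrightarrow> (cpoly (Polynomial.smult \<epsilon> p) z + Pf u z) / z ^ d = of_real \<epsilon> * poly eP (1 / z)" "poly eP 0 = 1" and
    R: "\<And>z. z \<noteq> 0 \<Longrightarrow> z ^ (length t - d) * (Pf t z * (cpoly (Polynomial.smult \<epsilon> p) z + Pf u z) + 1) = 1 / z * poly R (1 / z)"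
    using schur_rel_asymptotics[OF sr] by metis
  have d: "d \<ge> 1" "2 * d \<le> length t + 1" "\<epsilon> = 1 \<or> \<epsilon> = -1" "length u = length t - 2 * d"
    using sr by (auto simp: schur_rel_def)
  then have eps: "complex_of_real \<epsilon> \<noteq> 0" by auto
  define Q where "Q z = cpoly (Polynomial.smult \<epsilon> p) z + Pf u z" for z
  define x where "x = remainder t \<phi>"
  define y where "y z = of_real (a\<^sup>2) * remainder (map (\<lambda>x. x / a\<^sup>2) u) \<tau> z" for z
  let ?N = "length t - d"
  note F = nontang_le_at_infinity[of 1]
  have x0: "(x \<longlongrightarrow> 0) (nontang 1)" using \<phi> by (simp add: expands_iff_remainder x_def)
  \<comment> \<open>\<open>poly eP 0 = 1\<close> and \<open>poly cP 0 = \<epsilon>\<close>: to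
    leading order \<open>- 1 / \<phi>\<close> reproduces the remainder of \<open>\<phi>\<close> with
    factor exactly 1.\<close>
  have "poly (Polynomial.smult (of_real \<epsilon>) eP - cP) 0 = 0" using cP(2) eP(2) by simp
  then have "[:0, 1:] dvd Polynomial.smult (of_real \<epsilon>) eP - cP"
    using poly_eq_0_iff_dvd[of "Polynomial.smult (of_real \<epsilon>) eP - cP" 0] by simp
  then obtain S where S: "Polynomial.smult (of_real \<epsilon>) eP - cP = [:0, 1:] * S" by (rule dvdE)
  \<comment> \<open>Here \<open>2 * d \<le> length t\<close> and \<open>d \<ge> 1\<close> give
    \<open>?N \<ge> 1\<close>, so the exponent is not positive.\<close>
  have x1: "((\<lambda>z. z powi (1 - int ?N) * x z) \<longlongrightarrow> 0) (nontang 1)"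
    by (intro powi_nonpos_tendsto_0 F x0) (use d len in linarith)
  have x2: "((\<lambda>z. z powi (- int ?N) * x z) \<longlongrightarrow> 0) (nontang 1)"
    by (intro powi_nonpos_tendsto_0 F x0) simp
  have den: "((\<lambda>z. - poly cP (1 / z) + z powi (- int ?N) * x z) \<longlongrightarrow> - poly cP 0 + 0) (nontang 1)"
    by (intro tendsto_intros poly_inverse_tendsto F x2)
  have lim: "((\<lambda>z. - (poly R (1 / z) + x z * poly S (1 / z) + z powi (1 - int ?N) * x z * x z) / (- poly cP (1 / z) + z powi (- int ?N) * x z))
     \<longlongrightarrow> - (poly R 0 + 0 * poly S 0 + 0 * 0) / (- poly cP 0 + 0)) (nontang 1)"
    by (intro tendsto_intros den poly_inverse_tendsto F x0 x1) (use cP(2) eps in simp)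
  have "\<forall>\<^sub>F z in nontang 1. - poly cP (1 / z) + z powi (- int ?N) * x z \<noteq> 0"
    by (rule tendsto_imp_eventually_ne[OF den]) (use cP(2) eps in simp)
  then have ev: "\<forall>\<^sub>F z in nontang 1. - (poly R (1 / z) + x z * poly S (1 / z) + z powi (1 - int ?N) * x z * x z) / (- poly cP (1 / z) + z powi (- int ?N) * x z)
      = z * (y z - x z)"
    using eventually_nontang_upper[of 1, OF less_numeral_extra(1)]
  proof eventually_elim
    case (elim z)
    then have z: "z \<noteq> 0" by auto
    note pw = powi_split[OF z, of d "length t", OF d(2,1)]
    have pw1: "z ^ length t = z ^ ?N * z ^ d" using len by (simp flip: power_add)
    have pw3: "z ^ length u = z ^ ?N / z ^ d"
    proof -
      have "z ^ ?N = z ^ length u * z ^ d" unfolding d(4) power_add[symmetric] using len by (intro arg_cong[where f = "\<lambda>k. z ^ k"]) simp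
      then show ?thesis using z by simp
    qed
    have pw4: "z powi (1 - int ?N) = z / z ^ ?N"
      using z by (simp only: power_int_diff[OF disjI1[OF z]] power_int_of_nat power_int_1_right)
    have x: "x z = z ^ ?N * z ^ d * (\<phi> z - Pf t z)" by (simp only: x_def remainder_def pw1)
    have n0: "z ^ d * Pf t z + 1 / z ^ ?N * x z \<noteq> 0" using elim(1) by (simp add: cP(1)[OF z] pw(2))
    moreover have "z ^ d * Pf t z + 1 / z ^ ?N * x z = z ^ d * \<phi> z"
      using z by (simp add: x algebra_simps)
    ultimately have nz: "\<phi> z \<noteq> 0" by auto
    have \<tau>: "\<tau> z = (- 1 / \<phi> z - cpoly (Polynomial.smult \<epsilon> p) z) / of_real (a\<^sup>2)"
      using step_rel_backward_at(2)[OF rel a] elim nz by auto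
    have "of_real (a\<^sup>2) * (\<tau> z - Pf (map (\<lambda>x. x / a\<^sup>2) u) z) = - 1 / \<phi> z - Q z"
      using a unfolding right_diff_distrib Pf_scale[OF a, symmetric] by (simp add: \<tau> Q_def)
    then have "y z = (z ^ ?N / z ^ d) * (- 1 / \<phi> z - Q z)"
      unfolding y_def remainder_def length_map pw3[symmetric] by (simp add: mult.left_commute)
    also have "\<dots> = - (z ^ ?N * (Pf t z * Q z + 1) + x z * (Q z / z ^ d)) / (z ^ d * Pf t z + (1 / z ^ ?N) * x z)"
      unfolding x by (rule step_identity_forward) (use z nz in auto)
    finally have y: "y z = - (z ^ ?N * (Pf t z * Q z + 1) + x z * (Q z / z ^ d)) / (z ^ d * Pf t z + (1 / z ^ ?N) * x z)" .
    have "y z - x z = - (z ^ ?N * (Pf t z * Q z + 1) + x z * (Q z / z ^ d) + x z * (z ^ d * Pf t z) + (1 / z ^ ?N) * x z * x z)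
       / (z ^ d * Pf t z + (1 / z ^ ?N) * x z)"
      unfolding y using n0 by (simp add: divide_simps) (simp add: algebra_simps)
    also have "x z * (Q z / z ^ d) + x z * (z ^ d * Pf t z) = x z * poly (Polynomial.smult (of_real \<epsilon>) eP - cP) (1 / z)"
      unfolding Q_def cP(1)[OF z] eP(1)[OF z] by (simp add: algebra_simps)
    then have "z ^ ?N * (Pf t z * Q z + 1) + x z * (Q z / z ^ d) + x z * (z ^ d * Pf t z) + (1 / z ^ ?N) * x z * x z
      = 1 / z * poly R (1 / z) + x z * (1 / z * poly S (1 / z)) + (1 / z ^ ?N) * x z * x z"
      unfolding S using R[OF z] by (simp add: Q_def add.assoc)
    finally have "z * (y z - x z) = - (z * (1 / z * poly R (1 / z) + x z * (1 / z * poly S (1 / z)) + (1 / z ^ ?N) * x z * x z))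
       / (z ^ d * Pf t z + (1 / z ^ ?N) * x z)"
      by (simp only: times_divide_eq_right mult_minus_right)
    also have "z * (1 / z * poly R (1 / z) + x z * (1 / z * poly S (1 / z)) + (1 / z ^ ?N) * x z * x z)
      = poly R (1 / z) + x z * poly S (1 / z) + z powi (1 - int ?N) * x z * x z"
      using z by (simp add: pw4 distrib_left)
    finally show ?case by (simp add: cP(1)[OF z] pw(2))
  qed
  define L where "L = - (poly R 0 + 0 * poly S 0 + 0 * 0) / (- poly cP 0 + 0)"
  have "((\<lambda>z. z * (y z - x z)) \<longlongrightarrow> L) (nontang 1)"
    using Lim_transform_eventually[OF lim ev] by (simp add: L_def)
  then have "\<forall>\<^sub>F z in nontang 1. cmod (z * (y z - x z)) < cmod L + 1"
    by (intro order_tendstoD(2)[OF tendsto_norm]) auto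
  then have "\<forall>\<^sub>F z in nontang 1. cmod (y z - x z) \<le> (cmod L + 1) / cmod z"
    using eventually_nontang_nonzero[of 1, OF less_numeral_extra(1)]
    by eventually_elim (simp add: norm_mult pos_le_divide_eq mult.commute)
  then show ?thesis using that unfolding y_def x_def by blast
qed

text \<open>On the imaginary axis the remainder of \<open>\<phi>\<close> and
  \<open>a\<^sup>2\<close> times that of \<open>\<tau>\<close> differ by \<open>O(1 / y)\<close>, so
  their imaginary parts are integrable together.\<close>

lemma step_remainder_integrable:
  assumes sr: "schur_rel t d \<epsilon> p u" and rel: "step_rel (Polynomial.smult \<epsilon> p) a \<phi> \<tau>" and a: "a \<noteq> 0"
    and \<phi>: "expands (int (length t)) t \<phi>" and len: "2 * d \<le> length t"
  shows "remainder_integrable t \<phi> \<longleftrightarrow> remainder_integrable (map (\<lambda>x. x / a\<^sup>2) u) \<tau>"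
proof -
  let ?t = "map (\<lambda>x. x / a\<^sup>2) u"
  obtain C where C: "\<forall>\<^sub>F z in nontang 1.
    cmod (of_real (a\<^sup>2) * remainder ?t \<tau> z - remainder t \<phi> z) \<le> C / cmod z"
    using step_remainder_bounded[OF assms] .
  define X where "X y = Im (remainder t \<phi> (\<i> * of_real y))" for y
  define Y where "Y y = Im (remainder ?t \<tau> (\<i> * of_real y))" for y
  have XY: "\<forall>\<^sub>F y in at_top. \<bar>a\<^sup>2 * Y y - X y\<bar> \<le> C / y"
    using eventually_imag_axis[OF C] eventually_gt_at_top[of 0]
  proof eventually_elim
    case (elim y)
    have "\<bar>a\<^sup>2 * Y y - X y\<bar> \<le> cmod (of_real (a\<^sup>2) * remainder ?t \<tau> (\<i> * of_real y) - remainder t \<phi> (\<i> * of_real y))"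
      using abs_Im_le_cmod[of "of_real (a\<^sup>2) * remainder ?t \<tau> (\<i> * of_real y) - remainder t \<phi> (\<i> * of_real y)"]
      by (simp add: X_def Y_def del: of_real_power)
    then show ?case using elim by (simp add: norm_mult)
  qed
  have small: "nt_small \<phi>" "nt_small \<tau>"
    using expands_imp_nt_small[OF \<phi>] expands_imp_nt_small[OF step_expands_forward[OF sr rel a \<phi>]] len by auto
  have m: "\<phi> \<in> mero_sym" "\<tau> \<in> mero_sym" using rel by (auto simp: step_rel_def)
  show ?thesis
    unfolding remainder_integrable_def X_def[symmetric] Y_def[symmetric]
  proof
    assume "tail_integrable X"
    moreover have "\<forall>\<^sub>F y in at_top. \<bar>Y y\<bar> \<le> (1 / a\<^sup>2) * \<bar>X y\<bar> + (C / a\<^sup>2) / y"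
      using XY
    proof eventually_elim
      case (elim y)
      have "a\<^sup>2 * \<bar>Y y\<bar> = \<bar>a\<^sup>2 * Y y\<bar>" by (simp add: abs_mult)
      also have "\<dots> \<le> \<bar>X y\<bar> + C / y" using elim by linarith
      finally show ?case using a by (simp add: field_simps)
    qed
    ultimately show "tail_integrable Y"
      using isCont_Im_remainder[OF m(2) small(2), of ?t] tail_integrable_compare unfolding Y_def by blast
  next
    assume "tail_integrable Y"
    moreover have "\<forall>\<^sub>F y in at_top. \<bar>X y\<bar> \<le> a\<^sup>2 * \<bar>Y y\<bar> + C / y"
      using XY
    proof eventually_elim
      case (elim y)
      have "a\<^sup>2 * \<bar>Y y\<bar> = \<bar>a\<^sup>2 * Y y\<bar>" by (simp add: abs_mult)
      then show ?case using elim by linarith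
    qed
    ultimately show "tail_integrable X"
      using isCont_Im_remainder[OF m(1) small(1), of t] tail_integrable_compare unfolding X_def by blast
  qed
qed

section \<open>The classes of solutions of the moment problem\<close>

text \<open>This runs from \<open>\<phi>\<close> itself at \<open>j = 0\<close> to the full
  remainder at \<open>2 * j = length s\<close>, so that the power of \<open>z\<close> can be raised
  by 2 at a time.\<close>

definition shifted_rem :: "real list \<Rightarrow> (complex \<Rightarrow> complex) \<Rightarrow> nat \<Rightarrow> complex \<Rightarrow> complex" where
  "shifted_rem s \<phi> j z = z ^ (2 * j) * (\<phi> z - (\<Sum>i<2 * j. - complex_of_real (s ! i) / z ^ (i + 1)))"

lemma shifted_rem_remainder: "length s = 2 * k \<Longrightarrow> shifted_rem s \<phi> k = remainder s \<phi>"
  by (rule ext) (simp add: shifted_rem_def remainder_def Pf_def)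

lemma shifted_rem_lim:
  assumes \<phi>: "expands (int (length s)) s \<phi>" and j: "2 * j < length s" and \<delta>: "\<delta> > 0"
  shows "((\<lambda>z. z * shifted_rem s \<phi> j z) \<longlongrightarrow> - of_real (s ! (2 * j))) (nontang \<delta>)"
proof -
  obtain r where r: "length s = 2 * j + Suc r" using j less_iff_Suc_add by auto
  note F = nontang_le_at_infinity[of \<delta>]
  have "((\<lambda>z. z powi int (2 * j + 1) * (\<phi> z - Pf s z)) \<longlongrightarrow> 0) (nontang \<delta>)"
    using expands_weaken[OF \<phi>, of "int (2 * j + 1)"] j \<delta> by auto
  then have 1: "((\<lambda>z. z ^ (2 * j + 1) * (\<phi> z - Pf s z)) \<longlongrightarrow> 0) (nontang \<delta>)"
    by (simp only: power_int_of_nat)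
  have "((\<lambda>z. z ^ (2 * j + 1) * (\<phi> z - Pf s z) + (\<Sum>i<Suc r. - complex_of_real (s ! (2 * j + i)) * (1 / z) ^ i))
    \<longlongrightarrow> 0 + (\<Sum>i<Suc r. - complex_of_real (s ! (2 * j + i)) * 0 ^ i)) (nontang \<delta>)"
    by (intro tendsto_intros 1 tendsto_inverse_at_infinity F)
  also have "0 + (\<Sum>i<Suc r. - complex_of_real (s ! (2 * j + i)) * 0 ^ i) = - of_real (s ! (2 * j))"
    unfolding sum.lessThan_Suc_shift by simp
  finally show ?thesis
  proof (rule Lim_transform_eventually)
    show "\<forall>\<^sub>F z in nontang \<delta>. z ^ (2 * j + 1) * (\<phi> z - Pf s z) + (\<Sum>i<Suc r. - complex_of_real (s ! (2 * j + i)) * (1 / z) ^ i)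
       = z * shifted_rem s \<phi> j z"
      using eventually_nontang_nonzero[OF \<delta>]
    proof eventually_elim
      case (elim z)
      define A where "A = (\<Sum>i<2 * j. - complex_of_real (s ! i) / z ^ (i + 1))"
      define B where "B = (\<Sum>i<Suc r. - complex_of_real (s ! (2 * j + i)) / z ^ (2 * j + i + 1))"
      have PAB: "Pf s z = A + B"
        unfolding Pf_def r sum_lessThan_add A_def B_def ..
      have zB: "(\<Sum>i<Suc r. - complex_of_real (s ! (2 * j + i)) * (1 / z) ^ i) = z ^ (2 * j + 1) * B"
        unfolding B_def
      proof (rule sym)
        show "z ^ (2 * j + 1) * (\<Sum>i<Suc r. - complex_of_real (s ! (2 * j + i)) / z ^ (2 * j + i + 1))
         = (\<Sum>i<Suc r. - complex_of_real (s ! (2 * j + i)) * (1 / z) ^ i)"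
        unfolding sum_distrib_left
      proof (intro sum.cong refl)
        fix i
        have "z ^ (2 * j + i + 1) = z ^ (2 * j + 1) * z ^ i" by (simp flip: power_add)
        then show "z ^ (2 * j + 1) * (- complex_of_real (s ! (2 * j + i)) / z ^ (2 * j + i + 1)) = - complex_of_real (s ! (2 * j + i)) * (1 / z) ^ i"
          using elim by (simp add: power_divide)
      qed
      qed
      show ?case unfolding zB PAB shifted_rem_def A_def[symmetric] by (simp add: algebra_simps)
    qed
  qed
qed

text \<open>
  Multiplying by \<open>z\<^sup>2\<close> adds the limit of \<open>- i y kern(\<cdot>, i y)\<close> to every kernel function, so it does not
  create negative squares.
\<close>

lemma negsq_shifted_rem:
  assumes "\<phi> \<in> mero_sym" and \<phi>: "expands (int (length s)) s \<phi>" and "2 * j \<le> length s"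
    and "negsq (kern (shifted_rem s \<phi> j)) (holo_points \<phi>) m"
  shows "negsq_fun \<phi> m"
  using assms(3,4)
proof (induction j)
  case 0
  have "shifted_rem s \<phi> 0 = \<phi>" by (rule ext) (simp add: shifted_rem_def)
  then show ?case using 0 by simp
next
  case (Suc j)
  let ?h = "shifted_rem s \<phi> j"
  have j: "2 * j < length s" using Suc.prems by simp
  have "nt_small \<phi>" using expands_imp_nt_small[OF \<phi>] by simp
  then have "\<forall>\<^sub>F z in nontang 1. \<phi> analytic_on {z}"
    using assms(1) by (intro eventually_nontang_analytic) (auto simp: nt_small_def)
  then have "\<forall>\<^sub>F z in nontang 1. z \<in> holo_points \<phi>"
    using eventually_nontang_upper[of 1, OF less_numeral_extra(1)]
    by eventually_elim (simp add: holo_points_def)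
  then have ev: "\<forall>\<^sub>F y in at_top. \<i> * complex_of_real y \<in> holo_points \<phi>" by (rule eventually_imag_axis)
  \<comment> \<open>The two coefficients consumed in this round become a linear polynomial in
    \<open>z\<close>. Its kernel is the constant \<open>s ! (2 * j)\<close>, the constant that the
    extra vector needs.\<close>
  have rec: "shifted_rem s \<phi> (Suc j) z = z ^ 2 * ?h z + of_real (s ! (2 * j)) * z + of_real (s ! (2 * j + 1))"
    if "z \<noteq> 0" for z
  proof -
    have "z ^ (2 * Suc j) = z ^ 2 * z ^ (2 * j)" by (simp flip: power_add)
    moreover have "(\<Sum>i<2 * Suc j. - complex_of_real (s ! i) / z ^ (i + 1)) = (\<Sum>i<2 * j. - complex_of_real (s ! i) / z ^ (i + 1))
       - complex_of_real (s ! (2 * j)) / z ^ (2 * j + 1) - complex_of_real (s ! (2 * j + 1)) / z ^ (2 * j + 2)"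
      by (simp add: sum.lessThan_Suc)
    moreover have "z ^ 2 * z ^ (2 * j) * (complex_of_real (s ! (2 * j)) / z ^ (2 * j + 1)) = of_real (s ! (2 * j)) * z"
      "z ^ 2 * z ^ (2 * j) * (complex_of_real (s ! (2 * j + 1)) / z ^ (2 * j + 2)) = of_real (s ! (2 * j + 1))"
      using that by (simp_all add: power2_eq_square)
    ultimately show ?thesis unfolding shifted_rem_def by (simp only: right_diff_distrib mult.assoc) simp
  qed
  have "negsq (kern ?h) (holo_points \<phi>) m"
  proof (rule negsq_shift_le[OF _ Suc.prems(2) _ ev])
    show "holo_points \<phi> \<subseteq> \<complex>\<^sub>+" by (auto simp: holo_points_def)
    show "((\<lambda>y. \<i> * complex_of_real y * ?h (\<i> * complex_of_real y)) \<longlongrightarrow> - complex_of_real (s ! (2 * j))) at_top"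
      by (rule filterlim_compose[OF shifted_rem_lim[OF \<phi> j] filterlim_imag_axis_nontang[OF one_less_pi_half]]) simp
    fix z w assume "z \<in> holo_points \<phi>" "w \<in> holo_points \<phi>"
    then have zw: "Im z > 0" "Im w > 0" by (auto simp: holo_points_def)
    then have nz: "z \<noteq> 0" "w \<noteq> 0" "z - cnj w \<noteq> 0" by (auto simp: complex_eq_iff)
    define c where "c = z - cnj w"
    have c: "c \<noteq> 0" "cnj w = z - c" using nz by (auto simp: c_def)
    show "kern (shifted_rem s \<phi> (Suc j)) z w = z * cnj w * kern ?h z w + z * ?h z + cnj (w * ?h w) + complex_of_real (s ! (2 * j))"
      unfolding kern_def rec[OF nz(1)] rec[OF nz(2)] c_def[symmetric] complex_cnj_add complex_cnj_mult complex_cnj_power complex_cnj_complex_of_real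
      unfolding c(2) using c(1) by (simp add: field_simps power2_eq_square)
  qed
  then show ?case using Suc.IH j by simp
qed

text \<open>The number of negative squares of \<open>f\<close> is bounded by that of
  \<open>\<phi>\<close>, so a greatest one exists; this is the index of the class.\<close>

lemma nev_exists_le:
  assumes "f \<in> mero_sym" "\<And>m. negsq_fun f m \<Longrightarrow> negsq_fun \<phi> m" "\<phi> \<in> nev \<kappa>"
  obtains \<kappa>' where "\<kappa>' \<le> \<kappa>" "f \<in> nev \<kappa>'"
proof -
  obtain k where k: "\<kappa> = int k" "\<not> negsq_fun \<phi> (Suc k)" using assms(3) by (auto simp: nev_iff)
  have bound: "m \<le> k" if "negsq_fun f m" for m
    using negsq_mono[OF assms(2)[OF that], of "Suc k"] k(2) by (metis not_less_eq_eq)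
  define k' where "k' = (GREATEST m. negsq_fun f m)"
  have "negsq_fun f k'" unfolding k'_def by (rule GreatestI_nat[of _ 0 k]) (use bound in auto)
  moreover have "\<not> negsq_fun f (Suc k')"
    using Greatest_le_nat[of "negsq_fun f" "Suc k'" k] bound unfolding k'_def[symmetric] by auto
  ultimately show ?thesis using that[of "int k'"] bound assms(1) k by (auto simp: nev_iff)
qed

section \<open>The moment classes described by the remainder\<close>

lemma shifted_eq:
  fixes z :: complex
  shows "z ^ (2 * k) * (\<phi> z - complex_of_real 0 + (\<Sum>j=1..2*k. complex_of_real (s ! (j - 1)) / z ^ j)) = shifted_rem s \<phi> k z"
  unfolding shifted_rem_def One_nat_def sum.atLeast1_atMost_eq by (simp add: sum_negf)

lemma shifted_meromorphic:
  assumes "\<phi> \<in> mero_sym"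
  shows "(\<lambda>z. z ^ (2 * k) * (\<phi> z - complex_of_real \<gamma> + (\<Sum>j=1..2*k. complex_of_real (c (j - 1)) / z ^ j))) meromorphic_on \<complex>\<^sub>+"
  using mero_sym_meromorphic[OF assms] by (intro meromorphic_intros)

lemma shifted_at:
  assumes "Im z > 0" "\<phi> analytic_on {z}"
  shows "shifted \<phi> k \<gamma> c z = z ^ (2 * k) * (\<phi> z - complex_of_real \<gamma> + (\<Sum>j=1..2*k. complex_of_real (c (j - 1)) / z ^ j))"
proof -
  have "(\<lambda>z. z ^ (2 * k) * (\<phi> z - complex_of_real \<gamma> + (\<Sum>j=1..2*k. complex_of_real (c (j - 1)) / z ^ j))) analytic_on {z}"
    using assms by (intro analytic_intros) auto
  then show ?thesis unfolding shifted_def using assms by (simp add: sym_ext_upper)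
qed

lemma eventually_shifted:
  assumes "\<phi> \<in> mero_sym" "nt_small \<phi>" "\<delta> > 0"
  shows "\<forall>\<^sub>F z in nontang \<delta>. shifted \<phi> k \<gamma> c z = z ^ (2 * k) * (\<phi> z - complex_of_real \<gamma> + (\<Sum>j=1..2*k. complex_of_real (c (j - 1)) / z ^ j))"
proof -
  have "\<forall>\<^sub>F z in nontang \<delta>. \<phi> analytic_on {z}"
    using assms by (intro eventually_nontang_analytic) (auto simp: nt_small_def)
  then show ?thesis using eventually_nontang_upper[OF assms(3)] by eventually_elim (rule shifted_at)
qed

text \<open>Two choices of real coefficients in the definition of the shifted function differ by a
  real polynomial; growth \<open>o(z)\<close> leaves only its constant term.\<close>

lemma cpoly_small_imp_constant:
  assumes "((\<lambda>z. cpoly p z / z) \<longlongrightarrow> 0) (nontang 1)"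
  shows "cpoly p z = of_real (coeff p 0)"
proof -
  have "degree p = 0"
  proof (rule ccontr)
    assume d: "degree p \<noteq> 0"
    have "((\<lambda>z. (1 / z) ^ (degree p - 1) * (cpoly p z / z)) \<longlongrightarrow> 0 ^ (degree p - 1) * 0) (nontang 1)"
      by (intro tendsto_intros assms tendsto_inverse_at_infinity nontang_le_at_infinity)
    moreover have "(1 / z) ^ (degree p - 1) * (cpoly p z / z) = cpoly p z / z ^ degree p" for z
      using d by (cases "degree p") (auto simp: power_divide)
    ultimately have "((\<lambda>z. cpoly p z / z ^ degree p) \<longlongrightarrow> 0) (nontang 1)" by simp
    moreover have "((\<lambda>z. cpoly p z / z ^ degree p) \<longlongrightarrow> of_real (lead_coeff p)) (nontang 1)"
      using tendsto_mono[OF nontang_le_at_infinity cpoly_div_power_tendsto] .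
    ultimately have "complex_of_real (lead_coeff p) = 0" using tendsto_unique[OF nontang_one_nonbot] by blast
    then show False using d by auto
  qed
  then show ?thesis by (simp add: cpoly_altdef)
qed

text \<open>Any admissible shifted function is the remainder plus a real constant, so its imaginary
  part far out on the axis is that of the remainder. Conversely the choice
  \<open>\<gamma> = 0\<close> with the coefficients \<open>s\<close> works, its class having an
  index at most \<open>\<kappa>\<close> because shifting creates no negative squares.\<close>

lemma nev_neg_odd_iff:
  assumes \<phi>: "\<phi> \<in> nev \<kappa>" and ex: "has_expansion \<phi> s" and len: "length s = 2 * k" and k: "k \<ge> 1"
  shows "\<phi> \<in> nev_neg_odd \<kappa> k \<longleftrightarrow> remainder_integrable s \<phi>"
proof -
  have m: "\<phi> \<in> mero_sym" using \<phi> by (simp add: nev_def)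
  have e: "expands (int (length s)) s \<phi>" using ex by (simp add: has_expansion_iff)
  have small: "nt_small \<phi>" using expands_imp_nt_small[OF e] by simp
  have rem0: "(remainder s \<phi> \<longlongrightarrow> 0) (nontang \<delta>)" if "\<delta> > 0" for \<delta>
    using e that by (simp add: expands_iff_remainder)
  show ?thesis
  proof
    assume "\<phi> \<in> nev_neg_odd \<kappa> k"
    then obtain \<gamma> c \<kappa>' where f: "shifted \<phi> k \<gamma> c \<in> nev_1 \<kappa>'" by (auto simp: nev_neg_odd_def)
    define f where "f = shifted \<phi> k \<gamma> c"
    \<comment> \<open>The difference between the shifted function for \<open>\<gamma>\<close> and
      \<open>c\<close> and the one for 0 and \<open>s\<close>, with the powers
      \<open>z ^ (2 * k - 1 - i)\<close> left over after multiplication by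
      \<open>z ^ (2 * k)\<close>.\<close>
    define p where "p = (\<Sum>i<2 * k. Polynomial.monom (c i - s ! i) (2 * k - 1 - i)) - Polynomial.monom \<gamma> (2 * k)"
    have cp: "cpoly p z = (\<Sum>i<2 * k. of_real (c i - s ! i) * z ^ (2 * k - 1 - i)) - of_real \<gamma> * z ^ (2 * k)" for z
    proof -
      have "map_poly complex_of_real p = (\<Sum>i<2 * k. Polynomial.monom (of_real (c i - s ! i)) (2 * k - 1 - i)) - Polynomial.monom (of_real \<gamma>) (2 * k)"
        unfolding p_def
        by (rule poly_eqI) (simp add: coeff_map_poly coeff_sum if_distrib[of complex_of_real] cong: if_cong)
      then show ?thesis by (simp add: cpoly_def poly_sum poly_monom)
    qed
    have "\<forall>\<^sub>F z in nontang 1. f z = z ^ (2 * k) * (\<phi> z - complex_of_real \<gamma> + (\<Sum>j=1..2*k. complex_of_real (c (j - 1)) / z ^ j))"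
      unfolding f_def by (rule eventually_shifted[OF m small]) simp
    then have ev: "\<forall>\<^sub>F z in nontang 1. f z = remainder s \<phi> z + cpoly p z"
      using eventually_nontang_nonzero[of 1, OF less_numeral_extra(1)]
    proof eventually_elim
      case (elim z)
      have "z ^ (2 * k) * (\<Sum>i<2 * k. complex_of_real (c i - s ! i) / z ^ (i + 1)) = (\<Sum>i<2 * k. of_real (c i - s ! i) * z ^ (2 * k - 1 - i))"
        unfolding sum_distrib_left
      proof (intro sum.cong refl)
        fix i assume "i \<in> {..<2 * k}"
        then have "z ^ (2 * k) = z ^ (2 * k - 1 - i) * z ^ (i + 1)" unfolding power_add[symmetric] by (intro arg_cong[where f = "\<lambda>k. z ^ k"]) auto
        then show "z ^ (2 * k) * (complex_of_real (c i - s ! i) / z ^ (i + 1)) = of_real (c i - s ! i) * z ^ (2 * k - 1 - i)"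
          using elim(2) by simp
      qed
      then have cpz: "cpoly p z = z ^ (2 * k) * ((\<Sum>i<2 * k. complex_of_real (c i - s ! i) / z ^ (i + 1)) - of_real \<gamma>)"
        unfolding cp by (simp add: right_diff_distrib mult.commute)
      have sums: "(\<Sum>j=1..2*k. complex_of_real (c (j - 1)) / z ^ j) = Pf s z * (-1) + (\<Sum>i<2 * k. complex_of_real (c i - s ! i) / z ^ (i + 1)) "
        unfolding One_nat_def sum.atLeast1_atMost_eq Pf_def len
        by (simp add: sum_negf diff_divide_distrib sum_subtractf)
      show ?case unfolding elim(1) cpz remainder_def len sums by (simp add: algebra_simps)
    qed
    have "((\<lambda>z. f z / z) \<longlongrightarrow> 0) (nontang 1)" using f unfolding f_def nev_1_def nt_lim_def by simp
    then have "((\<lambda>z. f z / z - 1 / z * remainder s \<phi> z) \<longlongrightarrow> 0 - 0 * 0) (nontang 1)"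
      by (intro tendsto_intros tendsto_inverse_at_infinity nontang_le_at_infinity rem0[OF less_numeral_extra(1)])
    then have "((\<lambda>z. f z / z - 1 / z * remainder s \<phi> z) \<longlongrightarrow> 0) (nontang 1)" by simp
    then have "((\<lambda>z. cpoly p z / z) \<longlongrightarrow> 0) (nontang 1)"
      by (rule Lim_transform_eventually) (use ev in \<open>eventually_elim, simp add: add_divide_distrib\<close>)
    then have const: "cpoly p z = of_real (coeff p 0)" for z by (rule cpoly_small_imp_constant)
    have "\<forall>\<^sub>F z in nontang 1. Im (f z) = Im (remainder s \<phi> z)"
      using ev by eventually_elim (simp add: const)
    then have "\<forall>\<^sub>F y in at_top. Im (f (\<i> * of_real y)) = Im (remainder s \<phi> (\<i> * of_real y))"
      by (rule eventually_imag_axis)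
    moreover have "tail_integrable (\<lambda>y. Im (f (\<i> * of_real y)))"
      using f unfolding f_def nev_1_def tail_integrable_def by simp
    ultimately show "remainder_integrable s \<phi>"
      unfolding remainder_integrable_def by (rule tail_integrable_cong)
  next
    assume ri: "remainder_integrable s \<phi>"
    define f where "f = shifted \<phi> k 0 ((!) s)"
    have fm: "f \<in> mero_sym" unfolding f_def shifted_def by (rule sym_ext_mero_sym[OF shifted_meromorphic[OF m]])
    have f_at: "f z = remainder s \<phi> z" if "z \<in> holo_points \<phi>" for z
      using that shifted_at[of z \<phi> k 0 "(!) s"] unfolding f_def shifted_eq shifted_rem_remainder[OF len, symmetric]
      by (simp add: holo_points_def)
    have ev: "\<forall>\<^sub>F z in nontang \<delta>. remainder s \<phi> z = f z" if "\<delta> > 0" for \<delta>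
      using eventually_shifted[OF m small that, of k 0 "(!) s"]
      unfolding f_def shifted_eq shifted_rem_remainder[OF len] by (auto elim: eventually_mono)
    have "negsq_fun \<phi> j" if j: "negsq_fun f j" for j
    proof -
      define S where "S = holo_points f \<inter> holo_points \<phi>"
      have "\<forall>\<^sub>\<approx>z\<in>\<complex>\<^sub>+. z \<in> S"
        using mero_sym_analytic_cosparse[OF m] mero_sym_analytic_cosparse[OF fm] by (simp add: S_def eventually_conj_iff)
      then have "negsq (kern f) S j" using negsq_fun_generic[OF fm, of S] j by (simp add: S_def)
      then have "negsq (kern (shifted_rem s \<phi> k)) S j"
        by (rule negsq_scale[where c = "\<lambda>_. 1", rotated]) (simp add: S_def kern_def f_at shifted_rem_remainder[OF len])
      then have "negsq (kern (shifted_rem s \<phi> k)) (holo_points \<phi>) j"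
        by (rule negsq_subset) (simp add: S_def)
      then show ?thesis by (rule negsq_shifted_rem[OF m e, rotated]) (simp add: len)
    qed
    then obtain \<kappa>' where \<kappa>': "\<kappa>' \<le> \<kappa>" "f \<in> nev \<kappa>'" using nev_exists_le[OF fm _ \<phi>] by metis
    have "nt_lim (\<lambda>z. f z / z) 0"
      unfolding nt_lim_def
    proof (intro allI impI)
      fix \<delta> :: real assume \<delta>: "\<delta> > 0"
      have "((\<lambda>z. 1 / z * remainder s \<phi> z) \<longlongrightarrow> 0 * 0) (nontang \<delta>)"
        by (intro tendsto_intros tendsto_inverse_at_infinity nontang_le_at_infinity rem0 \<delta>)
      then show "((\<lambda>z. f z / z) \<longlongrightarrow> 0) (nontang \<delta>)"
        unfolding mult_zero_left
        by (rule Lim_transform_eventually) (use ev[OF \<delta>] in \<open>eventually_elim, simp\<close>)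
    qed
    moreover have "tail_integrable (\<lambda>y. Im (f (\<i> * of_real y)))"
    proof (rule tail_integrable_cong[OF _ ri[unfolded remainder_integrable_def]])
      show "\<forall>\<^sub>F y in at_top. Im (remainder s \<phi> (\<i> * of_real y)) = Im (f (\<i> * of_real y))"
        using eventually_imag_axis[OF ev[of 1]] by (auto elim: eventually_mono)
    qed
    ultimately have "f \<in> nev_1 \<kappa>'" using \<kappa>' by (simp add: nev_1_def tail_integrable_def)
    then show "\<phi> \<in> nev_neg_odd \<kappa> k" using \<phi> \<kappa>' unfolding nev_neg_odd_def f_def by blast
  qed
qed

text \<open>One more known term than shifts means that \<open>z\<close> times the shifted function
  converges to \<open>- s ! (2 * k)\<close>, which is more than the required
  \<open>O(1 / z)\<close>. For \<open>k = 0\<close> the same limit bounds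
  \<open>z * Im (\<phi> z)\<close>.\<close>

lemma expansion_imp_nev_neg_even:
  assumes \<phi>: "\<phi> \<in> nev \<kappa>" and ex: "has_expansion \<phi> s" and len: "length s = 2 * k + 1"
  shows "\<phi> \<in> nev_neg \<kappa> (2 * k)"
proof -
  have m: "\<phi> \<in> mero_sym" using \<phi> by (simp add: nev_def)
  have e: "expands (int (length s)) s \<phi>" using ex by (simp add: has_expansion_iff)
  have small: "nt_small \<phi>" using expands_imp_nt_small[OF e] by simp
  have lim: "((\<lambda>z. z * shifted_rem s \<phi> k z) \<longlongrightarrow> - of_real (s ! (2 * k))) (nontang \<delta>)" if "\<delta> > 0" for \<delta>
    using shifted_rem_lim[OF e _ that] len by simp
  show ?thesis
  proof (cases "k = 0")
    case True
    have "Limsup (nontang \<delta>) (\<lambda>z. ereal (cmod (z * complex_of_real (Im (\<phi> z))))) < \<infinity>" if "\<delta> > 0" for \<delta>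
    proof -
      have "((\<lambda>z. z * \<phi> z) \<longlongrightarrow> - of_real (s ! 0)) (nontang \<delta>)"
        using lim[OF that] True by (simp add: shifted_rem_def)
      then have "\<forall>\<^sub>F z in nontang \<delta>. cmod (z * \<phi> z) < \<bar>s ! 0\<bar> + 1"
        by (intro order_tendstoD(2)[OF tendsto_norm]) auto
      then have "\<forall>\<^sub>F z in nontang \<delta>. ereal (cmod (z * complex_of_real (Im (\<phi> z)))) \<le> ereal (\<bar>s ! 0\<bar> + 1)"
      proof eventually_elim
        case (elim z)
        have "cmod (z * complex_of_real (Im (\<phi> z))) \<le> cmod (z * \<phi> z)"
          by (simp add: norm_mult mult_left_mono abs_Im_le_cmod)
        then show ?case using elim by simp
      qed
      then have "Limsup (nontang \<delta>) (\<lambda>z. ereal (cmod (z * complex_of_real (Im (\<phi> z))))) \<le> ereal (\<bar>s ! 0\<bar> + 1)"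
        by (rule Limsup_bounded)
      then show ?thesis by (rule le_less_trans) simp
    qed
    then show ?thesis using True \<phi> small unfolding nev_neg_def nev_0_def nt_lim_def nt_small_def by auto
  next
    case False
    have "nt_bigo (shifted \<phi> k 0 ((!) s)) (\<lambda>z. 1 / z)"
      unfolding nt_bigo_def
    proof (intro allI impI)
      fix \<delta> :: real assume \<delta>: "\<delta> > 0"
      have "\<forall>\<^sub>F z in nontang \<delta>. z * shifted_rem s \<phi> k z = shifted \<phi> k 0 ((!) s) z / (1 / z)"
        using eventually_shifted[OF m small \<delta>, of k 0 "(!) s"]
        unfolding shifted_eq by eventually_elim (simp add: mult.commute)
      then have "((\<lambda>z. shifted \<phi> k 0 ((!) s) z / (1 / z)) \<longlongrightarrow> - of_real (s ! (2 * k))) (nontang \<delta>)"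
        by (rule Lim_transform_eventually[OF lim[OF \<delta>]])
      then show "shifted \<phi> k 0 ((!) s) \<in> O[nontang \<delta>](\<lambda>z. 1 / z)"
        by (rule bigoI_tendsto) (use eventually_nontang_nonzero[OF \<delta>] in \<open>eventually_elim, simp\<close>)
    qed
    then show ?thesis using False \<phi> unfolding nev_neg_def nev_neg_even_def by auto
  qed
qed

section \<open>Parameters with a prescribed number of negative squares\<close>

lemma nneg_le: "herm n A \<Longrightarrow> nneg n A \<le> n"
proof -
  assume "herm n A"
  then obtain lam where "nneg n A = card {l. l < n \<and> lam l < (0::real)}"
    by (rule spectral_decomposition) blast
  also have "\<dots> \<le> card {..<n}" by (intro card_mono) auto
  finally show ?thesis by simp
qed

text \<open>Starting from 0, the step with polynomial \<open>- z\<close> adds one negative square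
  each time, its Bezoutian being the 1 by 1 matrix with entry -1. The new function behaves like
  \<open>1 / z\<close>, so the step can be repeated.\<close>

lemma nev_example:
  "\<exists>\<tau>\<in>nev (int k). \<exists>L. \<forall>\<delta>>0. ((\<lambda>z. z * \<tau> z) \<longlongrightarrow> L) (nontang \<delta>)"
proof (induction k)
  case 0
  define \<tau> where "\<tau> = (\<lambda>z::complex. 0::complex)"
  have "\<tau> \<in> mero_sym" unfolding mero_sym_def \<tau>_def by auto
  moreover have "\<not> negsq_fun \<tau> (Suc 0)"
    unfolding negsq_def by (auto simp: \<tau>_def kern_def qf_def)
  ultimately have "\<tau> \<in> nev (int 0)" by (auto simp: nev_iff)
  moreover have "((\<lambda>z. z * \<tau> z) \<longlongrightarrow> 0) (nontang \<delta>)" for \<delta> by (simp add: \<tau>_def)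
  ultimately show ?case by blast
next
  case (Suc k)
  then obtain \<tau> L where \<tau>: "\<tau> \<in> nev (int k)" "\<And>\<delta>. \<delta> > 0 \<Longrightarrow> ((\<lambda>z. z * \<tau> z) \<longlongrightarrow> L) (nontang \<delta>)" by blast
  have m: "\<tau> \<in> mero_sym" using \<tau> by (simp add: nev_def)
  let ?q = "[:0, -1:] :: real poly"
  have small: "nt_small \<tau>"
    unfolding nt_small_def
  proof (intro allI impI)
    fix \<delta> :: real assume \<delta>: "\<delta> > 0"
    have "((\<lambda>z. (1 / z) * (1 / z) * (z * \<tau> z)) \<longlongrightarrow> 0 * 0 * L) (nontang \<delta>)"
      by (intro tendsto_intros tendsto_inverse_at_infinity nontang_le_at_infinity \<tau>(2) \<delta>)
    moreover have "\<forall>\<^sub>F z in nontang \<delta>. (1 / z) * (1 / z) * (z * \<tau> z) = \<tau> z / z"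
      using eventually_nontang_nonzero[OF \<delta>] by eventually_elim simp
    ultimately show "((\<lambda>z. \<tau> z / z) \<longlongrightarrow> 0) (nontang \<delta>)"
      using Lim_transform_eventually by fastforce
  qed
  have ev: "\<forall>\<^sub>F z in nontang \<delta>. Im z > 0 \<and> \<tau> analytic_on {z} \<and> cpoly ?q z + of_real (1\<^sup>2) * \<tau> z \<noteq> 0" if "\<delta> > 0" for \<delta>
    using small that m
    by (intro eventually_conj eventually_nontang_upper eventually_nontang_analytic
        step_denominator_nonzero[OF nontang_le_at_infinity]) (auto simp: nt_small_def)
  obtain z where "Im z > 0" "\<tau> analytic_on {z}" "cpoly ?q z + of_real (1\<^sup>2) * \<tau> z \<noteq> 0"
    using eventually_happens'[OF nontang_one_nonbot ev[of 1, OF less_numeral_extra(1)]] by blast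
  then obtain \<phi> where rel: "step_rel ?q 1 \<phi> \<tau>" using step_rel_exists_forward[OF m] by blast
  have "nneg 1 (bezout_coeff ?q) = 1"
  proof (rule antisym)
    show "nneg 1 (bezout_coeff ?q) \<le> 1" by (rule nneg_le[OF herm_bezout_coeff])
    show "1 \<le> nneg 1 (bezout_coeff ?q)"
      by (rule nneg_geI[OF herm_bezout_coeff, where V = "\<lambda>_ _. 1"]) (simp add: qf_def bezout_coeff_def lessThan_Suc)
  qed
  then have "\<phi> \<in> nev (int (Suc k))"
    using step_nev[OF rel _ small, of "int (Suc k)"] \<tau>(1) by simp
  moreover have "((\<lambda>z. z * \<phi> z) \<longlongrightarrow> 1) (nontang \<delta>)" if \<delta>: "\<delta> > 0" for \<delta>
  proof -
    have "((\<lambda>z. (cpoly ?q z + of_real (1\<^sup>2) * \<tau> z) / z ^ degree ?q) \<longlongrightarrow> of_real (lead_coeff ?q)) (nontang \<delta>)"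
      using small \<delta> by (intro step_denominator_tendsto[OF nontang_le_at_infinity]) (auto simp: nt_small_def)
    then have "((\<lambda>z. - 1 / ((cpoly ?q z + of_real (1\<^sup>2) * \<tau> z) / z ^ degree ?q)) \<longlongrightarrow> - 1 / of_real (lead_coeff ?q)) (nontang \<delta>)"
      by (intro tendsto_intros) simp_all
    then have "((\<lambda>z. - 1 / ((cpoly ?q z + of_real (1\<^sup>2) * \<tau> z) / z)) \<longlongrightarrow> 1) (nontang \<delta>)" by simp
    then show ?thesis
    proof (rule Lim_transform_eventually)
      show "\<forall>\<^sub>F z in nontang \<delta>. - 1 / ((cpoly ?q z + of_real (1\<^sup>2) * \<tau> z) / z) = z * \<phi> z"
        using ev[OF \<delta>]
      proof eventually_elim
        case (elim z)
        then have "\<phi> z = - 1 / (cpoly ?q z + of_real (1\<^sup>2) * \<tau> z)" using step_rel_forward_at(2)[OF rel] by blast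
        then show ?case by simp
      qed
    qed
  qed
  ultimately show ?case by blast
qed

text \<open>A function of size \<open>O(1 / z)\<close> is \<open>o(1)\<close>, and its imaginary
  part over \<open>y\<close> is \<open>O(1 / y ^ 2)\<close>, hence integrable.\<close>

lemma nev_1_example: "\<exists>\<tau>\<in>nev_1 (int k). expands 0 [] \<tau>"
proof -
  obtain \<tau> L where \<tau>: "\<tau> \<in> nev (int k)" "\<And>\<delta>. \<delta> > 0 \<Longrightarrow> ((\<lambda>z. z * \<tau> z) \<longlongrightarrow> L) (nontang \<delta>)"
    using nev_example[of k] by blast
  have m: "\<tau> \<in> mero_sym" using \<tau> by (simp add: nev_def)
  have e: "expands 0 [] \<tau>"
    unfolding expands_def
  proof (intro allI impI)
    fix \<delta> :: real assume \<delta>: "\<delta> > 0"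
    have "((\<lambda>z. (1 / z) * (z * \<tau> z)) \<longlongrightarrow> 0 * L) (nontang \<delta>)"
      by (intro tendsto_intros tendsto_inverse_at_infinity nontang_le_at_infinity \<tau>(2) \<delta>)
    moreover have "\<forall>\<^sub>F z in nontang \<delta>. (1 / z) * (z * \<tau> z) = z powi 0 * (\<tau> z - Pf [] z)"
      using eventually_nontang_nonzero[OF \<delta>] by eventually_elim (simp add: Pf_def)
    ultimately show "((\<lambda>z. z powi 0 * (\<tau> z - Pf [] z)) \<longlongrightarrow> 0) (nontang \<delta>)"
      using Lim_transform_eventually by fastforce
  qed
  have small: "nt_small \<tau>" using expands_imp_nt_small[OF e] by simp
  have z: "tail_integrable (\<lambda>_. 0)" by (simp add: tail_integrable_def set_integrable_def)
  have "tail_integrable (\<lambda>y. Im (\<tau> (\<i> * of_real y)))"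
  proof (rule tail_integrable_compare[OF z, where c = 0 and C = "cmod L + 1"])
    show "\<forall>\<^sub>F y in at_top. isCont (\<lambda>y. Im (\<tau> (\<i> * complex_of_real y))) y"
      using isCont_Im_remainder[OF m small, of "[]"] by (simp add: remainder_def Pf_def)
    have "\<forall>\<^sub>F z in nontang 1. cmod (z * \<tau> z) < cmod L + 1"
      by (intro order_tendstoD(2)[OF tendsto_norm[OF \<tau>(2)]]) auto
    from eventually_imag_axis[OF this] eventually_gt_at_top[of 0]
    show "\<forall>\<^sub>F y in at_top. \<bar>Im (\<tau> (\<i> * complex_of_real y))\<bar> \<le> 0 * \<bar>0\<bar> + (cmod L + 1) / y"
    proof eventually_elim
      case (elim y)
      have "y * cmod (\<tau> (\<i> * of_real y)) < cmod L + 1" using elim by (simp add: norm_mult)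
      then have "cmod (\<tau> (\<i> * of_real y)) \<le> (cmod L + 1) / y" using elim(2) by (simp add: pos_le_divide_eq mult.commute)
      then show ?case using abs_Im_le_cmod[of "\<tau> (\<i> * of_real y)"] by simp
    qed
  qed
  then have "\<tau> \<in> nev_1 (int k)"
    using \<tau>(1) small by (simp add: nev_1_def nt_lim_def nt_small_def tail_integrable_def)
  then show ?thesis using e by blast
qed

section \<open>Hankel matrices along one step\<close>

text \<open>Up to sign, the coefficient of \<open>z powi (- a - 1)\<close> in the expansion of
  \<open>\<phi> z * z powi (d - 1 - i)\<close>; the two signs cancel in the congruence.\<close>

definition hankel_L :: "real list \<Rightarrow> nat \<Rightarrow> nat \<Rightarrow> nat \<Rightarrow> real" where
  "hankel_L t d a i = (if i \<le> a then t ! (d - 1 + (a - i)) else 0)"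

text \<open>The coefficient of \<open>z powi (d - 1 - i) * w powi (d - 1 - j)\<close> in the
  difference quotient of \<open>Q\<close>: the polynomial \<open>q\<close> gives the block of
  nonnegative powers, the tail \<open>u\<close> that of negative powers, and mixed products do not
  occur.\<close>

definition hankel_D :: "real poly \<Rightarrow> real list \<Rightarrow> nat \<Rightarrow> nat \<Rightarrow> nat \<Rightarrow> real" where
  "hankel_D q u d i j = (if i < d \<and> j < d then coeff q (2 * d - 1 - i - j)
     else if d \<le> i \<and> d \<le> j then u ! (i + j - 2 * d) else 0)"

text \<open>
  The coefficients of \<open>(\<phi>(z) - \<phi>(w)) / (z - w) = \<phi>(z) \<phi>(w) (Q(z) - Q(w)) / (z - w)\<close> with
  \<open>\<phi> = - 1 / Q\<close>, expanded at infinity.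
\<close>

lemma hankel_factorization:
  assumes sr: "schur_rel t d \<epsilon> p u" and len: "2 * k + 1 \<le> length t" and dk: "d \<le> k + 1"
    and ab: "a \<le> k" "b \<le> k"
  shows "t ! (a + b) = (\<Sum>i<Suc k. \<Sum>j<Suc k. hankel_L t d a i * hankel_D (Polynomial.smult \<epsilon> p) u d i j * hankel_L t d b j)"
proof -
  have d: "d \<ge> 1" "2 * d \<le> length t + 1" "length u = length t - 2 * d" "\<And>i. i < d - 1 \<Longrightarrow> t ! i = 0"
    "t ! (d - 1) = \<epsilon>" "\<epsilon> = 1 \<or> \<epsilon> = -1" "degree p = d" "lead_coeff p = 1"
    using sr unfolding schur_rel_def by blast+
  have eps: "\<epsilon> * \<epsilon> = 1" using d(6) by auto
  define c where "c m = t ! (d - 1 + m)" for m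
  define E where "E = E_coeff d p \<epsilon> u"
  have conv: "(\<Sum>i<Suc m. c (m - i) * E i) = (if m = 0 then \<epsilon> else 0)" if "m \<le> length t - d" for m
  proof -
    have "(\<Sum>i<Suc m. c (m - i) * E i) = (\<Sum>i<Suc m. c i * E (m - i))"
      by (subst sum.nat_diff_reindex[symmetric]) (auto intro!: sum.cong)
    also have "\<dots> = (if m = 0 then \<epsilon> else 0)"
      using sr that unfolding schur_rel_def c_def E_def lessThan_Suc_atMost by auto
    finally show ?thesis .
  qed
  define x where "x i j = (if d \<le> i + j + 1 then E (i + j + 1 - d) else 0)" for i j
  let ?D = "hankel_D (Polynomial.smult \<epsilon> p) u d" and ?La = "hankel_L t d a" and ?Lb = "hankel_L t d b"
  \<comment> \<open>One Hankel array \<open>x\<close> with two cut-offs: when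
    \<open>i < d \<le> j\<close> both terms are present and cancel, when
    \<open>j < d \<le> i\<close> both are absent. Each of the two sums can then be evaluated with
    the convolution equations.\<close>
  have D: "?D i j = \<epsilon> * (x i j * (if i < d then 1 else 0) - x i j * (if d \<le> j then 1 else 0))" for i j
  proof -
    consider "i < d" "j < d" | "i < d" "d \<le> j" | "d \<le> i" "j < d" | "d \<le> i" "d \<le> j" by linarith
    then show ?thesis
    proof cases
      case 1
      show ?thesis
      proof (cases "d \<le> i + j + 1")
        case True
        have "d - (i + j + 1 - d) = 2 * d - 1 - i - j" using 1 True by linarith
        then show ?thesis using 1 True by (auto simp: hankel_D_def x_def E_def E_coeff_def)
      next
        case False
        then have "coeff p (2 * d - 1 - i - j) = 0" using d(7) by (intro coeff_eq_0) linarith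
        then show ?thesis using 1 False by (simp add: hankel_D_def x_def)
      qed
    next
      case 4
      have "i + j + 1 - d - d - 1 = i + j - 2 * d" using 4 by linarith
      moreover have "\<not> i + j + 1 - d \<le> d" "d \<le> i + j + 1" using 4 d(1) by linarith+
      ultimately show ?thesis using 4 eps by (simp add: hankel_D_def x_def E_def E_coeff_def mult.assoc[symmetric])
    qed (auto simp: hankel_D_def)
  qed
  have S: "(\<Sum>j<Suc k. ?Lb j * x i j) = (if b + i + 1 = d then \<epsilon> else 0)" if i: "i < d" for i
  proof -
    have "(\<Sum>j<Suc k. ?Lb j * x i j) = (\<Sum>j<Suc b. c (b - j) * x i j)"
      using ab by (intro sum.mono_neutral_cong_right) (auto simp: hankel_L_def c_def)
    also have "\<dots> = (if b + i + 1 = d then \<epsilon> else 0)"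
    proof (cases "b + i + 1 < d")
      case True
      then have "(\<Sum>j<Suc b. c (b - j) * x i j) = 0" by (intro sum.neutral) (auto simp: x_def)
      then show ?thesis using True by simp
    next
      case False
      define q N where "q = d - 1 - i" and "N = b + i + 1 - d"
      have b: "Suc b = q + Suc N" "b = q + N" using False i by (auto simp: q_def N_def)
      have "(\<Sum>j<Suc b. c (b - j) * x i j) = (\<Sum>j<q. c (b - j) * x i j) + (\<Sum>m<Suc N. c (b - (q + m)) * x i (q + m))"
        unfolding b(1) sum_lessThan_add ..
      also have "(\<Sum>j<q. c (b - j) * x i j) = 0" by (intro sum.neutral) (auto simp: x_def q_def)
      also have "(\<Sum>m<Suc N. c (b - (q + m)) * x i (q + m)) = (\<Sum>m<Suc N. c (N - m) * E m)"
      proof (intro sum.cong refl)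
        fix m assume "m \<in> {..<Suc N}"
        have "x i (q + m) = E m" using i by (simp add: x_def q_def)
        then show "c (b - (q + m)) * x i (q + m) = c (N - m) * E m" by (simp add: b(2))
      qed
      also have "\<dots> = (if N = 0 then \<epsilon> else 0)" using conv[of N] ab i len dk by (auto simp: N_def)
      finally show ?thesis using False by (auto simp: N_def)
    qed
    finally show ?thesis .
  qed
  \<comment> \<open>A complete convolution of positive index vanishes. The sum on the left is its
    upper part, hence minus its lower part.\<close>
  have T: "(\<Sum>i<Suc k. ?La i * x i (d + j)) = - (\<Sum>m<Suc j. c (a + 1 + (j - m)) * E m)" if j: "d + j \<le> k" for j
  proof -
    have "(\<Sum>i<Suc k. ?La i * x i (d + j)) = (\<Sum>i<Suc a. c (a - i) * E (Suc j + i))"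
      using ab by (intro sum.mono_neutral_cong_right) (auto simp: hankel_L_def c_def x_def add.commute)
    moreover have "(\<Sum>m<Suc j. c (a + Suc j - m) * E m) + (\<Sum>i<Suc a. c (a - i) * E (Suc j + i)) = 0"
    proof -
      have "(\<Sum>m<Suc (a + Suc j). c (a + Suc j - m) * E m) = 0"
        using conv[of "a + Suc j"] ab j len dk by auto
      moreover have "Suc (a + Suc j) = Suc j + Suc a" by simp
      ultimately show ?thesis using sum_lessThan_add[of "\<lambda>m. c (a + Suc j - m) * E m" "Suc j" "Suc a"]
        by (simp add: add.commute[of j a])
    qed
    moreover have "(\<Sum>m<Suc j. c (a + Suc j - m) * E m) = (\<Sum>m<Suc j. c (a + 1 + (j - m)) * E m)"
      by (intro sum.cong refl) (simp add: Suc_diff_le)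
    ultimately show ?thesis by linarith
  qed
  have "(\<Sum>i<Suc k. \<Sum>j<Suc k. ?La i * ?D i j * ?Lb j)
    = \<epsilon> * ((\<Sum>i<Suc k. \<Sum>j<Suc k. ?La i * (if i < d then 1 else 0) * (?Lb j * x i j))
      - (\<Sum>i<Suc k. \<Sum>j<Suc k. ?Lb j * (if d \<le> j then 1 else 0) * (?La i * x i j)))"
    unfolding D sum_subtractf[symmetric] sum_distrib_left by (intro sum.cong refl) (simp add: algebra_simps)
  also have "(\<Sum>i<Suc k. \<Sum>j<Suc k. ?La i * (if i < d then 1 else 0) * (?Lb j * x i j))
    = (\<Sum>i<Suc k. ?La i * (if i < d then 1 else 0) * (if b + i + 1 = d then \<epsilon> else 0))"
    unfolding sum_distrib_left[symmetric] using S by (intro sum.cong refl) auto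
  also have "\<dots> = (if b < d then \<epsilon> * ?La (d - 1 - b) else 0)"
  proof (cases "b < d")
    case True
    have "(\<Sum>i<Suc k. ?La i * (if i < d then 1 else 0) * (if b + i + 1 = d then \<epsilon> else 0))
      = (\<Sum>i<Suc k. if i = d - 1 - b then \<epsilon> * ?La (d - 1 - b) else 0)"
      using True by (intro sum.cong refl) auto
    then show ?thesis using True dk by (simp add: sum.delta)
  qed (auto intro!: sum.neutral)
  also have "(\<Sum>i<Suc k. \<Sum>j<Suc k. ?Lb j * (if d \<le> j then 1 else 0) * (?La i * x i j))
    = (\<Sum>j<Suc k. ?Lb j * (if d \<le> j then 1 else 0) * (\<Sum>i<Suc k. ?La i * x i j))"
    unfolding sum_distrib_left by (rule sum.swap)
  also have "\<dots> = (if b < d then 0 else - \<epsilon> * c (a + 1 + (b - d)))"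
  proof (cases "b < d")
    case True
    then show ?thesis by (auto intro!: sum.neutral simp: hankel_L_def)
  next
    case False
    define N where "N = b - d"
    \<comment> \<open>The double sum is a triple product of power series. Regrouping pairs
      \<open>E\<close> with \<open>c\<close>, whose product is \<open>\<epsilon>\<close> up to the
      order needed, so only one term survives.\<close>
    define P where "P = Abs_fps E * Abs_fps (\<lambda>m. c (a + 1 + m))"
    define Q where "Q = Abs_fps E * Abs_fps c"
    have P: "fps_nth P j = (\<Sum>m = 0..j. c (a + 1 + (j - m)) * E m)" for j
      by (simp add: P_def fps_mult_nth mult.commute)
    have b: "Suc b = d + Suc N" "b = d + N" using False by (auto simp: N_def)
    have "(\<Sum>j<Suc k. ?Lb j * (if d \<le> j then 1 else 0) * (\<Sum>i<Suc k. ?La i * x i j))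
      = (\<Sum>j<Suc b. ?Lb j * (if d \<le> j then 1 else 0) * (\<Sum>i<Suc k. ?La i * x i j))"
      using ab by (intro sum.mono_neutral_right) (auto simp: hankel_L_def)
    also have "\<dots> = (\<Sum>j<Suc N. ?Lb (d + j) * (\<Sum>i<Suc k. ?La i * x i (d + j)))"
      unfolding b(1) sum_lessThan_add by simp
    also have "\<dots> = (\<Sum>j<Suc N. c (N - j) * - (\<Sum>m<Suc j. c (a + 1 + (j - m)) * E m))"
      using ab b(2) by (intro sum.cong refl) (subst T, auto simp: hankel_L_def c_def)
    also have "\<dots> = - fps_nth (P * Abs_fps c) N"
      by (simp add: fps_mult_nth[of P] lessThan_Suc_atMost atMost_atLeast0 P sum_negf mult.commute)
    also have "P * Abs_fps c = Q * Abs_fps (\<lambda>m. c (a + 1 + m))"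
      by (simp add: P_def Q_def mult_ac)
    also have "fps_nth (Q * Abs_fps (\<lambda>m. c (a + 1 + m))) N = (\<Sum>i<Suc N. fps_nth Q i * c (a + 1 + (N - i)))"
      by (simp add: fps_mult_nth[of Q] lessThan_Suc_atMost atMost_atLeast0)
    also have "\<dots> = (\<Sum>i<Suc N. if i = 0 then \<epsilon> * c (a + 1 + N) else 0)"
    proof (intro sum.cong refl)
      fix i assume "i \<in> {..<Suc N}"
      then have "i \<le> length t - d" using b(2) ab len by auto
      then have "fps_nth Q i = (if i = 0 then \<epsilon> else 0)"
        using conv[of i] by (simp add: Q_def fps_mult_nth lessThan_Suc_atMost atMost_atLeast0 mult.commute)
      then show "fps_nth Q i * c (a + 1 + (N - i)) = (if i = 0 then \<epsilon> * c (a + 1 + N) else 0)" by simp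
    qed
    also have "\<dots> = \<epsilon> * c (a + 1 + N)" by (simp add: sum.delta)
    finally show ?thesis using False by (simp add: N_def)
  qed
  also have "\<epsilon> * ((if b < d then \<epsilon> * ?La (d - 1 - b) else 0) - (if b < d then 0 else - \<epsilon> * c (a + 1 + (b - d)))) = t ! (a + b)"
  proof (cases "b < d")
    case True
    have "?La (d - 1 - b) = t ! (a + b)"
      using True d(4)[of "a + b"] by (auto simp: hankel_L_def intro!: arg_cong[where f = "\<lambda>i. t ! i"])
    then show ?thesis using True eps by (simp add: mult.assoc[symmetric])
  next
    case False
    have "c (a + 1 + (b - d)) = t ! (a + b)"
      unfolding c_def using False d(1) by (intro arg_cong[where f = "\<lambda>i. t ! i"]) auto
    then show ?thesis using False eps by (simp add: mult.assoc[symmetric])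
  qed
  finally show ?thesis by simp
qed

section \<open>Hankel determinants and normal indices\<close>

text \<open>In a kernel vector the coordinates vanish one after the other from the last: row
  \<open>i\<close> involves only the coordinate \<open>d - 1 - i\<close> and later ones.\<close>

lemma antitriangular_det_nonzero:
  fixes A :: "'a::field Matrix.mat"
  assumes A: "A \<in> carrier_mat d d"
    and z: "\<And>i j. i < d \<Longrightarrow> j < d \<Longrightarrow> i + j < d - 1 \<Longrightarrow> A $$ (i, j) = 0"
    and nz: "\<And>i j. i < d \<Longrightarrow> j < d \<Longrightarrow> i + j = d - 1 \<Longrightarrow> A $$ (i, j) \<noteq> 0"
  shows "Determinant.det A \<noteq> 0"
proof
  assume "Determinant.det A = 0"
  then obtain v where v: "v \<in> carrier_vec d" "v \<noteq> 0\<^sub>v d" "A *\<^sub>v v = 0\<^sub>v d"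
    using det_0_iff_vec_prod_zero_field[OF A] by auto
  have row: "(\<Sum>j<d. A $$ (i, j) * vec_index v j) = 0" if "i < d" for i
  proof -
    have "vec_index (A *\<^sub>v v) i = 0" using v(3) that by simp
    then show ?thesis using that v(1) A by (auto simp: scalar_prod_def lessThan_atLeast0)
  qed
  have "vec_index v (d - 1 - i) = 0" if "i < d" for i
    using that
  proof (induction i rule: less_induct)
    case (less i)
    have "A $$ (i, j) * vec_index v j = (if j = d - 1 - i then A $$ (i, d - 1 - i) * vec_index v (d - 1 - i) else 0)"
      if "j < d" for j
    proof -
      consider "j < d - 1 - i" | "j = d - 1 - i" | "j > d - 1 - i" by linarith
      then show ?thesis
      proof cases
        case 1
        then show ?thesis using z[of i j] less.prems that by auto
      next
        case 3
        have "vec_index v (d - 1 - (d - 1 - j)) = 0" using 3 that less.prems by (intro less.IH) auto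
        then show ?thesis using 3 that by simp
      qed simp
    qed
    then have "0 = (\<Sum>j<d. if j = d - 1 - i then A $$ (i, d - 1 - i) * vec_index v (d - 1 - i) else 0)"
      unfolding row[OF less.prems, symmetric] by (intro sum.cong) auto
    also have "\<dots> = A $$ (i, d - 1 - i) * vec_index v (d - 1 - i)" using less.prems by simp
    finally show ?case using nz[of i "d - 1 - i"] less.prems by auto
  qed
  then have "vec_index v i = 0" if "i < d" for i
    using that by (metis Suc_pred' diff_Suc_1' diff_diff_cancel diff_less less_Suc_eq_le less_nat_zero_code not_gr_zero zero_less_Suc less_imp_diff_less)
  then show False using v by (metis carrier_vecD eq_vecI index_zero_vec)
qed

lemma hankel_carrier [simp]: "hankel t k \<in> carrier_mat (Suc k) (Suc k)"
  by (simp add: hankel_def)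

lemma hankel_index: "i \<le> k \<Longrightarrow> j \<le> k \<Longrightarrow> hankel t k $$ (i, j) = t ! (i + j)"
  by (simp add: hankel_def)

text \<open>Below size \<open>d\<close> the first row is zero; at size \<open>d\<close> the matrix
  is antitriangular with \<open>t ! (d - 1)\<close> on the antidiagonal. So the position of the
  first nonzero entry is the first normal index.\<close>

lemma det_hankel_leading_zeros:
  assumes "\<And>i. i < d - 1 \<Longrightarrow> t ! i = 0"
  shows "k + 1 < d \<Longrightarrow> Determinant.det (hankel t k) = 0"
    and "d \<ge> 1 \<Longrightarrow> t ! (d - 1) \<noteq> 0 \<Longrightarrow> Determinant.det (hankel t (d - 1)) \<noteq> 0"
proof -
  assume "k + 1 < d"
  then show "Determinant.det (hankel t k) = 0"
    using laplace_expansion_row[OF hankel_carrier[of t k], of 0] assms by (simp add: hankel_index)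
next
  assume "d \<ge> 1" "t ! (d - 1) \<noteq> 0"
  then show "Determinant.det (hankel t (d - 1)) \<noteq> 0"
    by (intro antitriangular_det_nonzero[of _ d]) (auto simp: hankel_def assms)
qed

lemma hankel_L_lower:
  assumes "d \<ge> 1"
  shows "Determinant.det (Matrix.mat n n (\<lambda>(a, i). hankel_L t d a i)) = (t ! (d - 1)) ^ n"
proof -
  have "Determinant.det (Matrix.mat n n (\<lambda>(a, i). hankel_L t d a i))
    = prod_list (diag_mat (Matrix.mat n n (\<lambda>(a, i). hankel_L t d a i)))"
    by (rule det_lower_triangular[of n]) (auto simp: hankel_L_def)
  also have "diag_mat (Matrix.mat n n (\<lambda>(a, i). hankel_L t d a i)) = replicate n (t ! (d - 1))"
    by (rule nth_equalityI) (auto simp: diag_mat_def hankel_L_def)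
  finally show ?thesis by simp
qed

text \<open>The outer factors of the congruence are triangular with \<open>\<epsilon>\<close> on the
  diagonal and the polynomial block is antitriangular with \<open>\<epsilon>\<close> on the
  antidiagonal; only the determinant of the Hankel block of \<open>u\<close> can vanish. Normal
  indices are thereby shifted by \<open>d\<close>.\<close>

lemma det_hankel_step:
  assumes sr: "schur_rel t d \<epsilon> p u" and len: "2 * k + 1 \<le> length t" and dk: "d \<le> k"
  shows "Determinant.det (hankel t k) \<noteq> 0 \<longleftrightarrow> Determinant.det (hankel u (k - d)) \<noteq> 0"
proof -
  have d: "d \<ge> 1" "t ! (d - 1) = \<epsilon>" "\<epsilon> = 1 \<or> \<epsilon> = -1" "degree p = d" "lead_coeff p = 1"
    using sr unfolding schur_rel_def by blast+
  let ?q = "Polynomial.smult \<epsilon> p"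
  define L where "L = Matrix.mat (Suc k) (Suc k) (\<lambda>(a, i). hankel_L t d a i)"
  define D where "D = Matrix.mat (Suc k) (Suc k) (\<lambda>(i, j). hankel_D ?q u d i j)"
  define B where "B = Matrix.mat d d (\<lambda>(i, j). coeff ?q (2 * d - 1 - i - j))"
  have L: "L \<in> carrier_mat (Suc k) (Suc k)" and D: "D \<in> carrier_mat (Suc k) (Suc k)"
    and B: "B \<in> carrier_mat d d" by (simp_all add: L_def D_def B_def)
  have fac: "hankel t k = L * D * transpose_mat L"
  proof (rule eq_matI)
    fix a b assume "a < dim_row (L * D * transpose_mat L)" "b < dim_col (L * D * transpose_mat L)"
    then have ab: "a < Suc k" "b < Suc k" using L D by auto
    have "(L * D * transpose_mat L) $$ (a, b) = (\<Sum>j<Suc k. (L * D) $$ (a, j) * transpose_mat L $$ (j, b))"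
      using ab L D by (intro index_mult_mat_sum[of _ "Suc k" "Suc k" _ "Suc k"]) auto
    also have "\<dots> = (\<Sum>j<Suc k. (\<Sum>i<Suc k. hankel_L t d a i * hankel_D ?q u d i j) * hankel_L t d b j)"
    proof (intro sum.cong refl)
      fix j assume j: "j \<in> {..<Suc k}"
      then have "(L * D) $$ (a, j) = (\<Sum>i<Suc k. L $$ (a, i) * D $$ (i, j))"
        using ab by (intro index_mult_mat_sum[OF L D]) auto
      then show "(L * D) $$ (a, j) * transpose_mat L $$ (j, b) = (\<Sum>i<Suc k. hankel_L t d a i * hankel_D ?q u d i j) * hankel_L t d b j"
        using ab j by (simp add: L_def D_def del: index_mult_mat(1))
    qed
    also have "\<dots> = (\<Sum>i<Suc k. \<Sum>j<Suc k. hankel_L t d a i * hankel_D ?q u d i j * hankel_L t d b j)"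
      unfolding sum_distrib_right by (rule sum.swap)
    also have "\<dots> = t ! (a + b)" using hankel_factorization[OF sr len] dk ab by simp
    finally show "hankel t k $$ (a, b) = (L * D * transpose_mat L) $$ (a, b)"
      using ab by (simp add: hankel_index)
  qed (use L D in \<open>simp_all add: hankel_def\<close>)
  have "D = four_block_mat B (0\<^sub>m d (Suc (k - d))) (0\<^sub>m (Suc (k - d)) d) (hankel u (k - d))"
    by (rule eq_matI) (use dk in \<open>auto simp: D_def B_def hankel_D_def hankel_def mult_2 intro!: arg_cong[where f = "\<lambda>i. u ! i"]\<close>)
  then have detD: "Determinant.det D = Determinant.det B * Determinant.det (hankel u (k - d))"
    using det_four_block_mat_upper_right_zero[OF B refl _ hankel_carrier] by auto
  have "Determinant.det B \<noteq> 0"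
  proof (rule antitriangular_det_nonzero[OF B])
    fix i j assume ij: "i < d" "j < d"
    show "i + j < d - 1 \<Longrightarrow> B $$ (i, j) = 0"
      using ij d(4) by (auto simp: B_def intro!: coeff_eq_0)
    assume "i + j = d - 1"
    then have "2 * d - 1 - i - j = d" using d(1) by linarith
    then show "B $$ (i, j) \<noteq> 0" using ij d by (auto simp: B_def)
  qed
  moreover have "Determinant.det L \<noteq> 0" unfolding L_def hankel_L_lower[OF d(1)] using d by auto
  moreover have "Determinant.det (hankel t k) = Determinant.det L * Determinant.det D * Determinant.det L"
    unfolding fac using L D by (simp add: Determinant.det_mult[of _ "Suc k"] Determinant.det_transpose[OF L])
  ultimately show ?thesis by (simp add: detD)
qed

section \<open>Negative eigenvalues of Hankel matrices\<close>

abbreviation hank :: "real list \<Rightarrow> nat \<Rightarrow> nat \<Rightarrow> complex" where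
  "hank t i j \<equiv> complex_of_real (t ! (i + j))"

lemma herm_hank: "herm n (hank t)"
  by (simp add: herm_def add.commute)

lemma nneg_hankel: "neg_eigs (map_mat complex_of_real (hankel t k)) = nneg (Suc k) (hank t)"
  unfolding nneg_def hankel_def by (intro arg_cong[where f = neg_eigs]) (auto intro!: eq_matI)

text \<open>The same congruence, read as an identity of Hermitian forms in the new coordinates
  \<open>X\<close> and \<open>Y\<close>. Subadditivity uses the coordinates, superadditivity their
  inverse \<open>lift\<close>.\<close>

lemma nneg_hankel_step:
  assumes sr: "schur_rel t d \<epsilon> p u" and len: "2 * k + 1 \<le> length t" and dk: "d \<le> Suc k"
  shows "nneg (Suc k) (hank t) = nneg d (bezout_coeff (Polynomial.smult \<epsilon> p)) + nneg (Suc k - d) (hank u)"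
proof -
  have d: "d \<ge> 1" "t ! (d - 1) = \<epsilon>" "\<epsilon> = 1 \<or> \<epsilon> = -1" "degree p = d" "lead_coeff p = 1"
    using sr unfolding schur_rel_def by blast+
  define q where "q = Polynomial.smult \<epsilon> p"
  define Lc where "Lc a i = complex_of_real (hankel_L t d a i)" for a i
  \<comment> \<open>The block of \<open>hankel_D\<close> is ordered by decreasing powers and
    \<open>bezout_coeff\<close> by increasing ones, hence the reversal
    \<open>d - 1 - r\<close>.\<close>
  define Xc where "Xc r a = Lc a (d - 1 - r)" for r a
  define Yc where "Yc r a = Lc a (d + r)" for r a
  define X where "X v r = (\<Sum>a<Suc k. Xc r a * v a)" for v r
  define Y where "Y v r = (\<Sum>a<Suc k. Yc r a * v a)" for v r
  have sk: "Suc k = d + (Suc k - d)" using dk by simp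
  have rev: "(\<Sum>i<d. f i) = (\<Sum>r<d. f (d - 1 - r))" for f :: "nat \<Rightarrow> complex"
    by (subst sum.nat_diff_reindex[symmetric]) simp
  have qf: "qf (Suc k) (hank t) v w = qf d (bezout_coeff q) (X v) (X w) + qf (Suc k - d) (hank u) (Y v) (Y w)" for v w
  proof -
    define Z where "Z v i = (\<Sum>a<Suc k. Lc a i * v a)" for v i
    have XZ: "X v r = Z v (d - 1 - r)" "Y v r = Z v (d + r)" for v r
      by (simp_all add: X_def Y_def Xc_def Yc_def Z_def)
    let ?D = "\<lambda>i j. complex_of_real (hankel_D q u d i j)"
    have "qf (Suc k) (hank t) v w = (\<Sum>a<Suc k. \<Sum>b<Suc k. \<Sum>i<Suc k. \<Sum>j<Suc k. (Lc a i * cnj (v a)) * ?D i j * (Lc b j * w b))"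
      unfolding qf_def
    proof (intro sum.cong refl)
      fix a b assume "a \<in> {..<Suc k}" "b \<in> {..<Suc k}"
      then have "hank t a b = (\<Sum>i<Suc k. \<Sum>j<Suc k. Lc a i * ?D i j * Lc b j)"
        using hankel_factorization[OF sr len, of a b] dk by (simp add: Lc_def q_def)
      then show "cnj (v a) * hank t a b * w b = (\<Sum>i<Suc k. \<Sum>j<Suc k. (Lc a i * cnj (v a)) * ?D i j * (Lc b j * w b))"
        by (simp add: sum_distrib_left sum_distrib_right mult_ac)
    qed
    also have "\<dots> = (\<Sum>a<Suc k. \<Sum>i<Suc k. \<Sum>b<Suc k. \<Sum>j<Suc k. (Lc a i * cnj (v a)) * ?D i j * (Lc b j * w b))"
      by (intro sum.cong refl sum.swap)
    also have "\<dots> = (\<Sum>a<Suc k. \<Sum>i<Suc k. \<Sum>j<Suc k. \<Sum>b<Suc k. (Lc a i * cnj (v a)) * ?D i j * (Lc b j * w b))"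
      by (intro sum.cong refl sum.swap)
    also have "\<dots> = (\<Sum>a<Suc k. \<Sum>i<Suc k. \<Sum>j<Suc k. (Lc a i * cnj (v a)) * ?D i j * Z w j)"
      unfolding Z_def sum_distrib_left ..
    also have "\<dots> = (\<Sum>i<Suc k. \<Sum>a<Suc k. \<Sum>j<Suc k. (Lc a i * cnj (v a)) * ?D i j * Z w j)"
      by (rule sum.swap)
    also have "\<dots> = (\<Sum>i<Suc k. \<Sum>j<Suc k. \<Sum>a<Suc k. (Lc a i * cnj (v a)) * ?D i j * Z w j)"
      by (intro sum.cong refl sum.swap)
    also have "\<dots> = (\<Sum>i<Suc k. \<Sum>j<Suc k. cnj (Z v i) * ?D i j * Z w j)"
      unfolding Z_def cnj_sum complex_cnj_mult sum_distrib_right Lc_def complex_cnj_complex_of_real ..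
    also have "\<dots> = (\<Sum>i<d. \<Sum>j<d. cnj (Z v i) * ?D i j * Z w j) + (\<Sum>i<d. \<Sum>j<Suc k - d. cnj (Z v i) * ?D i (d + j) * Z w (d + j))
      + ((\<Sum>i<Suc k - d. \<Sum>j<d. cnj (Z v (d + i)) * ?D (d + i) j * Z w j)
        + (\<Sum>i<Suc k - d. \<Sum>j<Suc k - d. cnj (Z v (d + i)) * ?D (d + i) (d + j) * Z w (d + j)))"
      by (subst (1 2) sk) (simp only: sum_lessThan_add sum.distrib add_ac)
    also have "(\<Sum>i<d. \<Sum>j<Suc k - d. cnj (Z v i) * ?D i (d + j) * Z w (d + j)) = 0"
      by (intro sum.neutral ballI) (simp add: hankel_D_def)
    also have "(\<Sum>i<Suc k - d. \<Sum>j<d. cnj (Z v (d + i)) * ?D (d + i) j * Z w j) = 0"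
      by (intro sum.neutral ballI) (simp add: hankel_D_def)
    also have "(\<Sum>i<Suc k - d. \<Sum>j<Suc k - d. cnj (Z v (d + i)) * ?D (d + i) (d + j) * Z w (d + j)) = qf (Suc k - d) (hank u) (Y v) (Y w)"
      unfolding qf_def XZ by (intro sum.cong refl) (simp add: hankel_D_def)
    also have "(\<Sum>i<d. \<Sum>j<d. cnj (Z v i) * ?D i j * Z w j) = qf d (bezout_coeff q) (X v) (X w)"
      unfolding qf_def XZ rev[of "\<lambda>i. \<Sum>j<d. cnj (Z v i) * ?D i j * Z w j"]
    proof (rule sum.cong[OF refl])
      fix r assume r: "r \<in> {..<d}"
      show "(\<Sum>j<d. cnj (Z v (d - 1 - r)) * ?D (d - 1 - r) j * Z w j)
         = (\<Sum>s<d. cnj (Z v (d - 1 - r)) * bezout_coeff q r s * Z w (d - 1 - s))"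
        unfolding rev[of "\<lambda>j. cnj (Z v (d - 1 - r)) * ?D (d - 1 - r) j * Z w j"]
      proof (intro sum.cong refl)
        fix s assume s: "s \<in> {..<d}"
        have "2 * d - 1 - (d - 1 - r) - (d - 1 - s) = r + s + 1" using r s by auto
        then show "cnj (Z v (d - 1 - r)) * ?D (d - 1 - r) (d - 1 - s) * Z w (d - 1 - s) = cnj (Z v (d - 1 - r)) * bezout_coeff q r s * Z w (d - 1 - s)"
          using r s by (simp add: hankel_D_def bezout_coeff_def)
      qed
    qed
    finally show ?thesis by simp
  qed
  define M where "M = Matrix.mat (Suc k) (Suc k) (\<lambda>(i, a). Lc a i)"
  have M: "M \<in> carrier_mat (Suc k) (Suc k)" by (simp add: M_def)
  have "transpose_mat M = map_mat complex_of_real (Matrix.mat (Suc k) (Suc k) (\<lambda>(a, i). hankel_L t d a i))"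
    by (rule eq_matI) (auto simp: M_def Lc_def)
  then have "Determinant.det M = of_real (Determinant.det (Matrix.mat (Suc k) (Suc k) (\<lambda>(a, i). hankel_L t d a i)))"
    using Determinant.det_transpose[OF M] by (simp add: of_real_hom.hom_det)
  then have "Determinant.det M \<noteq> 0" unfolding hankel_L_lower[OF d(1)] using d by auto
  then obtain Mi where Mi: "Mi \<in> carrier_mat (Suc k) (Suc k)" "M * Mi = 1\<^sub>m (Suc k)"
    using det_nonzero_right_inverse[OF M] by blast
  define lift where "lift b c a = (\<Sum>i<Suc k. Mi $$ (a, i) * (if i < d then b (d - 1 - i) else c (i - d)))" for b c a
  have lift: "(\<Sum>a<Suc k. Lc a i * lift b c a) = (if i < d then b (d - 1 - i) else c (i - d))" if i: "i < Suc k" for i b c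
  proof -
    have "(\<Sum>a<Suc k. Lc a i * lift b c a) = (\<Sum>a<Suc k. \<Sum>j<Suc k. (Lc a i * Mi $$ (a, j)) * (if j < d then b (d - 1 - j) else c (j - d)))"
      unfolding lift_def sum_distrib_left by (simp add: mult.assoc)
    also have "\<dots> = (\<Sum>j<Suc k. (\<Sum>a<Suc k. Lc a i * Mi $$ (a, j)) * (if j < d then b (d - 1 - j) else c (j - d)))"
      unfolding sum_distrib_right by (rule sum.swap)
    also have "\<dots> = (\<Sum>j<Suc k. if j = i then (if i < d then b (d - 1 - i) else c (i - d)) else 0)"
    proof (intro sum.cong refl)
      fix j assume j: "j \<in> {..<Suc k}"
      have "(M * Mi) $$ (i, j) = (\<Sum>a<Suc k. Lc a i * Mi $$ (a, j))"
        using i j by (subst index_mult_mat_sum[OF M Mi(1)]) (auto simp: M_def)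
      then have "(\<Sum>a<Suc k. Lc a i * Mi $$ (a, j)) = (if i = j then 1 else 0)"
        using i j by (simp add: Mi(2))
      then show "(\<Sum>a<Suc k. Lc a i * Mi $$ (a, j)) * (if j < d then b (d - 1 - j) else c (j - d))
        = (if j = i then (if i < d then b (d - 1 - i) else c (i - d)) else 0)" by simp
    qed
    finally show ?thesis using i by simp
  qed
  have lX: "X (lift b c) r = b r" if "r < d" for b c r
    unfolding X_def Xc_def using that dk by (subst lift) auto
  have lY: "Y (lift b c) r = c r" if "r < Suc k - d" for b c r
    unfolding Y_def Yc_def using that dk by (subst lift) auto
  show ?thesis
  proof (rule antisym)
    show "nneg (Suc k) (hank t) \<le> nneg d (bezout_coeff (Polynomial.smult \<epsilon> p)) + nneg (Suc k - d) (hank u)"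
      using qf unfolding X_def Y_def q_def[symmetric]
      by (intro nneg_subadditive[OF herm_hank herm_bezout_coeff herm_hank, where X = Xc and Y = Yc]) simp
    show "nneg d (bezout_coeff (Polynomial.smult \<epsilon> p)) + nneg (Suc k - d) (hank u) \<le> nneg (Suc k) (hank t)"
      unfolding q_def[symmetric]
    proof (rule nneg_superadditive[OF herm_hank herm_bezout_coeff herm_hank, where L = lift])
      fix b c b' c'
      show "qf (Suc k) (hank t) (lift b c) (lift b' c') = qf d (bezout_coeff q) b b' + qf (Suc k - d) (hank u) c c'"
        unfolding qf by (intro arg_cong2[where f = "(+)"] qf_cong) (simp_all add: lX lY)
    qed
  qed
qed

section \<open>The Toeplitz form of the algorithm\<close>

lemma toeplitz_mult_index:
  assumes "length c = n" "length e = n" "i < n" "j < n"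
  shows "(toeplitz c * toeplitz e) $$ (i, j) = (if i \<le> j then \<Sum>l\<le>j - i. c ! l * e ! (j - i - l) else 0)"
proof -
  have T: "toeplitz c \<in> carrier_mat n n" "toeplitz e \<in> carrier_mat n n" using assms by (simp_all add: toeplitz_def)
  have "(toeplitz c * toeplitz e) $$ (i, j) = (\<Sum>l<n. toeplitz c $$ (i, l) * toeplitz e $$ (l, j))"
    by (rule index_mult_mat_sum[OF T assms(3,4)])
  also have "\<dots> = (\<Sum>l<n. if i \<le> l \<and> l \<le> j then c ! (l - i) * e ! (j - l) else 0)"
    using assms by (intro sum.cong refl) (auto simp: toeplitz_def)
  also have "\<dots> = (if i \<le> j then \<Sum>l\<le>j - i. c ! l * e ! (j - i - l) else 0)"
  proof (cases "i \<le> j")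
    case True
    have "(\<Sum>l<n. if i \<le> l \<and> l \<le> j then c ! (l - i) * e ! (j - l) else 0) = (\<Sum>l\<in>{i..j}. c ! (l - i) * e ! (j - l))"
      using assms by (intro sum.mono_neutral_cong_right) auto
    also have "\<dots> = (\<Sum>l\<le>j - i. c ! l * e ! (j - i - l))"
      using True by (intro sum.reindex_bij_witness[of _ "\<lambda>l. l + i" "\<lambda>l. l - i"]) auto
    finally show ?thesis using True by simp
  qed (auto intro!: sum.neutral)
  finally show ?thesis .
qed

text \<open>The product of two upper triangular Toeplitz matrices is again of this form, so the
  identity is decided by its first row.\<close>

lemma toeplitz_inverse_iff:
  assumes "length c = n" "length e = n"
  shows "toeplitz c * toeplitz e = \<epsilon> \<cdot>\<^sub>m 1\<^sub>m n \<longleftrightarrow>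
    (\<forall>k<n. (\<Sum>l\<le>k. c ! l * e ! (k - l)) = (if k = 0 then \<epsilon> else 0))"
proof
  assume eq: "toeplitz c * toeplitz e = \<epsilon> \<cdot>\<^sub>m 1\<^sub>m n"
  show "\<forall>k<n. (\<Sum>l\<le>k. c ! l * e ! (k - l)) = (if k = 0 then \<epsilon> else 0)"
  proof (intro allI impI)
    fix k assume "k < n"
    then show "(\<Sum>l\<le>k. c ! l * e ! (k - l)) = (if k = 0 then \<epsilon> else 0)"
      using toeplitz_mult_index[OF assms, of 0 k] unfolding eq by auto
  qed
next
  assume *: "\<forall>k<n. (\<Sum>l\<le>k. c ! l * e ! (k - l)) = (if k = 0 then \<epsilon> else 0)"
  show "toeplitz c * toeplitz e = \<epsilon> \<cdot>\<^sub>m 1\<^sub>m n"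
  proof (rule eq_matI)
    fix i j assume "i < dim_row (\<epsilon> \<cdot>\<^sub>m 1\<^sub>m n)" "j < dim_col (\<epsilon> \<cdot>\<^sub>m 1\<^sub>m n)"
    then have ij: "i < n" "j < n" by auto
    then show "(toeplitz c * toeplitz e) $$ (i, j) = (\<epsilon> \<cdot>\<^sub>m 1\<^sub>m n) $$ (i, j)"
      unfolding toeplitz_mult_index[OF assms ij] using *[rule_format, of "j - i"] by auto
  qed (use assms in \<open>auto simp: toeplitz_def\<close>)
qed

lemma schur_list_nth:
  assumes "i < d + 1 + length u"
  shows "(map (coeff p) (rev [0..<d + 1]) @ map (\<lambda>x. - \<epsilon> * x) u) ! i = E_coeff d p \<epsilon> u i"
  using assms by (auto simp: nth_append rev_nth E_coeff_def simp del: upt_Suc)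

lemma schur_pair_condition_iff:
  assumes "d \<ge> 1" "2 * d \<le> length t" "\<And>i. i < d - 1 \<Longrightarrow> t ! i = 0" "t ! (d - 1) = 1 \<or> t ! (d - 1) = -1"
  defines "\<epsilon> \<equiv> t ! (d - 1)"
  shows "degree p = d \<and> lead_coeff p = 1 \<and> length u = length t - 2 * d \<and>
       toeplitz (drop (d - 1) t) * toeplitz (map (coeff p) (rev [0..<d + 1]) @ map (\<lambda>x. - \<epsilon> * x) u)
       = \<epsilon> \<cdot>\<^sub>m 1\<^sub>m (length t + 1 - d) \<longleftrightarrow> schur_rel t d \<epsilon> p u" (is "?P \<longleftrightarrow> _")
proof (cases "length u = length t - 2 * d")
  case True
  let ?e = "map (coeff p) (rev [0..<d + 1]) @ map (\<lambda>x. - \<epsilon> * x) u"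
  have l: "length (drop (d - 1) t) = length t + 1 - d" "length ?e = length t + 1 - d"
    using assms True by auto
  have "toeplitz (drop (d - 1) t) * toeplitz ?e = \<epsilon> \<cdot>\<^sub>m 1\<^sub>m (length t + 1 - d) \<longleftrightarrow>
    (\<forall>k\<le>length t - d. (\<Sum>i\<le>k. t ! (d - 1 + i) * E_coeff d p \<epsilon> u (k - i)) = (if k = 0 then \<epsilon> else 0))"
    unfolding toeplitz_inverse_iff[OF l]
  proof (intro iffI allI impI)
    have eq: "(\<Sum>i\<le>k. drop (d - 1) t ! i * ?e ! (k - i)) = (\<Sum>i\<le>k. t ! (d - 1 + i) * E_coeff d p \<epsilon> u (k - i))"
      if "k < length t + 1 - d" for k
    proof (rule sum.cong[OF refl], rule arg_cong2[where f = "(*)"])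
      fix i assume i: "i \<in> {..k}"
      show "drop (d - 1) t ! i = t ! (d - 1 + i)" using that i assms(1,2) by simp
      show "?e ! (k - i) = E_coeff d p \<epsilon> u (k - i)"
        by (rule schur_list_nth) (use that True assms(1,2) in simp)
    qed
    {
      fix k assume "\<forall>k<length t + 1 - d. (\<Sum>i\<le>k. drop (d - 1) t ! i * ?e ! (k - i)) = (if k = 0 then \<epsilon> else 0)" "k \<le> length t - d"
      then show "(\<Sum>i\<le>k. t ! (d - 1 + i) * E_coeff d p \<epsilon> u (k - i)) = (if k = 0 then \<epsilon> else 0)"
        using eq[of k] assms by simp
    }
    {
      fix k assume "\<forall>k\<le>length t - d. (\<Sum>i\<le>k. t ! (d - 1 + i) * E_coeff d p \<epsilon> u (k - i)) = (if k = 0 then \<epsilon> else 0)" "k < length t + 1 - d"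
      then show "(\<Sum>i\<le>k. drop (d - 1) t ! i * ?e ! (k - i)) = (if k = 0 then \<epsilon> else 0)"
        using eq[of k] assms by simp
    }
  qed
  then show ?thesis unfolding schur_rel_def using assms True by auto
qed (auto simp: schur_rel_def)

text \<open>The equations are triangular with leading coefficient \<open>\<epsilon>\<close> and
  determine the coefficients of \<open>E_coeff\<close> up to index \<open>length t - d\<close>. With
  \<open>2 * d \<le> length t\<close> this range covers all of \<open>p\<close>, including its
  constant coefficient, and all of \<open>u\<close>.\<close>

lemma schur_rel_unique:
  assumes "schur_rel t d \<epsilon> p u" "schur_rel t d \<epsilon> p' u'" "2 * d \<le> length t"
  shows "p = p' \<and> u = u'"
proof -
  have d: "d \<ge> 1" "length u = length t - 2 * d" "length u' = length t - 2 * d" "t ! (d - 1) = \<epsilon>"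
    "degree p = d" "degree p' = d" and eps: "\<epsilon> \<noteq> 0"
    using assms unfolding schur_rel_def by auto
  define E where "E = E_coeff d p \<epsilon> u"
  define E' where "E' = E_coeff d p' \<epsilon> u'"
  have cE: "(\<Sum>i\<le>k. t ! (d - 1 + i) * E (k - i)) = (if k = 0 then \<epsilon> else 0)"
    "(\<Sum>i\<le>k. t ! (d - 1 + i) * E' (k - i)) = (if k = 0 then \<epsilon> else 0)" if "k \<le> length t - d" for k
    using assms that unfolding schur_rel_def E_def E'_def by blast+
  have EE: "E k = E' k" if "k \<le> length t - d" for k
    using that
  proof (induction k rule: less_induct)
    case (less k)
    have "(\<Sum>i\<le>k. t ! (d - 1 + i) * (E (k - i) - E' (k - i))) = 0"
      using cE[OF less.prems] by (simp add: right_diff_distrib sum_subtractf)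
    also have "(\<Sum>i\<le>k. t ! (d - 1 + i) * (E (k - i) - E' (k - i))) = (\<Sum>i\<le>k. if i = 0 then \<epsilon> * (E k - E' k) else 0)"
    proof (intro sum.cong refl)
      fix i assume i: "i \<in> {..k}"
      show "t ! (d - 1 + i) * (E (k - i) - E' (k - i)) = (if i = 0 then \<epsilon> * (E k - E' k) else 0)"
      proof (cases "i = 0")
        case False
        then have "E (k - i) = E' (k - i)" using i less.prems by (intro less.IH) auto
        then show ?thesis using False by simp
      qed (use d(4) in simp)
    qed
    finally show ?case using eps by (simp add: sum.delta)
  qed
  have "coeff p i = coeff p' i" for i
  proof (cases "i \<le> d")
    case True
    then show ?thesis using EE[of "d - i"] assms(3) by (simp add: E_def E'_def E_coeff_def)
  next
    case False
    then show ?thesis using d by (simp add: coeff_eq_0)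
  qed
  moreover have "u ! i = u' ! i" if "i < length u" for i
    using EE[of "d + 1 + i"] that d assms(3) eps by (simp add: E_def E'_def E_coeff_def)
  ultimately show ?thesis using d by (auto intro: poly_eqI nth_equalityI)
qed

text \<open>The coefficients are those of the power series \<open>\<epsilon> / C\<close>: the first
  \<open>d + 1\<close> of them, reversed, form \<open>p\<close>, and the following ones give
  \<open>u\<close>.\<close>

lemma schur_rel_exists:
  assumes "d \<ge> 1" "2 * d \<le> length t" "\<And>i. i < d - 1 \<Longrightarrow> t ! i = 0" "t ! (d - 1) = \<epsilon>" "\<epsilon> = 1 \<or> \<epsilon> = -1"
  shows "\<exists>p u. schur_rel t d \<epsilon> p u"
proof -
  \<comment> \<open>Entries past the end of the list are unspecified reals; they enter only
    coefficients beyond index \<open>length t - d\<close>, which are not read off.\<close>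
  define C where "C = Abs_fps (\<lambda>i. t ! (d - 1 + i))"
  define E where "E = fps_nth (fps_const \<epsilon> * inverse C)"
  have C0: "fps_nth C 0 = \<epsilon>" "fps_nth C 0 \<noteq> 0" using assms by (auto simp: C_def)
  have E0: "E 0 = 1" using C0 assms(5) by (auto simp: E_def)
  have CE: "(\<Sum>i\<le>k. t ! (d - 1 + i) * E (k - i)) = (if k = 0 then \<epsilon> else 0)" for k
  proof -
    have "C * (fps_const \<epsilon> * inverse C) = fps_const \<epsilon> * (inverse C * C)" by (simp add: mult_ac)
    also have "\<dots> = fps_const \<epsilon>" using inverse_mult_eq_1[OF C0(2)] by simp
    finally have "fps_nth (C * (fps_const \<epsilon> * inverse C)) k = fps_nth (fps_const \<epsilon>) k"
      by (rule arg_cong)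
    then show ?thesis unfolding fps_mult_nth[of C] E_def by (simp add: C_def atMost_atLeast0)
  qed
  define p where "p = (\<Sum>i\<le>d. Polynomial.monom (E (d - i)) i)"
  define u where "u = map (\<lambda>i. - \<epsilon> * E (d + 1 + i)) [0..<length t - 2 * d]"
  have cp: "coeff p i = (if i \<le> d then E (d - i) else 0)" for i
    unfolding p_def by (simp add: coeff_sum)
  have deg: "degree p = d"
    by (rule antisym) (auto simp: cp E0 intro!: degree_le le_degree)
  have Ec: "E_coeff d p \<epsilon> u k = E k" if "k \<le> length t - d" for k
    using that assms by (auto simp: E_coeff_def cp u_def)
  have "schur_rel t d \<epsilon> p u"
    unfolding schur_rel_def
  proof (intro conjI allI impI)
    fix k assume k: "k \<le> length t - d"
    have "(\<Sum>i\<le>k. t ! (d - 1 + i) * E_coeff d p \<epsilon> u (k - i)) = (\<Sum>i\<le>k. t ! (d - 1 + i) * E (k - i))"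
      using k by (intro sum.cong refl) (simp add: Ec)
    then show "(\<Sum>i\<le>k. t ! (d - 1 + i) * E_coeff d p \<epsilon> u (k - i)) = (if k = 0 then \<epsilon> else 0)" using CE by simp
  qed (use assms deg in \<open>auto simp: cp E0 u_def\<close>)
  then show ?thesis by blast
qed

text \<open>Existence and uniqueness together give meaning to the definite description in
  \<open>schur_pair\<close>.\<close>

lemma schur_pair_rel:
  assumes "d \<ge> 1" "2 * d \<le> length t" "\<And>i. i < d - 1 \<Longrightarrow> t ! i = 0" "t ! (d - 1) = 1 \<or> t ! (d - 1) = -1"
  shows "schur_rel t d (t ! (d - 1)) (fst (schur_pair t d)) (snd (schur_pair t d))"
proof -
  have iff: "degree p = d \<and> lead_coeff p = 1 \<and> length u = length t - 2 * d \<and>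
       toeplitz (drop (d - 1) t) * toeplitz (map (coeff p) (rev [0..<d + 1]) @ map (\<lambda>x. - (t ! (d - 1)) * x) u)
       = (t ! (d - 1)) \<cdot>\<^sub>m 1\<^sub>m (length t + 1 - d) \<longleftrightarrow> schur_rel t d (t ! (d - 1)) p u" for p u
    using schur_pair_condition_iff[OF assms] .
  have pair: "schur_pair t d = (THE (p, u). schur_rel t d (t ! (d - 1)) p u)"
    unfolding schur_pair_def Let_def iff ..
  obtain p u where pu: "schur_rel t d (t ! (d - 1)) p u"
    using schur_rel_exists[OF assms(1-3) refl assms(4)] by blast
  have "schur_pair t d = (p, u)"
    unfolding pair
  proof (rule the_equality)
    fix x assume "case x of (p, u) \<Rightarrow> schur_rel t d (t ! (d - 1)) p u"
    then show "x = (p, u)" using schur_rel_unique[OF _ pu assms(2)] by (cases x) auto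
  qed (use pu in simp)
  then show ?thesis using pu by simp
qed

section \<open>The polynomial of the last step\<close>

lemma det_const_poly_mat:
  fixes A :: "'a::comm_ring_1 Matrix.mat"
  shows "Determinant.det (map_mat (\<lambda>a. [:a:]) A) = [:Determinant.det A:]"
proof -
  interpret comm_ring_hom "\<lambda>a::'a. [:a:]" by unfold_locales (auto simp: one_pCons)
  show ?thesis by (rule hom_det)
qed

text \<open>
  The last step is an ordinary one with nothing left over; for even \<open>\<ell>\<close> the free number \<open>x\<close> affects
  only the constant coefficient of \<open>p\<close>, which the relation does not constrain.
\<close>

lemma last_poly_rel:
  assumes "length t = 2 * d \<or> length t + 1 = 2 * d" "d \<ge> 1"
    and "\<And>i. i < d - 1 \<Longrightarrow> t ! i = 0" "t ! (d - 1) = \<epsilon>" "\<epsilon> = 1 \<or> \<epsilon> = -1"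
  shows "schur_rel t d \<epsilon> (last_poly t (d - 1) x) []"
proof -
  \<comment> \<open>Completing the sequence by \<open>x\<close> to even length when necessary makes
    the existence lemma determine a full monic polynomial.\<close>
  define t2 where "t2 = (if length t = 2 * d then t else t @ [x])"
  have t2: "length t2 = 2 * d" using assms(1) by (auto simp: t2_def)
  have t2_nth: "t2 ! i = t ! i" if "i < length t" for i using that by (auto simp: t2_def nth_append)
  have tx: "(t @ [x]) ! i = t2 ! i" if "i < 2 * d" for i using that assms(1) by (auto simp: t2_def nth_append)
  have lt: "2 * d - 1 \<le> length t" using assms(1) by auto
  obtain p u where pu: "schur_rel t2 d \<epsilon> p u"
    using schur_rel_exists[of d t2 \<epsilon>] assms t2 t2_nth lt by auto
  have u: "u = []" using pu t2 by (simp add: schur_rel_def)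
  have p: "degree p = d" "coeff p d = 1" using pu by (auto simp: schur_rel_def)
  have conv: "(\<Sum>i\<le>k. t2 ! (d - 1 + i) * coeff p (d - (k - i))) = (if k = 0 then \<epsilon> else 0)" if "k \<le> d" for k
  proof -
    have "(\<Sum>i\<le>k. t2 ! (d - 1 + i) * E_coeff d p \<epsilon> u (k - i)) = (if k = 0 then \<epsilon> else 0)"
      using pu that t2 unfolding schur_rel_def by auto
    moreover have "(\<Sum>i\<le>k. t2 ! (d - 1 + i) * E_coeff d p \<epsilon> u (k - i)) = (\<Sum>i\<le>k. t2 ! (d - 1 + i) * coeff p (d - (k - i)))"
      using that by (intro sum.cong refl) (auto simp: E_coeff_def)
    ultimately show ?thesis by simp
  qed
  \<comment> \<open>The convolution equations of index 1 to \<open>d\<close>, read as orthogonality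
    of \<open>p\<close> to the powers below \<open>d\<close> under the functional with moments
    \<open>t2\<close>.\<close>
  have orth: "(\<Sum>k<d + 1. t2 ! (i + k) * coeff p k) = 0" if i: "i < d" for i
  proof -
    have "(\<Sum>k<d + 1. t2 ! (i + k) * coeff p k) = (\<Sum>k\<in>{d - 1 - i..d}. t2 ! (i + k) * coeff p k)"
    proof (rule sum.mono_neutral_right)
      show "\<forall>k\<in>{..<d + 1} - {d - 1 - i..d}. t2 ! (i + k) * coeff p k = 0"
      proof
        fix k assume "k \<in> {..<d + 1} - {d - 1 - i..d}"
        then have "i + k < d - 1" by auto
        then show "t2 ! (i + k) * coeff p k = 0" using assms(3)[of "i + k"] t2_nth[of "i + k"] lt by simp
      qed
    qed auto
    also have "\<dots> = (\<Sum>j\<le>i + 1. t2 ! (d - 1 + j) * coeff p (d - (i + 1 - j)))"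
      using i by (intro sum.reindex_bij_witness[of _ "\<lambda>j. d + j - (i + 1)" "\<lambda>k. k + i + 1 - d"]) (auto simp: add.commute[of _ i])
    also have "\<dots> = 0" using conv[of "i + 1"] i by simp
    finally show ?thesis .
  qed
  define H where "H = hankel t (d - 1)"
  have H: "H \<in> carrier_mat d d" using hankel_carrier[of t "d - 1"] assms(2) by (simp add: H_def)
  have detH: "Determinant.det H \<noteq> 0"
    unfolding H_def using assms by (intro det_hankel_leading_zeros(2)) auto
  define A where "A = Matrix.mat (d + 1) (d + 1) (\<lambda>(i, k). if i \<le> d - 1 then [:(t @ [x]) ! (i + k):] else Polynomial.monom 1 k)"
  have A: "A \<in> carrier_mat (d + 1) (d + 1)" by (simp add: A_def)
  \<comment> \<open>A column operation that replaces the last column of \<open>A\<close> by its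
    combination with the coefficients of \<open>p\<close>. By orthogonality only the bottom entry
    \<open>p\<close> remains there, and \<open>U\<close> has determinant 1 because \<open>p\<close>
    is monic.\<close>
  define U where "U = Matrix.mat (d + 1) (d + 1) (\<lambda>(i, j). if j = d then [:coeff p i:] else if i = j then 1 else 0)"
  have U: "U \<in> carrier_mat (d + 1) (d + 1)" by (simp add: U_def)
  have detU: "Determinant.det U = 1"
  proof -
    have "Determinant.det U = prod_list (diag_mat U)"
      using U by (intro det_upper_triangular[of _ "d + 1"]) (auto simp: U_def upper_triangular_def)
    also have "diag_mat U = replicate (d + 1) 1"
      by (rule nth_equalityI) (auto simp: diag_mat_def U_def p one_pCons less_Suc_eq simp del: upt_Suc replicate_Suc)
    finally show ?thesis by simp
  qed
  define R where "R = Matrix.mat 1 d (\<lambda>(i, k). Polynomial.monom (1::real) k)"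
  have AU: "A * U = four_block_mat (map_mat (\<lambda>a. [:a:]) H) (0\<^sub>m d 1) R (Matrix.mat 1 1 (\<lambda>_. p))"
  proof (rule eq_matI)
    fix i j assume "i < dim_row (four_block_mat (map_mat (\<lambda>a. [:a:]) H) (0\<^sub>m d 1) R (Matrix.mat 1 1 (\<lambda>_. p)))"
      "j < dim_col (four_block_mat (map_mat (\<lambda>a. [:a:]) H) (0\<^sub>m d 1) R (Matrix.mat 1 1 (\<lambda>_. p)))"
    then have ij: "i < d + 1" "j < d + 1" using H by auto
    have AUij: "(A * U) $$ (i, j) = (\<Sum>k<d + 1. A $$ (i, k) * U $$ (k, j))"
      by (rule index_mult_mat_sum[OF A U ij])
    show "(A * U) $$ (i, j) = four_block_mat (map_mat (\<lambda>a. [:a:]) H) (0\<^sub>m d 1) R (Matrix.mat 1 1 (\<lambda>_. p)) $$ (i, j)"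
    proof (cases "j < d")
      case True
      have "(A * U) $$ (i, j) = (\<Sum>k<d + 1. if k = j then A $$ (i, j) else 0)"
        unfolding AUij using ij True by (intro sum.cong refl) (auto simp: U_def)
      then have "(A * U) $$ (i, j) = A $$ (i, j)" using ij by (simp add: sum.delta del: index_mult_mat(1))
      then show ?thesis using ij True H lt tx[of "i + j"] t2_nth[of "i + j"] assms(2)
        by (auto simp: A_def R_def H_def hankel_def simp del: index_mult_mat(1))
    next
      case False
      then have j: "j = d" using ij by simp
      have e: "(A * U) $$ (i, j) = (\<Sum>k<d + 1. A $$ (i, k) * [:coeff p k:])"
        unfolding AUij[unfolded j] j by (intro sum.cong refl) (auto simp: U_def)
      show ?thesis
      proof (cases "i < d")
        case True
        have "(\<Sum>k<d + 1. A $$ (i, k) * [:coeff p k:]) = (\<Sum>k<d + 1. [:t2 ! (i + k) * coeff p k:])"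
          using True tx by (intro sum.cong refl) (auto simp: A_def)
        also have "\<dots> = [:\<Sum>k<d + 1. t2 ! (i + k) * coeff p k:]"
          by (rule poly_eqI) (simp add: coeff_sum coeff_pCons split: nat.split)
        also have "\<dots> = 0" using orth[OF True] by simp
        finally show ?thesis using e True j H by simp
      next
        case False
        then have i: "i = d" using ij by simp
        have "(\<Sum>k<d + 1. A $$ (i, k) * [:coeff p k:]) = (\<Sum>k<d + 1. Polynomial.monom (coeff p k) k)"
          using assms(2) i by (intro sum.cong refl) (auto simp: A_def smult_monom mult.commute[of _ "[:_:]"])
        also have "\<dots> = p"
          unfolding Suc_eq_plus1[symmetric] lessThan_Suc_atMost p(1)[symmetric] by (rule poly_as_sum_of_monoms)
        finally show ?thesis using e i j H by simp
      qed
    qed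
  qed (use A U H in \<open>auto simp: R_def\<close>)
  have "Determinant.det A = Determinant.det (A * U)"
    using Determinant.det_mult[OF A U] detU by simp
  also have "\<dots> = Determinant.det (map_mat (\<lambda>a. [:a:]) H) * Determinant.det (Matrix.mat 1 1 (\<lambda>_. p))"
    unfolding AU using H by (intro det_four_block_mat_upper_right_zero_col) (auto simp: R_def)
  also have "\<dots> = Polynomial.smult (Determinant.det H) p"
    unfolding det_const_poly_mat by (simp add: det_single)
  finally have "last_poly t (d - 1) x = p"
    unfolding last_poly_def H_def[symmetric] using detH assms(2) by (simp add: A_def)
  moreover have "schur_rel t d \<epsilon> p []"
    unfolding schur_rel_def
  proof (intro conjI allI impI)
    fix k assume k: "k \<le> length t - d"
    have "(\<Sum>i\<le>k. t ! (d - 1 + i) * E_coeff d p \<epsilon> [] (k - i)) = (\<Sum>i\<le>k. t2 ! (d - 1 + i) * coeff p (d - (k - i)))"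
      using k assms(1,2) by (intro sum.cong refl) (auto simp: E_coeff_def t2_nth)
    then show "(\<Sum>i\<le>k. t ! (d - 1 + i) * E_coeff d p \<epsilon> [] (k - i)) = (if k = 0 then \<epsilon> else 0)"
      using conv[of k] k assms(1) by auto
  qed (use assms p in auto)
  ultimately show ?thesis by simp
qed

section \<open>Linear fractional transformations\<close>

lemma normalizedE:
  assumes "normalized t"
  obtains d where "d \<ge> 1" "d \<le> length t" "\<And>i. i < d - 1 \<Longrightarrow> t ! i = 0" "t ! (d - 1) = 1 \<or> t ! (d - 1) = -1"
proof -
  obtain k where k: "k < length t" "\<bar>t ! k\<bar> = 1" "\<forall>i<k. t ! i = 0"
    using assms by (auto simp: normalized_def)
  then have "t ! k = 1 \<or> t ! k = -1" by linarith
  then show ?thesis using k by (intro that[of "Suc k"]) auto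
qed

text \<open>Scaling does not move the first nonzero entry \<open>u ! k\<close>, so normalization
  means \<open>a\<^sup>2 = \<bar>u ! k\<bar>\<close>, which has exactly one positive
  solution.\<close>

lemma schur_scale_props:
  assumes "i < length u" "u ! i \<noteq> 0"
  shows "schur_scale u > 0" "normalized (map (\<lambda>x. x / (schur_scale u)\<^sup>2) u)"
proof -
  define k where "k = (LEAST i. i < length u \<and> u ! i \<noteq> 0)"
  have k: "k < length u" "u ! k \<noteq> 0"
    using LeastI[of "\<lambda>i. i < length u \<and> u ! i \<noteq> 0" i] assms unfolding k_def by auto
  have z: "u ! j = 0" if "j < k" for j
    using not_less_Least[OF that[unfolded k_def]] that k(1) by auto
  have nk: "normalized (map (\<lambda>x. x / b\<^sup>2) u) \<longleftrightarrow> \<bar>u ! k\<bar> = b\<^sup>2" if "b > 0" for b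
  proof
    assume "normalized (map (\<lambda>x. x / b\<^sup>2) u)"
    then obtain j where j: "j < length u" "\<bar>u ! j / b\<^sup>2\<bar> = 1" "\<forall>i<j. u ! i / b\<^sup>2 = 0"
      by (auto simp: normalized_def)
    have "j = k"
    proof (rule antisym)
      show "j \<le> k" using j(3) k(2) that by (metis divide_eq_0_iff less_irrefl not_less power_not_zero)
      show "k \<le> j" using j(2) z by (metis abs_zero div_0 not_less zero_neq_one)
    qed
    then show "\<bar>u ! k\<bar> = b\<^sup>2" using j(2) that by (simp add: abs_divide)
  next
    assume "\<bar>u ! k\<bar> = b\<^sup>2"
    then show "normalized (map (\<lambda>x. x / b\<^sup>2) u)"
      unfolding normalized_def using k z that by (intro exI[of _ k]) (auto simp: abs_divide)
  qed
  have "schur_scale u = sqrt \<bar>u ! k\<bar>"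
    unfolding schur_scale_def
  proof (rule the_equality)
    show "sqrt \<bar>u ! k\<bar> > 0 \<and> normalized (map (\<lambda>x. x / (sqrt \<bar>u ! k\<bar>)\<^sup>2) u)"
      using k(2) by (subst nk) auto
    fix a assume "a > 0 \<and> normalized (map (\<lambda>x. x / a\<^sup>2) u)"
    then show "a = sqrt \<bar>u ! k\<bar>" using nk[of a] by simp
  qed
  then show "schur_scale u > 0" "normalized (map (\<lambda>x. x / (schur_scale u)\<^sup>2) u)"
    using k(2) nk[of "sqrt \<bar>u ! k\<bar>"] by auto
qed

lemma nneg_cong: "(\<And>i j. i < n \<Longrightarrow> j < n \<Longrightarrow> A i j = A' i j) \<Longrightarrow> nneg n A = nneg n A'"
  unfolding nneg_def by (intro arg_cong[where f = neg_eigs] eq_matI) auto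

lemma herm_scale: "herm n A \<Longrightarrow> herm n (\<lambda>i j. of_real c * A i j)"
  unfolding herm_def
proof (intro allI impI)
  fix i j assume "\<forall>i<n. \<forall>j<n. A j i = cnj (A i j)" "i < n" "j < n"
  then have "A j i = cnj (A i j)" by blast
  then show "of_real c * A j i = cnj (of_real c * A i j)" by simp
qed

lemma nneg_scale_le:
  assumes "herm n A" "c > 0"
  shows "nneg n (\<lambda>i j. of_real c * A i j) \<le> nneg n A"
proof -
  note h = herm_scale[OF assms(1), of c]
  obtain V where V: "\<And>a b. a < nneg n (\<lambda>i j. of_real c * A i j) \<Longrightarrow> b < nneg n (\<lambda>i j. of_real c * A i j) \<Longrightarrow>
    qf n (\<lambda>i j. of_real c * A i j) (V a) (V b) = (if a = b then -1 else 0)" using nneg_vectors[OF h] by blast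
  have "qf n A (\<lambda>i. of_real (sqrt c) * V a i) (\<lambda>i. of_real (sqrt c) * V b i) = qf n (\<lambda>i j. of_real c * A i j) (V a) (V b)" for a b
  proof -
    have "complex_of_real (sqrt c) * of_real (sqrt c) = of_real c" using assms(2) by (simp flip: of_real_mult)
    moreover have "cnj (complex_of_real (sqrt c) * v) * w * (of_real (sqrt c) * v')
        = cnj v * ((complex_of_real (sqrt c) * of_real (sqrt c)) * w) * v'" for v w v'
      by (simp only: complex_cnj_mult complex_cnj_complex_of_real mult_ac)
    ultimately show ?thesis unfolding qf_def by (simp only:)
  qed
  then show ?thesis using V by (intro nneg_geI[OF assms(1), where V = "\<lambda>a i. of_real (sqrt c) * V a i"]) auto
qed

lemma nneg_scale:
  assumes "herm n A" "c > 0"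
  shows "nneg n (\<lambda>i j. of_real c * A i j) = nneg n A"
proof (rule antisym)
  note h = herm_scale[OF assms(1), of c]
  show "nneg n A \<le> nneg n (\<lambda>i j. of_real c * A i j)"
    using nneg_scale_le[OF h, of "1 / c"] assms(2) by simp
qed (rule nneg_scale_le[OF assms])

lemma nneg_0: "nneg 0 A = 0"
  using nneg_le[of 0 A] by (simp add: herm_def)

section \<open>One step for classes of solutions\<close>

text \<open>\<open>z ^ d * \<phi> z\<close> tends to \<open>- \<epsilon>\<close>, so
  \<open>\<phi>\<close> is not identically 0 and \<open>- 1 / \<phi>\<close> is meromorphic.\<close>

lemma step_phi_nonzero:
  assumes sr: "schur_rel t d \<epsilon> p u" and \<phi>: "expands (int (length t)) t \<phi>"
  shows "\<exists>z\<in>\<complex>\<^sub>+. \<phi> z \<noteq> 0"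
proof -
  obtain cP eP R where
    cP: "\<And>z. z \<noteq> 0 \<Longrightarrow> z ^ d * Pf t z = - poly cP (1 / z)" "poly cP 0 = of_real \<epsilon>"
    using schur_rel_asymptotics[OF sr] by metis
  have d: "d \<ge> 1" "2 * d \<le> length t + 1" "\<epsilon> = 1 \<or> \<epsilon> = -1" using sr by (auto simp: schur_rel_def)
  have one: "(0::real) < 1" by simp
  have "((\<lambda>z. z powi int d * (\<phi> z - Pf t z)) \<longlongrightarrow> 0) (nontang 1)"
    using expands_weaken[OF \<phi>, of "int d"] d by simp
  then have "((\<lambda>z. z powi int d * (\<phi> z - Pf t z) + - poly cP (1 / z)) \<longlongrightarrow> 0 + - poly cP 0) (nontang 1)"
    by (intro tendsto_intros poly_inverse_tendsto nontang_le_at_infinity)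
  then have "\<forall>\<^sub>F z in nontang 1. z powi int d * (\<phi> z - Pf t z) + - poly cP (1 / z) \<noteq> 0"
    by (rule tendsto_imp_eventually_ne) (use cP(2) d in auto)
  then have "\<forall>\<^sub>F z in nontang 1. Im z > 0 \<and> \<phi> z \<noteq> 0"
    using eventually_nontang_upper[OF one]
  proof eventually_elim
    case (elim z)
    then have "z \<noteq> 0" by auto
    then have "z powi int d * (\<phi> z - Pf t z) + - poly cP (1 / z) = z ^ d * \<phi> z"
      using cP(1)[of z] by (simp add: right_diff_distrib)
    then show ?case using elim by auto
  qed
  then show ?thesis using eventually_happens'[OF nontang_one_nonbot] by auto
qed

lemma step_forward:
  assumes sr: "schur_rel t d \<epsilon> p u" and a: "a > 0"
    and \<tau>: "\<tau> \<in> nev (\<kappa> - int (nneg d (bezout_coeff (Polynomial.smult \<epsilon> p))))"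
      "expands (int (length t) - 2 * int d) (map (\<lambda>x. x / a\<^sup>2) u) \<tau>"
  shows "\<exists>\<phi>\<in>nev \<kappa>. expands (int (length t)) t \<phi> \<and> step_rel (Polynomial.smult \<epsilon> p) a \<phi> \<tau>"
proof -
  have d: "d \<ge> 1" "2 * d \<le> length t + 1" "\<epsilon> = 1 \<or> \<epsilon> = -1" "degree p = d" using sr by (auto simp: schur_rel_def)
  then have dq: "degree (Polynomial.smult \<epsilon> p) = d" by auto
  have m: "\<tau> \<in> mero_sym" using \<tau>(1) by (simp add: nev_def)
  have small: "nt_small \<tau>" by (rule expands_imp_nt_small[OF \<tau>(2)]) (use d in linarith)
  have \<tau>0: "((\<lambda>z. \<tau> z / z) \<longlongrightarrow> 0) (nontang 1)" using small by (simp add: nt_small_def)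
  have one: "(0::real) < 1" by simp
  have "\<forall>\<^sub>F z in nontang 1. Im z > 0 \<and> \<tau> analytic_on {z} \<and> cpoly (Polynomial.smult \<epsilon> p) z + of_real (a\<^sup>2) * \<tau> z \<noteq> 0"
    using dq d(1)
    by (intro eventually_conj eventually_nontang_upper[OF one] eventually_nontang_analytic[OF m one \<tau>0]
      step_denominator_nonzero[OF nontang_le_at_infinity \<tau>0]) simp
  then obtain \<phi> where rel: "step_rel (Polynomial.smult \<epsilon> p) a \<phi> \<tau>"
    using step_rel_exists_forward[OF m] eventually_happens'[OF nontang_one_nonbot] by fastforce
  have a0: "a \<noteq> 0" using a by simp
  have "\<phi> \<in> nev \<kappa>" using step_nev[OF rel a0 small] \<tau>(1) dq d(1) by simp
  then show ?thesis using rel step_expands_backward[OF sr rel a0 \<tau>(2)] by blast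
qed

lemma step_backward:
  assumes sr: "schur_rel t d \<epsilon> p u" and a: "a > 0"
    and \<phi>: "\<phi> \<in> nev \<kappa>" "expands (int (length t)) t \<phi>"
  shows "\<exists>\<tau>\<in>nev (\<kappa> - int (nneg d (bezout_coeff (Polynomial.smult \<epsilon> p)))).
    expands (int (length t) - 2 * int d) (map (\<lambda>x. x / a\<^sup>2) u) \<tau> \<and> step_rel (Polynomial.smult \<epsilon> p) a \<phi> \<tau>"
proof -
  have d: "d \<ge> 1" "2 * d \<le> length t + 1" "\<epsilon> = 1 \<or> \<epsilon> = -1" "degree p = d" using sr by (auto simp: schur_rel_def)
  then have dq: "degree (Polynomial.smult \<epsilon> p) = d" by auto
  have m: "\<phi> \<in> mero_sym" using \<phi>(1) by (simp add: nev_def)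
  have a0: "a \<noteq> 0" using a by simp
  obtain \<tau> where rel: "step_rel (Polynomial.smult \<epsilon> p) a \<phi> \<tau>"
    using step_rel_exists_backward[OF m step_phi_nonzero[OF sr \<phi>(2)] a0] by blast
  have e: "expands (int (length t) - 2 * int d) (map (\<lambda>x. x / a\<^sup>2) u) \<tau>"
    by (rule step_expands_forward[OF sr rel a0 \<phi>(2)])
  have small: "nt_small \<tau>" by (rule expands_imp_nt_small[OF e]) (use d in linarith)
  have "\<tau> \<in> nev (\<kappa> - int (nneg d (bezout_coeff (Polynomial.smult \<epsilon> p))))"
    using step_nev[OF rel a0 small] \<phi>(1) dq d(1) by simp
  then show ?thesis using rel e by blast
qed

section \<open>From a relation to a parametrization\<close>

text \<open>The fraction is written without division and off a discrete set, so that it composes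
  along a product of matrices; the condition on the denominator is part of the relation.\<close>

definition lft_rel :: "(complex \<Rightarrow> complex Matrix.mat) \<Rightarrow> (complex \<Rightarrow> complex) \<Rightarrow> (complex \<Rightarrow> complex) \<Rightarrow> bool" where
  "lft_rel W \<tau> \<phi> \<longleftrightarrow> (\<forall>\<^sub>\<approx>z\<in>\<complex>\<^sub>+. lft_den W \<tau> z \<noteq> 0 \<and> W z $$ (0, 0) * \<tau> z + W z $$ (0, 1) = \<phi> z * lft_den W \<tau> z)"

lemma lft_rel_eq:
  assumes "\<phi> \<in> mero_sym" "lft_rel W \<tau> \<phi>"
  shows "lft W \<tau> = \<phi>" "lft_defined W \<tau>"
proof -
  show "lft_defined W \<tau>"
    using assms(2) unfolding lft_defined_def lft_rel_def by (rule eventually_mono) blast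
  have "\<forall>\<^sub>\<approx>z\<in>\<complex>\<^sub>+. (W z $$ (0, 0) * \<tau> z + W z $$ (0, 1)) / lft_den W \<tau> z = \<phi> z"
    using assms(2) unfolding lft_rel_def by (rule eventually_mono) auto
  then show "lft W \<tau> = \<phi>" unfolding lft_def by (rule sym_ext_eqI[OF assms(1)])
qed

text \<open>Cross-multiplying two equal fractions leaves the determinant times
  \<open>\<tau> z - \<tau>' z\<close>.\<close>

lemma lft_rel_inj:
  assumes "\<tau> \<in> mero_sym" "\<tau>' \<in> mero_sym" "lft_rel W \<tau> \<phi>" "lft_rel W \<tau>' \<phi>"
    and det: "\<And>z. W z $$ (0, 0) * W z $$ (1, 1) - W z $$ (0, 1) * W z $$ (1, 0) = 1"
  shows "\<tau> = \<tau>'"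
proof (rule mero_sym_eqI[OF assms(1,2)])
  show "\<forall>\<^sub>\<approx>z\<in>\<complex>\<^sub>+. \<tau> z = \<tau>' z"
    using assms(3,4) unfolding lft_rel_def
  proof eventually_elim
    case (elim z)
    define A B C D where "A = W z $$ (0, 0)" "B = W z $$ (0, 1)" "C = W z $$ (1, 0)" "D = W z $$ (1, 1)"
    have det': "A * D - B * C = 1" using det[of z] by (simp add: A_B_C_D_def)
    define e e' where "e = lft_den W \<tau> z" "e' = lft_den W \<tau>' z"
    have e: "e = C * \<tau> z + D" "e' = C * \<tau>' z + D" by (simp_all add: e_e'_def lft_den_def A_B_C_D_def)
    have n: "A * \<tau> z + B = \<phi> z * e" "A * \<tau>' z + B = \<phi> z * e'" "e \<noteq> 0"
      using elim by (simp_all add: A_B_C_D_def e_e'_def)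
    have "(A * \<tau> z + B) * e' = (A * \<tau>' z + B) * e" unfolding n(1,2) by simp
    then have "(A * \<tau> z + B) * (C * \<tau>' z + D) - (A * \<tau>' z + B) * (C * \<tau> z + D) = 0" unfolding e by simp
    then have "(A * D - B * C) * (\<tau> z - \<tau>' z) = 0" by (simp add: algebra_simps)
    then show ?case unfolding det' by simp
  qed
qed

text \<open>The last clause of the definition concerns arbitrary meromorphic \<open>\<tau>\<close>.
  If its image lies in \<open>A\<close>, some \<open>\<tau>'\<close> in \<open>B\<close> is related
  to the same function, and injectivity on all of \<open>mero_sym\<close> forces
  \<open>\<tau> = \<tau>'\<close>.\<close>

lemma parametrized_byI:
  assumes AB: "A \<subseteq> mero_sym" "B \<subseteq> mero_sym"
    and fwd: "\<And>\<tau>. \<tau> \<in> B \<Longrightarrow> \<exists>\<phi>\<in>A. lft_rel W \<tau> \<phi>"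
    and bwd: "\<And>\<phi>. \<phi> \<in> A \<Longrightarrow> \<exists>\<tau>\<in>B. lft_rel W \<tau> \<phi>"
    and det: "\<And>z. W z $$ (0, 0) * W z $$ (1, 1) - W z $$ (0, 1) * W z $$ (1, 0) = 1"
    and mero: "\<And>i j. i < 2 \<Longrightarrow> j < 2 \<Longrightarrow> (\<lambda>z. W z $$ (i, j)) meromorphic_on \<complex>\<^sub>+"
  shows "parametrized_by A W B"
proof -
  have B: "lft W \<tau> \<in> A \<and> lft_defined W \<tau> \<and> lft_rel W \<tau> (lft W \<tau>)" if \<tau>: "\<tau> \<in> B" for \<tau>
  proof -
    obtain \<phi> where \<phi>: "\<phi> \<in> A" "lft_rel W \<tau> \<phi>" using fwd[OF \<tau>] by blast
    then have "lft W \<tau> = \<phi>" "lft_defined W \<tau>" using lft_rel_eq[of \<phi> W \<tau>] AB by auto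
    then show ?thesis using \<phi> by simp
  qed
  have A: "\<exists>\<tau>\<in>B. lft W \<tau> = \<phi> \<and> lft_rel W \<tau> \<phi>" if "\<phi> \<in> A" for \<phi>
    using bwd[OF that] lft_rel_eq(1) AB(1) that by blast
  have inj: "inj_on (lft W) B"
  proof (rule inj_onI)
    fix \<tau> \<tau>' assume *: "\<tau> \<in> B" "\<tau>' \<in> B" "lft W \<tau> = lft W \<tau>'"
    then have "lft_rel W \<tau> (lft W \<tau>)" "lft_rel W \<tau>' (lft W \<tau>)" using B[OF *(1)] B[OF *(2)] by simp_all
    then show "\<tau> = \<tau>'"
      by (rule lft_rel_inj[OF subsetD[OF AB(2) *(1)] subsetD[OF AB(2) *(2)]]) (rule det)
  qed
  have "\<tau> \<in> B" if \<tau>: "\<tau> \<in> mero_sym" "lft_defined W \<tau>" "lft W \<tau> \<in> A" for \<tau>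
  proof -
    obtain \<tau>' where \<tau>': "\<tau>' \<in> B" "lft_rel W \<tau>' (lft W \<tau>)" using A[OF \<tau>(3)] by blast
    have m: "(\<lambda>z. (W z $$ (0, 0) * \<tau> z + W z $$ (0, 1)) / lft_den W \<tau> z) meromorphic_on \<complex>\<^sub>+"
      unfolding lft_den_def using mero mero_sym_meromorphic[OF \<tau>(1)] by (intro meromorphic_intros) auto
    have "lft_rel W \<tau> (lft W \<tau>)"
      unfolding lft_rel_def lft_def
      using sym_ext_cosparse[OF m] \<tau>(2)[unfolded lft_defined_def] by eventually_elim simp
    then have "\<tau> = \<tau>'" using lft_rel_inj[OF \<tau>(1) _ _ \<tau>'(2) det] \<tau>'(1) AB(2) by blast
    then show ?thesis using \<tau>' by simp
  qed
  moreover have "bij_betw (lft W) B A"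
    unfolding bij_betw_def using inj A B by (auto simp: image_iff)
  ultimately show ?thesis unfolding parametrized_by_def using B by blast
qed

lemma W_factor_carrier [simp]: "W_factor s x j z \<in> carrier_mat 2 2"
  unfolding W_factor_def Let_def mat_of_rows_list_def by (rule carrier_matI) simp_all

lemma W_factor_index:
  "W_factor s x j z $$ (0, 0) = 0" "W_factor s x j z $$ (0, 1) = - of_real (W_eps s j) / of_real (W_a s j)"
  "W_factor s x j z $$ (1, 0) = of_real (W_eps s j) * of_real (W_a s j)"
  "W_factor s x j z $$ (1, 1) = cpoly (W_p s x j) z / of_real (W_a s j)"
  by (simp_all add: W_factor_def Let_def mat_of_rows_list_def cpoly_def)

lemma mult_2x2_index:
  fixes A B :: "'a::semiring_0 Matrix.mat"
  assumes "A \<in> carrier_mat 2 2" "B \<in> carrier_mat 2 2" "i < 2" "j < 2"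
  shows "(A * B) $$ (i, j) = A $$ (i, 0) * B $$ (0, j) + A $$ (i, 1) * B $$ (1, j)"
  using index_mult_mat_sum[OF assms] by (simp add: numeral_2_eq_2 sum.lessThan_Suc)

text \<open>The factor acts as
  \<open>\<tau> \<mapsto> - 1 / (\<epsilon> p + a\<^sup>2 \<tau>)\<close>. Relative to the fraction
  of \<open>W\<close>, the new numerator and denominator are \<open>- (\<epsilon> / a)\<close> and
  \<open>(\<epsilon> / a) * Q\<close> times the old denominator.\<close>

lemma lft_rel_step:
  assumes rel: "step_rel (Polynomial.smult (W_eps s j) (W_p s x j)) (W_a s j) \<phi> \<tau>1" and eps: "W_eps s j = 1 \<or> W_eps s j = -1"
    and a: "W_a s j > 0" and W: "\<And>z. W z \<in> carrier_mat 2 2" and "lft_rel W \<tau> \<tau>1"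
  shows "lft_rel (\<lambda>z. W_factor s x j z * W z) \<tau> \<phi>"
  unfolding lft_rel_def
  using assms(5)[unfolded lft_rel_def] rel[unfolded step_rel_def, THEN conjunct2, THEN conjunct2]
proof eventually_elim
  case (elim z)
  define e a' where "e = complex_of_real (W_eps s j)" "a' = complex_of_real (W_a s j)"
  have ea: "e * e = 1" "e \<noteq> 0" "a' \<noteq> 0" using eps a by (auto simp: e_a'_def)
  define D where "D = lft_den W \<tau> z"
  have D: "D \<noteq> 0" "W z $$ (0, 0) * \<tau> z + W z $$ (0, 1) = \<tau>1 z * D" using elim by (auto simp: D_def)
  have D': "W z $$ (1, 0) * \<tau> z + W z $$ (1, 1) = D" by (simp add: D_def lft_den_def)
  define Q where "Q = e * cpoly (W_p s x j) z + a'\<^sup>2 * \<tau>1 z"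
  have "cpoly (Polynomial.smult (W_eps s j) (W_p s x j)) z = e * cpoly (W_p s x j) z"
    by (simp add: cpoly_def e_a'_def map_poly_smult)
  then have Q: "Q \<noteq> 0" "\<phi> z = - 1 / Q" using elim by (auto simp: Q_def e_a'_def)
  let ?W = "\<lambda>z. W_factor s x j z * W z"
  note idx = mult_2x2_index[OF W_factor_carrier W] W_factor_index
  have den: "lft_den ?W \<tau> z = (e / a') * Q * D"
  proof -
    have "lft_den ?W \<tau> z = e * a' * (W z $$ (0, 0) * \<tau> z + W z $$ (0, 1)) + cpoly (W_p s x j) z / a' * (W z $$ (1, 0) * \<tau> z + W z $$ (1, 1))"
      unfolding lft_den_def by (simp add: idx W_factor_index[unfolded One_nat_def] e_a'_def algebra_simps del: index_mult_mat(1))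
    also have "\<dots> = (e * a' * \<tau>1 z + (e * e) * cpoly (W_p s x j) z / a') * D"
      unfolding D D' ea by (simp add: algebra_simps)
    also have "\<dots> = (e / a') * Q * D" using ea(3) by (simp add: Q_def field_simps power2_eq_square)
    finally show ?thesis .
  qed
  have num: "?W z $$ (0, 0) * \<tau> z + ?W z $$ (0, 1) = - (e / a') * D"
    unfolding D'[symmetric] by (simp add: idx W_factor_index[unfolded One_nat_def] e_a'_def algebra_simps del: index_mult_mat(1))
  have "\<phi> z * (e / a' * Q * D) = (\<phi> z * Q) * (e / a' * D)" by (simp only: mult_ac)
  also have "\<phi> z * Q = -1" using Q by simp
  finally show ?case unfolding den num using Q D ea by simp
qed

section \<open>The algorithm\<close>

locale schur_data =
  fixes s :: "real list" and x :: real and n :: nat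
  assumes n: "n = (length s - 1) div 2" and len: "length s \<ge> 1"
    and norm: "normalized s" and det: "Determinant.det (hankel s n) \<noteq> 0"
begin

abbreviation "N \<equiv> num_normal s"
abbreviation "ni \<equiv> normal_index s"
abbreviation "ts \<equiv> schur_seq s"

lemma lens: "2 * n + 1 \<le> length s" "length s \<le> 2 * n + 2"
  using n len by presburger+

section \<open>Normal indices as an increasing sequence\<close>

lemma normal_indices_iff:
  "j \<in> normal_indices s \<longleftrightarrow> 1 \<le> j \<and> j \<le> n + 1 \<and> Determinant.det (hankel s (j - 1)) \<noteq> 0"
  by (auto simp: normal_indices_def n)

lemma finite_normal_indices [simp]: "finite (normal_indices s)"
  by (simp add: normal_indices_def)

lemma last_normal: "n + 1 \<in> normal_indices s"
  using det by (simp add: normal_indices_iff)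

lemma N_pos: "N \<ge> 1"
  using last_normal card_gt_0_iff[of "normal_indices s"] by (auto simp: num_normal_def)

lemma ni_0 [simp]: "ni 0 = 0"
  by (simp add: normal_index_def)

lemma ni_Suc: "ni (Suc j) = sorted_list_of_set (normal_indices s) ! j"
  by (simp add: normal_index_def)

lemma length_sorted: "length (sorted_list_of_set (normal_indices s)) = N"
  by (simp add: num_normal_def)

lemma ni_mem: "j < N \<Longrightarrow> ni (Suc j) \<in> normal_indices s"
  unfolding ni_Suc using nth_mem[of j "sorted_list_of_set (normal_indices s)"] by (simp add: num_normal_def)

lemma ni_less:
  assumes "i < j" "j \<le> N"
  shows "ni i < ni j"
proof (cases i)
  case 0
  then show ?thesis using assms ni_mem[of "j - 1"] by (cases j) (auto simp: normal_indices_iff)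
next
  case (Suc i')
  then obtain j' where j: "j = Suc j'" "i' < j'" using assms by (cases j) auto
  then show ?thesis
    unfolding Suc ni_Suc j using sorted_wrt_nth_less[OF strict_sorted_list_of_set, of i' j' "normal_indices s"] assms(2) j
    by (simp add: num_normal_def)
qed

lemma ni_le: "i \<le> j \<Longrightarrow> j \<le> N \<Longrightarrow> ni i \<le> ni j"
  using ni_less[of i j] by (cases "i = j") auto

lemma ni_gap:
  assumes "j < N" "k \<in> normal_indices s" "ni j < k"
  shows "ni (Suc j) \<le> k"
proof -
  obtain i where i: "i < N" "k = ni (Suc i)"
    using assms(2) set_sorted_list_of_set[of "normal_indices s"] unfolding ni_Suc
    by (metis finite_normal_indices in_set_conv_nth length_sorted)
  have "j \<le> i"
  proof (rule ccontr)
    assume "\<not> j \<le> i"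
    then have "ni (Suc i) \<le> ni j" using assms(1) by (intro ni_le) auto
    then show False using assms(3) i by simp
  qed
  then show ?thesis using i by (auto intro: ni_le)
qed

lemma ni_N: "ni N = n + 1"
proof -
  obtain N' where N': "N = Suc N'" using N_pos by (cases N) auto
  have "ni N \<le> n + 1" using ni_mem[of N'] N' by (simp add: normal_indices_iff)
  moreover have "ni N \<ge> n + 1"
  proof (rule ccontr)
    assume *: "\<not> n + 1 \<le> ni N"
    obtain i where i: "i < N" "n + 1 = ni (Suc i)"
      using last_normal set_sorted_list_of_set[of "normal_indices s"] unfolding ni_Suc
      by (metis finite_normal_indices in_set_conv_nth length_sorted)
    then show False using ni_le[of "Suc i" N] * by simp
  qed
  ultimately show ?thesis by simp
qed

lemma ni_le_n: "j < N \<Longrightarrow> ni j \<le> n"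
  using ni_less[of j N] ni_N by simp

section \<open>The invariant of the algorithm\<close>

definition nu :: "nat \<Rightarrow> nat" where
  "nu j = nneg (step_size s (Suc j)) (bezout_coeff (Polynomial.smult (W_eps s (Suc j)) (W_p s x (Suc j))))"

text \<open>The last step takes its polynomial from \<open>last_poly\<close> and leaves nothing
  over, so the sequence at \<open>N\<close> is set to be empty instead of being taken from
  \<open>schur_seq\<close>.\<close>

definition tail_seq :: "nat \<Rightarrow> real list" where
  "tail_seq j = (if j < N then ts j else [])"

text \<open>The determinant clause says that the normal indices of the current sequence are the
  later ones of \<open>s\<close>, shifted by \<open>ni j\<close>. The last clause splits the
  negative eigenvalues into those already accounted for and those of the remaining Hankel
  matrix.\<close>

definition invariant :: "nat \<Rightarrow> bool" where
  "invariant j \<longleftrightarrow> length (ts j) = length s - 2 * ni j \<and> normalized (ts j) \<and>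
    (\<forall>k. ni j + k \<le> n \<longrightarrow> (Determinant.det (hankel (ts j) k) \<noteq> 0 \<longleftrightarrow> ni j + k + 1 \<in> normal_indices s)) \<and>
    nneg (Suc n) (hank s) = (\<Sum>i<j. nu i) + nneg (Suc n - ni j) (hank (ts j))"

definition step_data :: "nat \<Rightarrow> real list \<Rightarrow> bool" where
  "step_data j u \<longleftrightarrow> schur_rel (ts j) (step_size s (Suc j)) (W_eps s (Suc j)) (W_p s x (Suc j)) u \<and>
    W_a s (Suc j) > 0 \<and> map (\<lambda>y. y / (W_a s (Suc j))\<^sup>2) u = tail_seq (Suc j)"

lemma invariant_0: "invariant 0"
  by (auto simp: invariant_def norm normal_indices_iff)

text \<open>With \<open>e\<close> the position of the first nonzero entry, Hankel determinants below
  size \<open>e\<close> vanish and the one of size \<open>e\<close> does not, so by the invariant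
  \<open>ni j + e\<close> is the next normal index and \<open>e\<close> is the step size.\<close>

lemma step_size_props:
  assumes j: "j < N" and inv: "invariant j"
  defines "d \<equiv> step_size s (Suc j)"
  shows "d \<ge> 1" "ni (Suc j) = ni j + d" "\<And>i. i < d - 1 \<Longrightarrow> ts j ! i = 0"
    "ts j ! (d - 1) = 1 \<or> ts j ! (d - 1) = -1"
proof -
  have lt: "ni j < ni (Suc j)" using j by (intro ni_less) auto
  then show d: "d \<ge> 1" "ni (Suc j) = ni j + d" by (auto simp: d_def step_size_def)
  have iff: "Determinant.det (hankel (ts j) k) \<noteq> 0 \<longleftrightarrow> ni j + k + 1 \<in> normal_indices s" if "ni j + k \<le> n" for k
    using inv that by (simp add: invariant_def)
  have "normalized (ts j)" using inv by (simp add: invariant_def)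
  then obtain e where e: "e \<ge> 1" "\<And>i. i < e - 1 \<Longrightarrow> ts j ! i = 0" "ts j ! (e - 1) = 1 \<or> ts j ! (e - 1) = -1"
    by (elim normalizedE) blast
  note z = det_hankel_leading_zeros[of e "ts j", OF e(2)]
  have en: "ni j + e \<le> n + 1"
  proof (rule ccontr)
    assume "\<not> ni j + e \<le> n + 1"
    then have "Determinant.det (hankel (ts j) (n - ni j)) = 0" using ni_le_n[OF j] by (intro z(1)) auto
    then show False using iff[of "n - ni j"] last_normal ni_le_n[OF j] by simp
  qed
  have "ni j + e \<in> normal_indices s" using iff[of "e - 1"] z(2) e(1,3) en by auto
  then have "ni (Suc j) \<le> ni j + e" using e(1) by (intro ni_gap[OF j]) auto
  moreover have "ni j + e \<le> ni (Suc j)"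
  proof (rule ccontr)
    assume *: "\<not> ni j + e \<le> ni (Suc j)"
    have "ni j + (d - 1) + 1 \<in> normal_indices s" using ni_mem[OF j] d by simp
    then have "Determinant.det (hankel (ts j) (d - 1)) \<noteq> 0" using iff[of "d - 1"] * d en by auto
    moreover have "Determinant.det (hankel (ts j) (d - 1)) = 0" using * d by (intro z(1)) auto
    ultimately show False by simp
  qed
  ultimately have "d = e" using d by simp
  then show "\<And>i. i < d - 1 \<Longrightarrow> ts j ! i = 0" "ts j ! (d - 1) = 1 \<or> ts j ! (d - 1) = -1" using e by auto
qed

lemma W_eps_eq: "W_eps s (Suc j) = ts j ! (step_size s (Suc j) - 1)"
  by (simp add: W_eps_def)

lemma step_inner:
  assumes j: "Suc j < N" and inv: "invariant j"
  shows "\<exists>u. step_data j u" "invariant (Suc j)"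
proof -
  have jN: "j < N" using j by simp
  define t d where "t = ts j" and "d = step_size s (Suc j)"
  note d = step_size_props[OF jN inv, folded d_def t_def]
  have i: "length t = length s - 2 * ni j"
    "\<And>k. ni j + k \<le> n \<Longrightarrow> Determinant.det (hankel t k) \<noteq> 0 \<longleftrightarrow> ni j + k + 1 \<in> normal_indices s"
    "nneg (Suc n) (hank s) = (\<Sum>i<j. nu i) + nneg (Suc n - ni j) (hank t)"
    using inv by (simp_all add: invariant_def t_def)
  have nis: "ni j + d \<le> n" using ni_le_n[OF j] d by simp
  have len2: "2 * d \<le> length t" using i(1) nis lens by simp
  define u where "u = snd (schur_pair t d)"
  have sr: "schur_rel t d (t ! (d - 1)) (fst (schur_pair t d)) u"
    unfolding u_def by (rule schur_pair_rel[OF d(1) len2 d(3,4)])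
  have lu: "length u = length t - 2 * d" using sr by (simp add: schur_rel_def)
  have detu: "Determinant.det (hankel t (d + k)) \<noteq> 0 \<longleftrightarrow> Determinant.det (hankel u k) \<noteq> 0" if "ni j + d + k \<le> n" for k
    using det_hankel_step[OF sr, of "d + k"] that i(1) lens by simp
  \<comment> \<open>The remainder cannot vanish: its Hankel determinant at the end of the range is
    nonzero together with that of \<open>s\<close> at \<open>n\<close>. This makes the normalization
    of the next sequence possible.\<close>
  have nz: "\<exists>i<length u. u ! i \<noteq> 0"
  proof (rule ccontr)
    assume "\<not> (\<exists>i<length u. u ! i \<noteq> 0)"
    then have z: "u ! i = 0" if "i < length u" for i using that by auto
    define k where "k = n - ni j - d"
    have "k < length u" using lu i(1) nis lens by (simp add: k_def)
    then have "Determinant.det (hankel u k) = 0" using z by (intro det_hankel_leading_zeros(1)[of "k + 2"]) auto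
    then have "\<not> Determinant.det (hankel t (d + k)) \<noteq> 0" using detu[of k] nis by (simp add: k_def)
    moreover have "Determinant.det (hankel t (d + k)) \<noteq> 0"
      using i(2)[of "d + k"] last_normal nis by (simp add: k_def)
    ultimately show False by simp
  qed
  define a where "a = schur_scale u"
  have a: "a > 0" "normalized (map (\<lambda>y. y / a\<^sup>2) u)" using schur_scale_props nz by (auto simp: a_def)
  have W: "W_a s (Suc j) = a" "W_p s x (Suc j) = fst (schur_pair t d)" "W_eps s (Suc j) = t ! (d - 1)"
    using j by (simp_all add: W_a_def W_p_def a_def u_def t_def d_def W_eps_eq)
  have tsS: "ts (Suc j) = map (\<lambda>y. y / a\<^sup>2) u"
    by (simp add: Let_def a_def u_def t_def d_def)
  have "tail_seq (Suc j) = map (\<lambda>y. y / a\<^sup>2) u"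
    unfolding tail_seq_def tsS using j by simp
  then show "\<exists>u. step_data j u"
    unfolding step_data_def t_def[symmetric] d_def[symmetric] W using sr a by auto
  have hk: "hankel (map (\<lambda>y. y / a\<^sup>2) u) k = (1 / a\<^sup>2) \<cdot>\<^sub>m hankel u k" if "2 * k < length u" for k
    by (rule eq_matI) (use that in \<open>auto simp: hankel_def\<close>)
  show "invariant (Suc j)"
    unfolding invariant_def tsS
  proof (intro conjI allI impI)
    show "length (map (\<lambda>y. y / a\<^sup>2) u) = length s - 2 * ni (Suc j)" using lu i(1) d(2) by simp
    show "normalized (map (\<lambda>y. y / a\<^sup>2) u)" by (rule a)
    fix k assume k: "ni (Suc j) + k \<le> n"
    have k2: "2 * k < length u" using k lu i(1) d(2) lens by simp
    have "Determinant.det (hankel (map (\<lambda>y. y / a\<^sup>2) u) k) \<noteq> 0 \<longleftrightarrow> Determinant.det (hankel u k) \<noteq> 0"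
      unfolding hk[OF k2] det_smult using a(1) by simp
    also have "\<dots> \<longleftrightarrow> Determinant.det (hankel t (d + k)) \<noteq> 0" using detu[of k] k d(2) by simp
    also have "\<dots> \<longleftrightarrow> ni (Suc j) + k + 1 \<in> normal_indices s" using i(2)[of "d + k"] k d(2) by (simp add: add.assoc)
    finally show "Determinant.det (hankel (map (\<lambda>y. y / a\<^sup>2) u) k) \<noteq> 0 \<longleftrightarrow> ni (Suc j) + k + 1 \<in> normal_indices s" .
  next
    have "nneg (Suc n - ni (Suc j)) (hank (map (\<lambda>y. y / a\<^sup>2) u))
      = nneg (Suc n - ni (Suc j)) (\<lambda>i j. of_real (1 / a\<^sup>2) * hank u i j)"
      using lu i(1) d(2) lens by (intro nneg_cong) auto
    also have "\<dots> = nneg (Suc n - ni (Suc j)) (hank u)" using a(1) by (intro nneg_scale[OF herm_hank]) simp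
    finally have sc: "nneg (Suc n - ni (Suc j)) (hank (map (\<lambda>y. y / a\<^sup>2) u)) = nneg (Suc n - ni (Suc j)) (hank u)" .
    have Sk: "Suc n - ni j = Suc (n - ni j)" using ni_le_n[OF jN] by simp
    have "nneg (Suc (n - ni j)) (hank t) = nu j + nneg (Suc (n - ni j) - d) (hank u)"
      unfolding nu_def W d_def[symmetric] using nis i(1) lens by (intro nneg_hankel_step[OF sr]) auto
    also have "Suc (n - ni j) - d = Suc n - ni (Suc j)" using ni_le_n[OF jN] d(2) by simp
    finally show "nneg (Suc n) (hank s) = (\<Sum>i<Suc j. nu i) + nneg (Suc n - ni (Suc j)) (hank (map (\<lambda>y. y / a\<^sup>2) u))"
      unfolding sc i(3) Sk by (simp add: sum.lessThan_Suc)
  qed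
qed

lemma step_last:
  assumes j: "Suc j = N" and inv: "invariant j"
  shows "step_data j []" "nneg (Suc n) (hank s) = (\<Sum>i<N. nu i)"
proof -
  have jN: "j < N" using j by simp
  define t d where "t = ts j" and "d = step_size s (Suc j)"
  note d = step_size_props[OF jN inv, folded d_def t_def]
  have i: "length t = length s - 2 * ni j"
    "nneg (Suc n) (hank s) = (\<Sum>i<j. nu i) + nneg (Suc n - ni j) (hank t)"
    using inv by (simp_all add: invariant_def t_def)
  have nd: "ni j + d = n + 1" using ni_N d(2) j by simp
  \<comment> \<open>The first alternative occurs for odd \<open>\<ell>\<close>, the second for even
    \<open>\<ell>\<close>.\<close>
  have lt: "length t = 2 * d \<or> length t + 1 = 2 * d" using i(1) nd lens by linarith
  have W: "W_a s (Suc j) = 1" "W_p s x (Suc j) = last_poly t (d - 1) x" "W_eps s (Suc j) = t ! (d - 1)"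
  proof -
    have "(length s - 1) div 2 - normal_index s j = d - 1" using n nd by simp
    then show "W_p s x (Suc j) = last_poly t (d - 1) x"
      unfolding W_p_def by (simp add: j[symmetric] t_def)
    show "W_a s (Suc j) = 1" by (simp add: W_a_def j)
    show "W_eps s (Suc j) = t ! (d - 1)" unfolding t_def d_def by (rule W_eps_eq)
  qed
  have sr: "schur_rel t d (t ! (d - 1)) (last_poly t (d - 1) x) []"
    by (rule last_poly_rel[OF lt d(1) d(3) refl d(4)])
  show "step_data j []"
    unfolding step_data_def t_def[symmetric] d_def[symmetric] W using sr j by (simp add: tail_seq_def)
  have "nneg (Suc (n - ni j)) (hank t) = nu j + nneg (Suc (n - ni j) - d) (hank [])"
    unfolding nu_def W d_def[symmetric] using nd i(1) lens ni_le_n[OF jN] by (intro nneg_hankel_step[OF sr]) auto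
  moreover have "Suc (n - ni j) - d = 0" "Suc n - ni j = Suc (n - ni j)" using nd d(1) by auto
  ultimately show "nneg (Suc n) (hank s) = (\<Sum>i<N. nu i)"
    unfolding i(2) j[symmetric] by (simp add: nneg_0 sum.lessThan_Suc)
qed

lemma invariant: "j < N \<Longrightarrow> invariant j"
  by (induction j) (use invariant_0 step_inner(2) in auto)

lemma step_data_exists: "j < N \<Longrightarrow> \<exists>u. step_data j u"
  using step_inner(1)[OF _ invariant] step_last(1)[OF _ invariant] by (cases "Suc j = N") auto

lemma nneg_eq_sum_nu: "nneg (Suc n) (hank s) = (\<Sum>i<N. nu i)"
proof -
  obtain j where "Suc j = N" using N_pos by (cases N) auto
  then show ?thesis using step_last(2)[OF _ invariant, of j] by simp
qed

text \<open>
  The order of the remainder after \<open>j\<close> steps. For \<open>j = N\<close> it is \<open>-1\<close> if \<open>\<ell>\<close> is even and \<open>0\<close> if \<open>\<ell>\<close> is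
  odd, which turns \<open>expands\<close> of the empty sequence into the conditions (E) and (O).
\<close>

definition order_at :: "nat \<Rightarrow> int" where
  "order_at j = int (length s) - 2 * int (ni j)"

text \<open>Solution classes interpolating between the interpolation problem at \<open>j = 0\<close>
  and the set of parameters at \<open>j = N\<close>.\<close>

definition sols :: "int \<Rightarrow> nat \<Rightarrow> (complex \<Rightarrow> complex) set" where
  "sols \<kappa> j = {\<phi> \<in> nev (\<kappa> - int (\<Sum>i<j. nu i)). expands (order_at j) (tail_seq j) \<phi>}"

definition W_tail :: "nat \<Rightarrow> complex \<Rightarrow> complex Matrix.mat" where
  "W_tail j z = foldr (\<lambda>i A. W_factor s x i z * A) [Suc j..<N + 1] (1\<^sub>m 2)"

lemma W_tail_N: "W_tail N z = 1\<^sub>m 2"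
  by (simp add: W_tail_def)

lemma W_tail_Suc: "j < N \<Longrightarrow> W_tail j z = W_factor s x (Suc j) z * W_tail (Suc j) z"
  by (simp add: W_tail_def upt_conv_Cons del: upt_Suc)

lemma W_tail_0: "W_tail 0 = W_prod s x"
  by (rule ext) (simp add: W_tail_def W_prod_def)

lemma W_tail_carrier: "j \<le> N \<Longrightarrow> W_tail j z \<in> carrier_mat 2 2"
proof (induction j rule: inc_induct)
  case base
  then show ?case by (simp add: W_tail_N)
next
  case (step j)
  then show ?case using mult_carrier_mat[OF W_factor_carrier] by (simp add: W_tail_Suc)
qed

lemma W_eps_pm: "j < N \<Longrightarrow> W_eps s (Suc j) = 1 \<or> W_eps s (Suc j) = -1"
  using step_data_exists unfolding step_data_def schur_rel_def by blast

lemma W_a_pos: "j < N \<Longrightarrow> W_a s (Suc j) > 0"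
  using step_data_exists unfolding step_data_def by blast

lemma order_at_eq: "j < N \<Longrightarrow> order_at j = int (length (ts j))"
  using invariant[of j] ni_le_n[of j] lens by (simp add: order_at_def invariant_def)

lemma order_at_Suc: "j < N \<Longrightarrow> order_at (Suc j) = int (length (ts j)) - 2 * int (step_size s (Suc j))"
  using step_size_props(2)[OF _ invariant, of j] order_at_eq[of j] by (simp add: order_at_def)

lemma one_step:
  assumes j: "j < N"
  shows "\<tau> \<in> sols \<kappa> (Suc j) \<Longrightarrow>
      \<exists>\<phi>\<in>sols \<kappa> j. step_rel (Polynomial.smult (W_eps s (Suc j)) (W_p s x (Suc j))) (W_a s (Suc j)) \<phi> \<tau>"
    and "\<phi> \<in> sols \<kappa> j \<Longrightarrow>
      \<exists>\<tau>\<in>sols \<kappa> (Suc j). step_rel (Polynomial.smult (W_eps s (Suc j)) (W_p s x (Suc j))) (W_a s (Suc j)) \<phi> \<tau>"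
proof -
  obtain u where u: "schur_rel (ts j) (step_size s (Suc j)) (W_eps s (Suc j)) (W_p s x (Suc j)) u"
    "W_a s (Suc j) > 0" "map (\<lambda>y. y / (W_a s (Suc j))\<^sup>2) u = tail_seq (Suc j)"
    using step_data_exists[OF j] unfolding step_data_def by blast
  have k: "\<kappa> - int (\<Sum>i<Suc j. nu i) = \<kappa> - int (\<Sum>i<j. nu i)
     - int (nneg (step_size s (Suc j)) (bezout_coeff (Polynomial.smult (W_eps s (Suc j)) (W_p s x (Suc j)))))" for \<kappa>
    by (simp add: sum.lessThan_Suc nu_def)
  have t: "tail_seq j = ts j" using j by (simp add: tail_seq_def)
  show "\<exists>\<phi>\<in>sols \<kappa> j. step_rel (Polynomial.smult (W_eps s (Suc j)) (W_p s x (Suc j))) (W_a s (Suc j)) \<phi> \<tau>"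
    if "\<tau> \<in> sols \<kappa> (Suc j)"
    using step_forward[OF u(1,2), of \<tau>] that
    unfolding sols_def mem_Collect_eq k order_at_Suc[OF j] order_at_eq[OF j] u(3) t by blast
  show "\<exists>\<tau>\<in>sols \<kappa> (Suc j). step_rel (Polynomial.smult (W_eps s (Suc j)) (W_p s x (Suc j))) (W_a s (Suc j)) \<phi> \<tau>"
    if "\<phi> \<in> sols \<kappa> j"
    using step_backward[OF u(1,2), of \<phi>] that
    unfolding sols_def mem_Collect_eq k order_at_Suc[OF j] order_at_eq[OF j] u(3) t by blast
qed

lemma one_step_remainder:
  assumes j: "j < N" and ev: "even (length s)" and \<phi>: "\<phi> \<in> sols \<kappa> j"
    and rel: "step_rel (Polynomial.smult (W_eps s (Suc j)) (W_p s x (Suc j))) (W_a s (Suc j)) \<phi> \<tau>"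
  shows "remainder_integrable (tail_seq j) \<phi> \<longleftrightarrow> remainder_integrable (tail_seq (Suc j)) \<tau>"
proof -
  obtain u where u: "schur_rel (ts j) (step_size s (Suc j)) (W_eps s (Suc j)) (W_p s x (Suc j)) u"
    "W_a s (Suc j) > 0" "map (\<lambda>y. y / (W_a s (Suc j))\<^sup>2) u = tail_seq (Suc j)"
    using step_data_exists[OF j] unfolding step_data_def by blast
  have t: "tail_seq j = ts j" using j by (simp add: tail_seq_def)
  have "even (length (ts j))" using invariant[OF j] ev by (auto simp: invariant_def)
  moreover have "2 * step_size s (Suc j) \<le> length (ts j) + 1" using u(1) unfolding schur_rel_def by blast
  \<comment> \<open>All lengths stay even, so the weaker bound with \<open>+ 1\<close> cannot be
    attained.\<close>
  ultimately have len2: "2 * step_size s (Suc j) \<le> length (ts j)" by presburger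
  have "expands (int (length (ts j))) (ts j) \<phi>" using \<phi> j unfolding sols_def t order_at_eq[OF j] by simp
  then show ?thesis using step_remainder_integrable[OF u(1) rel _ _ len2] u(2) unfolding t u(3) by simp
qed

lemma lft_rel_N: "lft_rel (W_tail N) \<tau> \<tau>"
  unfolding lft_rel_def by (simp add: W_tail_N lft_den_def)

lemma lft_rel_tail:
  assumes j: "j < N" and "step_rel (Polynomial.smult (W_eps s (Suc j)) (W_p s x (Suc j))) (W_a s (Suc j)) \<phi> \<tau>1"
    "lft_rel (W_tail (Suc j)) \<tau> \<tau>1"
  shows "lft_rel (W_tail j) \<tau> \<phi>"
  using lft_rel_step[OF assms(2) W_eps_pm[OF j] W_a_pos[OF j] W_tail_carrier assms(3)] j
  by (simp add: W_tail_Suc[OF j, abs_def])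

text \<open>Downward induction from \<open>j = N\<close>, where the fraction is the identity.
  Integrability is carried along with the relation, so that the same \<open>\<tau>\<close> and
  \<open>\<phi>\<close> serve both the interpolation and the moment problem.\<close>

lemma chain:
  assumes "j \<le> N"
  shows "\<tau> \<in> sols \<kappa> N \<Longrightarrow> \<exists>\<phi>\<in>sols \<kappa> j. lft_rel (W_tail j) \<tau> \<phi> \<and>
      (even (length s) \<longrightarrow> (remainder_integrable (tail_seq j) \<phi> \<longleftrightarrow> remainder_integrable [] \<tau>))"
    and "\<phi> \<in> sols \<kappa> j \<Longrightarrow> \<exists>\<tau>\<in>sols \<kappa> N. lft_rel (W_tail j) \<tau> \<phi> \<and>
      (even (length s) \<longrightarrow> (remainder_integrable (tail_seq j) \<phi> \<longleftrightarrow> remainder_integrable [] \<tau>))"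
proof -
  have tN: "tail_seq N = []" by (simp add: tail_seq_def)
  have "(\<forall>\<tau>\<in>sols \<kappa> N. \<exists>\<phi>\<in>sols \<kappa> j. lft_rel (W_tail j) \<tau> \<phi> \<and>
      (even (length s) \<longrightarrow> (remainder_integrable (tail_seq j) \<phi> \<longleftrightarrow> remainder_integrable [] \<tau>))) \<and>
    (\<forall>\<phi>\<in>sols \<kappa> j. \<exists>\<tau>\<in>sols \<kappa> N. lft_rel (W_tail j) \<tau> \<phi> \<and>
      (even (length s) \<longrightarrow> (remainder_integrable (tail_seq j) \<phi> \<longleftrightarrow> remainder_integrable [] \<tau>)))"
    using assms
  proof (induction j rule: inc_induct)
    case base
    then show ?case using lft_rel_N tN by auto
  next
    case (step j)
    show ?case
    proof (intro conjI ballI)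
      fix \<tau> assume "\<tau> \<in> sols \<kappa> N"
      then obtain \<tau>1 where 1: "\<tau>1 \<in> sols \<kappa> (Suc j)" "lft_rel (W_tail (Suc j)) \<tau> \<tau>1"
        "even (length s) \<longrightarrow> (remainder_integrable (tail_seq (Suc j)) \<tau>1 \<longleftrightarrow> remainder_integrable [] \<tau>)"
        using step.IH by blast
      obtain \<phi> where 2: "\<phi> \<in> sols \<kappa> j"
        "step_rel (Polynomial.smult (W_eps s (Suc j)) (W_p s x (Suc j))) (W_a s (Suc j)) \<phi> \<tau>1"
        using one_step(1)[OF step.hyps(2) 1(1)] by blast
      show "\<exists>\<phi>\<in>sols \<kappa> j. lft_rel (W_tail j) \<tau> \<phi> \<and>
        (even (length s) \<longrightarrow> (remainder_integrable (tail_seq j) \<phi> \<longleftrightarrow> remainder_integrable [] \<tau>))"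
        using 1(3) lft_rel_tail[OF step.hyps(2) 2(2) 1(2)] one_step_remainder[OF step.hyps(2) _ 2] 2(1) by blast
    next
      fix \<phi> assume \<phi>: "\<phi> \<in> sols \<kappa> j"
      then obtain \<tau>1 where 2: "\<tau>1 \<in> sols \<kappa> (Suc j)"
        "step_rel (Polynomial.smult (W_eps s (Suc j)) (W_p s x (Suc j))) (W_a s (Suc j)) \<phi> \<tau>1"
        using one_step(2)[OF step.hyps(2)] by blast
      then obtain \<tau> where 1: "\<tau> \<in> sols \<kappa> N" "lft_rel (W_tail (Suc j)) \<tau> \<tau>1"
        "even (length s) \<longrightarrow> (remainder_integrable (tail_seq (Suc j)) \<tau>1 \<longleftrightarrow> remainder_integrable [] \<tau>)"
        using step.IH by blast
      show "\<exists>\<tau>\<in>sols \<kappa> N. lft_rel (W_tail j) \<tau> \<phi> \<and>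
        (even (length s) \<longrightarrow> (remainder_integrable (tail_seq j) \<phi> \<longleftrightarrow> remainder_integrable [] \<tau>))"
        using 1 lft_rel_tail[OF step.hyps(2) 2(2) 1(2)] one_step_remainder[OF step.hyps(2) _ \<phi> 2(2)] by blast
    qed
  qed
  then show "\<tau> \<in> sols \<kappa> N \<Longrightarrow> \<exists>\<phi>\<in>sols \<kappa> j. lft_rel (W_tail j) \<tau> \<phi> \<and>
      (even (length s) \<longrightarrow> (remainder_integrable (tail_seq j) \<phi> \<longleftrightarrow> remainder_integrable [] \<tau>))"
    and "\<phi> \<in> sols \<kappa> j \<Longrightarrow> \<exists>\<tau>\<in>sols \<kappa> N. lft_rel (W_tail j) \<tau> \<phi> \<and>
      (even (length s) \<longrightarrow> (remainder_integrable (tail_seq j) \<phi> \<longleftrightarrow> remainder_integrable [] \<tau>))"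
    by blast+
qed

text \<open>Determinants multiply, and each factor has determinant
  \<open>\<epsilon>\<^sup>2 = 1\<close>; this is the source of injectivity.\<close>

lemma W_tail_regular:
  assumes "j \<le> N"
  shows "W_tail j z $$ (0, 0) * W_tail j z $$ (1, 1) - W_tail j z $$ (0, 1) * W_tail j z $$ (1, 0) = 1"
    and "i < 2 \<Longrightarrow> k < 2 \<Longrightarrow> (\<lambda>z. W_tail j z $$ (i, k)) meromorphic_on \<complex>\<^sub>+"
proof -
  have "(\<forall>z. W_tail j z $$ (0, 0) * W_tail j z $$ (1, 1) - W_tail j z $$ (0, 1) * W_tail j z $$ (1, 0) = 1) \<and>
    (\<forall>i<2. \<forall>k<2. (\<lambda>z. W_tail j z $$ (i, k)) meromorphic_on \<complex>\<^sub>+)"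
    using assms
  proof (induction j rule: inc_induct)
    case base
    then show ?case by (auto simp: W_tail_N)
  next
    case (step j)
    let ?F = "W_factor s x (Suc j)" and ?W = "W_tail (Suc j)"
    have idx: "W_tail j z $$ (i, k) = ?F z $$ (i, 0) * ?W z $$ (0, k) + ?F z $$ (i, 1) * ?W z $$ (1, k)"
      if "i < 2" "k < 2" for i k z
      unfolding W_tail_Suc[OF step.hyps(2)]
      using step.hyps(2) that by (intro mult_2x2_index[OF W_factor_carrier W_tail_carrier]) auto
    have mF: "(\<lambda>z. ?F z $$ (i, k)) meromorphic_on \<complex>\<^sub>+" if "i < 2" "k < 2" for i k
    proof -
      have "i = 0 \<or> i = 1" "k = 0 \<or> k = 1" using that by auto
      then show ?thesis by (elim disjE) (simp_all only: W_factor_index, auto intro!: meromorphic_intros)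
    qed
    have "W_tail j z $$ (0, 0) * W_tail j z $$ (1, 1) - W_tail j z $$ (0, 1) * W_tail j z $$ (1, 0) = 1" for z
    proof -
      have i2: "(0::nat) < 2" "(1::nat) < 2" by simp_all
      have F: "?F z $$ (0, 0) * ?F z $$ (1, 1) - ?F z $$ (0, 1) * ?F z $$ (1, 0) = 1"
        unfolding W_factor_index using W_eps_pm[OF step.hyps(2)] W_a_pos[OF step.hyps(2)] by auto
      have "W_tail j z $$ (0, 0) * W_tail j z $$ (1, 1) - W_tail j z $$ (0, 1) * W_tail j z $$ (1, 0)
        = (?F z $$ (0, 0) * ?F z $$ (1, 1) - ?F z $$ (0, 1) * ?F z $$ (1, 0)) * (?W z $$ (0, 0) * ?W z $$ (1, 1) - ?W z $$ (0, 1) * ?W z $$ (1, 0))"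
        unfolding idx[OF i2(1) i2(1)] idx[OF i2(1) i2(2)] idx[OF i2(2) i2(1)] idx[OF i2(2) i2(2)]
        by (simp only: algebra_simps)
      then show ?thesis unfolding F using step.IH by simp
    qed
    moreover have "(\<lambda>z. W_tail j z $$ (i, k)) meromorphic_on \<complex>\<^sub>+" if "i < 2" "k < 2" for i k
      unfolding idx[OF that] using mF step.IH that by (intro meromorphic_intros) auto
    ultimately show ?case by blast
  qed
  then show "W_tail j z $$ (0, 0) * W_tail j z $$ (1, 1) - W_tail j z $$ (0, 1) * W_tail j z $$ (1, 0) = 1"
    and "i < 2 \<Longrightarrow> k < 2 \<Longrightarrow> (\<lambda>z. W_tail j z $$ (i, k)) meromorphic_on \<complex>\<^sub>+"
    by blast+
qed

lemma sols_mero_sym: "sols \<kappa> j \<subseteq> mero_sym"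
  by (auto simp: sols_def nev_def)

lemma sols_0: "sols \<kappa> 0 = IP_sols \<kappa> s"
  using N_pos by (auto simp: sols_def IP_sols_def has_expansion_iff order_at_def tail_seq_def)

lemma parametrized_sols: "parametrized_by (IP_sols \<kappa> s) (W_prod s x) (sols \<kappa> N)"
  unfolding sols_0[symmetric] W_tail_0[symmetric]
  by (rule parametrized_byI[OF sols_mero_sym sols_mero_sym])
     (use chain[of 0] W_tail_regular[of 0] in blast)+

lemma parametrized_integrable_sols:
  assumes "even (length s)"
  shows "parametrized_by {\<phi> \<in> IP_sols \<kappa> s. remainder_integrable s \<phi>} (W_prod s x) {\<tau> \<in> sols \<kappa> N. remainder_integrable [] \<tau>}"
proof -
  have t0: "tail_seq 0 = s" using N_pos by (simp add: tail_seq_def)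
  show ?thesis
    unfolding sols_0[symmetric] W_tail_0[symmetric]
  proof (rule parametrized_byI)
    show "\<exists>\<phi>\<in>{\<phi> \<in> sols \<kappa> 0. remainder_integrable s \<phi>}. lft_rel (W_tail 0) \<tau> \<phi>"
      if "\<tau> \<in> {\<tau> \<in> sols \<kappa> N. remainder_integrable [] \<tau>}" for \<tau>
      using chain(1)[of 0 \<tau> \<kappa>] that assms by (auto simp: t0)
    show "\<exists>\<tau>\<in>{\<tau> \<in> sols \<kappa> N. remainder_integrable [] \<tau>}. lft_rel (W_tail 0) \<tau> \<phi>"
      if "\<phi> \<in> {\<phi> \<in> sols \<kappa> 0. remainder_integrable s \<phi>}" for \<phi>
      using chain(2)[of 0 \<phi> \<kappa>] that assms by (auto simp: t0)
  qed (use sols_mero_sym W_tail_regular[of 0] in auto)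
qed

end

section \<open>Solvability and the parametrization theorem\<close>

lemma parametrized_by_empty_iff: "parametrized_by A W B \<Longrightarrow> A \<noteq> {} \<longleftrightarrow> B \<noteq> {}"
  unfolding parametrized_by_def bij_betw_def by auto

lemma nev_nonneg: "\<phi> \<in> nev \<kappa> \<Longrightarrow> \<kappa> \<ge> 0"
  by (auto simp: nev_iff)

text \<open>The remainder for the empty sequence is \<open>\<tau>\<close> itself, and
  \<open>o(1)\<close> already contains the limit condition of \<open>nev_1\<close>.\<close>

lemma nev_1_eq:
  "{\<tau> \<in> nev_1 \<kappa>. nt_smallo \<tau> (\<lambda>z. 1)} = {\<tau> \<in> nev \<kappa>. expands 0 [] \<tau> \<and> remainder_integrable [] \<tau>}"
proof -
  have "nt_lim (\<lambda>z. \<tau> z / z) 0" if "expands 0 [] \<tau>" for \<tau>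
    using expands_imp_nt_small[OF that] by (simp add: nt_lim_def nt_small_def)
  then show ?thesis
    unfolding nev_1_def nt_smallo_one_iff
    by (auto simp: remainder_integrable_def remainder_def Pf_def tail_integrable_def)
qed

theorem theorem5p1:
  fixes s :: "real list" and l n \<kappa> \<nu> :: nat and x :: real
  assumes "length s = l + 1"
    and "n = l div 2"
    and "normalized s"
    and "Determinant.det (hankel s n) \<noteq> 0"
    and "\<nu> = neg_eigs (map_mat complex_of_real (hankel s n))"
  shows "(MP_sols (int \<kappa>) s \<noteq> {} \<longleftrightarrow> \<kappa> \<ge> \<nu>) \<and>
    (even l \<longrightarrow>
       parametrized_by (MP_sols (int \<kappa>) s) (W_prod s x)
         {\<tau> \<in> nev (int \<kappa> - int \<nu>). nt_smallo \<tau> (\<lambda>z. z)} \<and>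
       parametrized_by (IP_sols (int \<kappa>) s) (W_prod s x)
         {\<tau> \<in> nev (int \<kappa> - int \<nu>). nt_smallo \<tau> (\<lambda>z. z)}) \<and>
    (odd l \<longrightarrow>
       parametrized_by (IP_sols (int \<kappa>) s) (W_prod s x)
         {\<tau> \<in> nev (int \<kappa> - int \<nu>). nt_smallo \<tau> (\<lambda>z. 1)} \<and>
       parametrized_by (MP_sols (int \<kappa>) s) (W_prod s x)
         {\<tau> \<in> nev_1 (int \<kappa> - int \<nu>). nt_smallo \<tau> (\<lambda>z. 1)})"
proof -
  interpret schur_data s x n
    by unfold_locales (use assms in auto)
  have \<nu>: "\<nu> = (\<Sum>i<N. nu i)" unfolding assms(5) nneg_hankel nneg_eq_sum_nu ..
  have tN: "tail_seq N = []" by (simp add: tail_seq_def)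
  show ?thesis
  proof (cases "even l")
    case True
    then have l: "l = 2 * n" using assms(2) by simp
    \<comment> \<open>With \<open>length s = 2 * n + 1\<close> and \<open>ni N = n + 1\<close> the
      final order is -1, which is condition (E).\<close>
    have B: "sols (int \<kappa>) N = {\<tau> \<in> nev (int \<kappa> - int \<nu>). nt_smallo \<tau> (\<lambda>z. z)}"
      unfolding sols_def \<nu> tN nt_smallo_id_iff order_at_def ni_N using assms(1) l by simp
    have MP: "MP_sols (int \<kappa>) s = IP_sols (int \<kappa>) s"
    proof (intro equalityI subsetI)
      fix \<phi> assume "\<phi> \<in> MP_sols (int \<kappa>) s"
      then show "\<phi> \<in> IP_sols (int \<kappa>) s"
        by (auto simp: MP_sols_def IP_sols_def nev_neg_def nev_0_def nev_neg_even_def nev_neg_odd_def split: if_splits)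
    next
      fix \<phi> assume "\<phi> \<in> IP_sols (int \<kappa>) s"
      then show "\<phi> \<in> MP_sols (int \<kappa>) s"
        using expansion_imp_nev_neg_even[of \<phi> "int \<kappa>" s n] assms(1) l by (simp add: MP_sols_def IP_sols_def)
    qed
    have par: "parametrized_by (IP_sols (int \<kappa>) s) (W_prod s x) {\<tau> \<in> nev (int \<kappa> - int \<nu>). nt_smallo \<tau> (\<lambda>z. z)}"
      using parametrized_sols[of "int \<kappa>"] B by simp
    have "IP_sols (int \<kappa>) s \<noteq> {} \<longleftrightarrow> \<kappa> \<ge> \<nu>"
      unfolding parametrized_by_empty_iff[OF par]
    proof
      assume "{\<tau> \<in> nev (int \<kappa> - int \<nu>). nt_smallo \<tau> (\<lambda>z. z)} \<noteq> {}"
      then show "\<kappa> \<ge> \<nu>" using nev_nonneg by force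
    next
      assume "\<kappa> \<ge> \<nu>"
      obtain \<tau> where \<tau>: "\<tau> \<in> nev_1 (int (\<kappa> - \<nu>))" "expands 0 [] \<tau>" using nev_1_example by blast
      \<comment> \<open>The example satisfies (O), and therefore also the weaker (E).\<close>
      have "nt_smallo \<tau> (\<lambda>z. z)"
        using expands_imp_nt_small[OF \<tau>(2)] by (simp add: nt_small_iff nt_smallo_id_iff)
      then show "{\<tau> \<in> nev (int \<kappa> - int \<nu>). nt_smallo \<tau> (\<lambda>z. z)} \<noteq> {}"
        using \<tau>(1) \<open>\<kappa> \<ge> \<nu>\<close> by (auto simp: nev_1_def of_nat_diff)
    qed
    then show ?thesis using True par by (simp add: MP)
  next
    case False
    then have l: "l = 2 * n + 1" using assms(2) by presburger
    then have len': "length s = 2 * (n + 1)" using assms(1) by simp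
    \<comment> \<open>Here \<open>length s = 2 * n + 2\<close>, so the final order is 0, which is
      condition (O).\<close>
    have B: "sols (int \<kappa>) N = {\<tau> \<in> nev (int \<kappa> - int \<nu>). expands 0 [] \<tau>}"
      unfolding sols_def \<nu> tN order_at_def ni_N using assms(1) l by simp
    have neg: "nev_neg (int \<kappa>) (length s - 1) = nev_neg_odd (int \<kappa>) (n + 1)"
      using assms(1) l by (simp add: nev_neg_def)
    have MP: "MP_sols (int \<kappa>) s = {\<phi> \<in> nev_neg_odd (int \<kappa>) (n + 1). has_expansion \<phi> s}"
      unfolding MP_sols_def neg ..
    have "MP_sols (int \<kappa>) s = {\<phi> \<in> IP_sols (int \<kappa>) s. remainder_integrable s \<phi>}"
    proof (intro equalityI subsetI)
      fix \<phi> assume \<phi>: "\<phi> \<in> MP_sols (int \<kappa>) s"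
      then have "\<phi> \<in> nev (int \<kappa>)" by (auto simp: MP nev_neg_odd_def)
      then show "\<phi> \<in> {\<phi> \<in> IP_sols (int \<kappa>) s. remainder_integrable s \<phi>}"
        using \<phi> nev_neg_odd_iff[of \<phi> "int \<kappa>" s "n + 1"] len' by (simp add: MP IP_sols_def)
    next
      fix \<phi> assume "\<phi> \<in> {\<phi> \<in> IP_sols (int \<kappa>) s. remainder_integrable s \<phi>}"
      then show "\<phi> \<in> MP_sols (int \<kappa>) s"
        using nev_neg_odd_iff[of \<phi> "int \<kappa>" s "n + 1"] len' by (simp add: MP IP_sols_def)
    qed
    moreover have "{\<tau> \<in> sols (int \<kappa>) N. remainder_integrable [] \<tau>} = {\<tau> \<in> nev_1 (int \<kappa> - int \<nu>). nt_smallo \<tau> (\<lambda>z. 1)}"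
      unfolding B nev_1_eq by auto
    ultimately have par: "parametrized_by (MP_sols (int \<kappa>) s) (W_prod s x) {\<tau> \<in> nev_1 (int \<kappa> - int \<nu>). nt_smallo \<tau> (\<lambda>z. 1)}"
      using parametrized_integrable_sols[of "int \<kappa>"] len' by simp
    have "MP_sols (int \<kappa>) s \<noteq> {} \<longleftrightarrow> \<kappa> \<ge> \<nu>"
      unfolding parametrized_by_empty_iff[OF par]
    proof
      assume "{\<tau> \<in> nev_1 (int \<kappa> - int \<nu>). nt_smallo \<tau> (\<lambda>z. 1)} \<noteq> {}"
      then obtain \<tau> where "\<tau> \<in> nev (int \<kappa> - int \<nu>)" by (auto simp: nev_1_def)
      then show "\<kappa> \<ge> \<nu>" using nev_nonneg by force
    next
      assume "\<kappa> \<ge> \<nu>"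
      obtain \<tau> where \<tau>: "\<tau> \<in> nev_1 (int (\<kappa> - \<nu>))" "expands 0 [] \<tau>" using nev_1_example by blast
      then show "{\<tau> \<in> nev_1 (int \<kappa> - int \<nu>). nt_smallo \<tau> (\<lambda>z. 1)} \<noteq> {}"
        using \<open>\<kappa> \<ge> \<nu>\<close> by (auto simp: of_nat_diff nt_smallo_one_iff)
    qed
    then show ?thesis
      using False par parametrized_sols[of "int \<kappa>"] unfolding B nt_smallo_one_iff by simp
  qed
qed

end
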